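(* Let $d,L\in\mathbb{N}$, $A,B_1,\dots,B_L\in\mathbb{R}^{d\times d}$ and, for $x\in\mathbb{R}^d$, let $(X_t(x))_{t\ge 0}$ be the unique strong solution of the Stratonovich SDE $$dX_t(x)=AX_t(x)\,dt+\sum_{j=1}^{L}B_jX_t(x)\circ dW_j(t),\quad t\ge 0,\qquad X_0(x)=x.$$ Assume that $\{A,B_1,\dots,B_L\}$ is simultaneously unitarily diagonalizable, and let $v_k$, $\lambda_k$, $\mu_{k,j}$, $\widetilde\lambda_k$ be as in the context. Assume $$\Lambda:=\max_{1\le k\le d}\Big(\mathrm{Re}(\lambda_k)+\sum_{j=1}^{L}(\mathrm{Re}(\mu_{k,j}))^2\Big)<0.$$ Then for any positive increasing sequence $(s_n)_{n\in\mathbb{N}}$ with $s_n\to\infty$ as $n\to\infty$ and $\delta_n:=s_{n+1}-s_n>0$, any positive non-increasing sequence $(\varepsilon_n)_{n\in\mathbb{N}}$, any $x\in\mathbb{R}^d$ with $x\ne0$, any $p>1$ and any $n\in\mathbb{N}$, $$\mathbb{P}\Big(\sup_{t\in[s_n,s_{n+1}]}\|X_t(x)\|>\varepsilon_n\|x\|\Big)\le\frac{1}{\varepsilon_n^2\|x\|^2}\Big(\frac{p}{p-1}\Big)^p\exp\Big(2(p^2-p)\delta_n\max_{1\le k\le d}\sum_{j=1}^{L}(\mathrm{Re}(\mu_{k,j}))^2\Big)\sum_{k=1}^{d}|\langle x,v_k\rangle|^2\exp\Big(\Big(2\,\mathrm{Re}(\widetilde\lambda_k)+\sum_{j=1}^{L}|\mu_{k,j}|^2\Big)s_n\Big).$$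 In particular, for $$\Lambda(x):=\max_{1\le k\le d,\ \langle x,v_k\rangle\ne0}\Big(\mathrm{Re}(\lambda_k)+\sum_{j=1}^{L}(\mathrm{Re}(\mu_{k,j}))^2\Big)<0$$ it follows that for all $n\in\mathbb{N}$ $$\mathbb{P}\Big(\sup_{t\in[s_n,s_{n+1}]}\|X_t(x)\|>\varepsilon_n\|x\|\Big)\le\frac{\exp(2\Lambda(x)s_n)}{\varepsilon_n^2}\Big(\frac{p}{p-1}\Big)^p\exp\Big(2(p^2-p)\delta_n\max_{1\le k\le d}\sum_{j=1}^{L}(\mathrm{Re}(\mu_{k,j}))^2\Big).$$
   Context: $W_1,\dots,W_L$ are independent standard one-dimensional Brownian motions on a filtered complete probability space satisfying the usual conditions, and $\circ$ denotes Stratonovich integration. $\|\cdot\|$ is the Euclidean norm and $\langle\cdot,\cdot\rangle$ the standard Hermitian inner product on $\mathbb{C}^d$. $\{A,B_1,\dots,B_L\}$ is simultaneously unitarily diagonalizable if there is a unitary $U\in\mathbb{C}^{d\times d}$ such that $U^{-1}AU$ and all $U^{-1}B_jU$ are diagonal (with possibly complex entries). Equivalently, the same holds for the conjugate transposes $\{A^*,B_1^*,\dots,B_L^*\}$, and then there is an orthonormal basis $\{v_1,\dots,v_d\}$ of $\mathbb{C}^d$ (fixed throughout) and $\lambda_k,\mu_{k,j}\in\mathbb{C}$ with $$A^*v_k=\lambda_kv_k,\qquad B_j^*v_k=\mu_{k,j}v_k,\qquad k\in\{1,\dots,d\},\ j\in\{1,\dots,L\}.$$ Set $\widetilde\lambda_k:=\lambda_k+\frac12\sum_{j=1}^{L}\mu_{k,j}^2$.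 *)

theory Defs
  imports "HOL-Probability.Probability"
begin

section \<open>Linear algebra over the complex numbers\<close>

definition cinner :: "complex ^ 'd \<Rightarrow> complex ^ 'd \<Rightarrow> complex" where
  "cinner x y = (\<Sum>i\<in>UNIV. x $ i * cnj (y $ i))"

definition cvec :: "real ^ 'd \<Rightarrow> complex ^ 'd" where
  "cvec x = (\<chi> i. complex_of_real (x $ i))"

definition cmat :: "real ^ 'd ^ 'd \<Rightarrow> complex ^ 'd ^ 'd" where
  "cmat A = map_matrix complex_of_real A"

definition conj_transpose :: "complex ^ 'd ^ 'd \<Rightarrow> complex ^ 'd ^ 'd" where
  "conj_transpose A = map_matrix cnj (transpose A)"

definition unitary_matrix :: "complex ^ 'd ^ 'd \<Rightarrow> bool" where
  "unitary_matrix U \<longleftrightarrow> conj_transpose U ** U = mat 1 \<and> U ** conj_transpose U = mat 1"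

definition diagonal_matrix :: "complex ^ 'd ^ 'd \<Rightarrow> bool" where
  "diagonal_matrix D \<longleftrightarrow> (\<forall>i j. i \<noteq> j \<longrightarrow> D $ i $ j = 0)"

definition simultaneously_unitarily_diagonalizable :: "(complex ^ 'd ^ 'd) set \<Rightarrow> bool" where
  "simultaneously_unitarily_diagonalizable S \<longleftrightarrow>
     (\<exists>U. unitary_matrix U \<and> (\<forall>A\<in>S. diagonal_matrix (matrix_inv U ** A ** U)))"

definition orthonormal_basis :: "('d \<Rightarrow> complex ^ 'd) \<Rightarrow> bool" where
  "orthonormal_basis v \<longleftrightarrow>
     (\<forall>k l. cinner (v k) (v l) = (if k = l then 1 else 0)) \<and> vec.span (range v) = UNIV"


section \<open>Filtered probability spaces and Brownian motion\<close>

text \<open>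
  Time is the half-line of nonnegative reals, although filtrations and processes are indexed by
  all reals: a process is never evaluated at a negative time, and a filtration on the half-line
  extends to negative times by \<open>F t = F 0\<close>.
\<close>

definition usual_conditions :: "'a measure \<Rightarrow> (real \<Rightarrow> 'a measure) \<Rightarrow> bool" where
  "usual_conditions M F \<longleftrightarrow>
     prob_space M \<and>
     complete_measure M \<and>
     filtration (space M) F \<and>
     (\<forall>t\<ge>0. subalgebra M (F t)) \<and>
     null_sets M \<subseteq> sets (F 0) \<and>
     (\<forall>t\<ge>0. sets (F t) = (\<Inter>u\<in>{t<..}. sets (F u)))"

definition continuous_adapted ::
  "'a measure \<Rightarrow> (real \<Rightarrow> 'a measure) \<Rightarrow> (real \<Rightarrow> 'a \<Rightarrow> 'b::topological_space) \<Rightarrow> bool" where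
  "continuous_adapted M F Y \<longleftrightarrow>
     (\<forall>t\<ge>0. Y t \<in> borel_measurable (F t)) \<and>
     (AE \<omega> in M. continuous_on {0..} (\<lambda>t. Y t \<omega>))"

definition brownian_motion ::
  "'a measure \<Rightarrow> (real \<Rightarrow> 'a measure) \<Rightarrow> (real \<Rightarrow> 'a \<Rightarrow> real) \<Rightarrow> bool" where
  "brownian_motion M F W \<longleftrightarrow>
     continuous_adapted M F W \<and>
     (AE \<omega> in M. W 0 \<omega> = 0) \<and>
     (\<forall>s t. 0 \<le> s \<and> s < t \<longrightarrow>
        distributed M lborel (\<lambda>\<omega>. W t \<omega> - W s \<omega>) (normal_density 0 (sqrt (t - s))) \<and>
        prob_space.indep_set M (sets (F s))
          {(\<lambda>\<omega>. W t \<omega> - W s \<omega>) -` A \<inter> space M | A. A \<in> sets borel})"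

text \<open>Mutual independence of whole processes, viewed as random elements of the product space of
  real functions on the half-line.\<close>

definition independent_processes ::
  "'a measure \<Rightarrow> ('l \<Rightarrow> real \<Rightarrow> 'a \<Rightarrow> real) \<Rightarrow> bool" where
  "independent_processes M W \<longleftrightarrow>
     prob_space.indep_vars M (\<lambda>_. PiM {0..} (\<lambda>_. borel))
       (\<lambda>j \<omega>. restrict (\<lambda>t. W j t \<omega>) {0..}) UNIV"


section \<open>Stochastic integrals with respect to Brownian motion\<close>

text \<open>The values are in the extended nonnegative reals, so that a divergent integral or supremum
  is never mistaken for a small one; measurability is demanded because the measure of a
  non-measurable set is 0 by convention.\<close>

definition tends_to_zero_in_prob :: "'a measure \<Rightarrow> (nat \<Rightarrow> 'a \<Rightarrow> ennreal) \<Rightarrow> bool" where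
  "tends_to_zero_in_prob M Z \<longleftrightarrow>
     (\<forall>m. Z m \<in> borel_measurable M) \<and>
     (\<forall>e>0. (\<lambda>m. measure M {\<omega> \<in> space M. Z m \<omega> > ennreal e}) \<longlonglongrightarrow> 0)"

text \<open>Simple processes \<open>\<Sum>i<n. \<xi>\<^sub>i 1\<^bsub>(\<tau>\<^sub>i, \<tau>\<^sub>i\<^sub>+\<^sub>1]\<^esub>\<close> and their elementary stochastic integrals.\<close>

definition simple_integrand ::
  "(real \<Rightarrow> 'a measure) \<Rightarrow> nat \<Rightarrow> (nat \<Rightarrow> real) \<Rightarrow> (nat \<Rightarrow> 'a \<Rightarrow> real) \<Rightarrow> bool" where
  "simple_integrand F n \<tau> \<xi> \<longleftrightarrow>
     0 \<le> \<tau> 0 \<and> (\<forall>i<n. \<tau> i \<le> \<tau> (Suc i)) \<and>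
     (\<forall>i<n. \<xi> i \<in> borel_measurable (F (\<tau> i)) \<and> (\<exists>K. \<forall>\<omega>. \<bar>\<xi> i \<omega>\<bar> \<le> K))"

definition simple_process ::
  "nat \<Rightarrow> (nat \<Rightarrow> real) \<Rightarrow> (nat \<Rightarrow> 'a \<Rightarrow> real) \<Rightarrow> real \<Rightarrow> 'a \<Rightarrow> real" where
  "simple_process n \<tau> \<xi> t \<omega> = (\<Sum>i<n. \<xi> i \<omega> * indicator {\<tau> i<..\<tau> (Suc i)} t)"

definition simple_integral ::
  "(real \<Rightarrow> 'a \<Rightarrow> real) \<Rightarrow> nat \<Rightarrow> (nat \<Rightarrow> real) \<Rightarrow> (nat \<Rightarrow> 'a \<Rightarrow> real) \<Rightarrow> real \<Rightarrow> 'a \<Rightarrow> real" where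
  "simple_integral W n \<tau> \<xi> t \<omega> =
     (\<Sum>i<n. \<xi> i \<omega> * (W (min (\<tau> (Suc i)) t) \<omega> - W (min (\<tau> i) t) \<omega>))"

text \<open>\<open>I\<close> is the It\^o integral process of the continuous adapted integrand \<open>H\<close> against the Brownian
  motion \<open>W\<close>: the limit, locally uniformly in time in probability, of the integrals of simple
  processes that converge to \<open>H\<close> in \<open>L\<^sup>2\<close> of each \<open>[0, t]\<close> in probability.\<close>

definition is_ito_integral ::
  "'a measure \<Rightarrow> (real \<Rightarrow> 'a measure) \<Rightarrow> (real \<Rightarrow> 'a \<Rightarrow> real) \<Rightarrow> (real \<Rightarrow> 'a \<Rightarrow> real)
     \<Rightarrow> (real \<Rightarrow> 'a \<Rightarrow> real) \<Rightarrow> bool" where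
  "is_ito_integral M F W H I \<longleftrightarrow>
     continuous_adapted M F H \<and> continuous_adapted M F I \<and>
     (\<exists>n \<tau> \<xi>.
        (\<forall>m. simple_integrand F (n m) (\<tau> m) (\<xi> m)) \<and>
        (\<forall>t\<ge>0.
           tends_to_zero_in_prob M
             (\<lambda>m \<omega>. \<integral>\<^sup>+ s\<in>{0..t}.
                ennreal ((simple_process (n m) (\<tau> m) (\<xi> m) s \<omega> - H s \<omega>)\<^sup>2) \<partial>lborel) \<and>
           tends_to_zero_in_prob M
             (\<lambda>m \<omega>. SUP s\<in>{0..t}.
                ennreal \<bar>simple_integral W (n m) (\<tau> m) (\<xi> m) s \<omega> - I s \<omega>\<bar>)))"

definition partition_sequence :: "real \<Rightarrow> (nat \<Rightarrow> nat) \<Rightarrow> (nat \<Rightarrow> nat \<Rightarrow> real) \<Rightarrow> bool" where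
  "partition_sequence t n \<tau> \<longleftrightarrow>
     (\<forall>m. \<tau> m 0 = 0 \<and> \<tau> m (n m) = t \<and> (\<forall>i<n m. \<tau> m i \<le> \<tau> m (Suc i))) \<and>
     (\<forall>\<delta>>0. \<forall>\<^sub>F m in sequentially. \<forall>i<n m. \<tau> m (Suc i) - \<tau> m i < \<delta>)"

definition finite_variation :: "(real \<Rightarrow> real) \<Rightarrow> bool" where
  "finite_variation f \<longleftrightarrow>
     (\<forall>t\<ge>0. \<exists>K. \<forall>n \<tau>. \<tau> 0 = 0 \<and> \<tau> n = t \<and> (\<forall>i<n. \<tau> i \<le> \<tau> (Suc i)) \<longrightarrow>
        (\<Sum>i<n. \<bar>f (\<tau> (Suc i)) - f (\<tau> i)\<bar>) \<le> K)"

definition is_quadratic_covariation ::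
  "'a measure \<Rightarrow> (real \<Rightarrow> 'a measure) \<Rightarrow> (real \<Rightarrow> 'a \<Rightarrow> real) \<Rightarrow> (real \<Rightarrow> 'a \<Rightarrow> real)
     \<Rightarrow> (real \<Rightarrow> 'a \<Rightarrow> real) \<Rightarrow> bool" where
  "is_quadratic_covariation M F Y Z C \<longleftrightarrow>
     continuous_adapted M F C \<and>
     (AE \<omega> in M. finite_variation (\<lambda>t. C t \<omega>)) \<and>
     (\<forall>t\<ge>0. \<forall>n \<tau>. partition_sequence t n \<tau> \<longrightarrow>
        tends_to_zero_in_prob M
          (\<lambda>m \<omega>. ennreal \<bar>(\<Sum>i<n m. (Y (\<tau> m (Suc i)) \<omega> - Y (\<tau> m i) \<omega>) *
                                      (Z (\<tau> m (Suc i)) \<omega> - Z (\<tau> m i) \<omega>)) - C t \<omega>\<bar>))"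

text \<open>The Stratonovich integral of \<open>Y\<close> is the It\^o integral plus half the covariation with \<open>W\<close>.
  It is usually defined for continuous semimartingales \<open>Y\<close>, for which the covariation exists as a
  continuous process of finite variation; here only that existence is required. It makes every
  solution of the equation below (an initial value plus It\^o integrals plus processes of finite
  variation) a continuous semimartingale.\<close>

definition is_stratonovich_integral ::
  "'a measure \<Rightarrow> (real \<Rightarrow> 'a measure) \<Rightarrow> (real \<Rightarrow> 'a \<Rightarrow> real) \<Rightarrow> (real \<Rightarrow> 'a \<Rightarrow> real)
     \<Rightarrow> (real \<Rightarrow> 'a \<Rightarrow> real) \<Rightarrow> bool" where
  "is_stratonovich_integral M F W Y S \<longleftrightarrow>
     (\<exists>I C. is_ito_integral M F W Y I \<and> is_quadratic_covariation M F Y W C \<and>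
        (\<forall>t \<omega>. S t \<omega> = I t \<omega> + 1/2 * C t \<omega>))"

text \<open>\<open>X\<close> solves \<open>dX = A X dt + (\<Sum>j. B\<^sub>j X \<circ> dW\<^sub>j)\<close>, \<open>X\<^sub>0 = x\<close>, on the given filtered space with the
  given Brownian motions; the Stratonovich integrals are taken componentwise.\<close>

definition linear_stratonovich_solution ::
  "'a measure \<Rightarrow> (real \<Rightarrow> 'a measure) \<Rightarrow> ('l::finite \<Rightarrow> real \<Rightarrow> 'a \<Rightarrow> real) \<Rightarrow>
     real ^ 'd ^ 'd \<Rightarrow> ('l \<Rightarrow> real ^ 'd ^ 'd) \<Rightarrow> real ^ 'd \<Rightarrow> (real \<Rightarrow> 'a \<Rightarrow> real ^ 'd) \<Rightarrow> bool" where
  "linear_stratonovich_solution M F W A B x X \<longleftrightarrow>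
     continuous_adapted M F X \<and>
     (\<exists>S :: 'l \<Rightarrow> real \<Rightarrow> 'a \<Rightarrow> real ^ 'd.
        (\<forall>j i. is_stratonovich_integral M F (W j)
                 (\<lambda>t \<omega>. (B j *v X t \<omega>) $ i) (\<lambda>t \<omega>. S j t \<omega> $ i)) \<and>
        (AE \<omega> in M. \<forall>t\<ge>0.
           X t \<omega> = x + integral {0..t} (\<lambda>s. A *v X s \<omega>) + (\<Sum>j\<in>UNIV. S j t \<omega>)))"

end

theory Submission
  imports Defs
begin

text \<open>The coordinates \<open>\<langle>X t, v k\<rangle>\<close> solve scalar linear Stratonovich equations, whose solutions are
  explicit exponentials of the Brownian motions. Hence \<open>\<parallel>X t\<parallel>\<^sup>2\<close> is a positive combination of
  exponential processes whose drifts are negative because \<open>\<Lambda> < 0\<close>: it is a nonnegative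
  supermartingale, and the weak maximal inequality bounds the probability even without the two
  factors depending on \<open>p\<close>, which are at least 1.

  The explicit solution is obtained without Ito's formula. Along dyadic grids, refined at a
  rate that may depend on the sample point so that all Riemann sums converge, the product of a
  coordinate with the inverse exponential is telescoped; the second-order terms cancel pathwise, so
  that the covariations of the Brownian motions never have to be known.\<close>

section \<open>Dyadic grids\<close>

text \<open>The Ito integrals are specified only through limits in probability, so none of their
  moments is at hand. In place of the isometry stands a domination inequality: with a truncated
  integrand, the probability that the squared elementary sums exceed \<open>\<alpha>\<close> while
  the accumulated squared integrand stays below \<open>\<beta>\<close> is at most
  \<open>\<beta> / \<alpha>\<close>, and this survives the passage from simple processes to the
  integrand itself. The covariations are likewise known only at fixed times and in probability; a
  single subsequence of dyadic levels makes countably many such limits almost sure. Of the quadratic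
  variations of the Brownian motions just a bound is wanted: their sums have expectation
  \<open>T\<close> on every level, so by Fatou's lemma the lower limit is finite almost surely. The
  levels at which the sums stay bounded vary with the sample point, and this is why the refinement
  does too.\<close>

definition dyadic :: "real \<Rightarrow> nat \<Rightarrow> nat \<Rightarrow> real" where
  "dyadic T m l = T * real l / 2 ^ m"

lemma dyadic_simps [simp]: "dyadic T m 0 = 0" "dyadic T m (2 ^ m) = T"
  by (simp_all add: dyadic_def)

lemma dyadic_mono: "0 \<le> T \<Longrightarrow> mono (dyadic T m)"
  by (auto intro!: monoI divide_right_mono mult_left_mono simp: dyadic_def)

lemma dyadic_step: "dyadic T m (Suc l) - dyadic T m l = T / 2 ^ m"
  by (simp add: dyadic_def field_simps)

lemma dyadic_mem: "0 \<le> T \<Longrightarrow> l \<le> 2 ^ m \<Longrightarrow> dyadic T m l \<in> {0..T}"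
  using monoD[OF dyadic_mono, of T 0 l m] monoD[OF dyadic_mono, of T l "2 ^ m" m] by simp

lemma interval_small_osc:
  fixes f :: "real \<Rightarrow> 'b::metric_space"
  assumes f: "continuous_on {0..T} f" and e: "0 < e"
  shows "\<exists>\<delta>>0. \<forall>u\<in>{0..T}. \<forall>v\<in>{0..T}. \<bar>u - v\<bar> \<le> \<delta> \<longrightarrow> dist (f u) (f v) \<le> e"
proof -
  have "uniformly_continuous_on {0..T} f" using f by (intro compact_uniformly_continuous) auto
  then obtain d where d: "0 < d" "\<And>u v. u \<in> {0..T} \<Longrightarrow> v \<in> {0..T} \<Longrightarrow> dist u v < d \<Longrightarrow> dist (f u) (f v) < e"
    unfolding uniformly_continuous_on_def using e by metis
  show ?thesis
  proof (intro exI[of _ "d/2"] conjI ballI impI)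
    fix u v assume "u \<in> {0..T}" "v \<in> {0..T}" "\<bar>u - v\<bar> \<le> d/2"
    then show "dist (f u) (f v) \<le> e" using d(1) by (intro less_imp_le d(2)) (auto simp: dist_real_def)
  qed (use d in auto)
qed

lemma dyadic_small_osc:
  fixes f :: "real \<Rightarrow> 'b::metric_space"
  assumes T: "0 < T" and f: "continuous_on {0..T} f" and e: "0 < e"
  shows "\<forall>\<^sub>F m in sequentially. \<forall>l<2^m. \<forall>s\<in>{dyadic T m l..dyadic T m (Suc l)}. dist (f s) (f (dyadic T m l)) \<le> e"
proof -
  obtain d where d: "0 < d" "\<And>u v. u \<in> {0..T} \<Longrightarrow> v \<in> {0..T} \<Longrightarrow> \<bar>u - v\<bar> \<le> d \<Longrightarrow> dist (f u) (f v) \<le> e"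
    using interval_small_osc[OF f e] by metis
  have "(\<lambda>m. T * (1/2) ^ m) \<longlonglongrightarrow> T * 0"
    by (intro tendsto_intros LIMSEQ_power_zero) auto
  then have "(\<lambda>m. T / 2 ^ m) \<longlonglongrightarrow> 0" by (simp add: power_divide)
  then have "\<forall>\<^sub>F m in sequentially. T / 2 ^ m < d" using d by (intro order_tendstoD(2))
  then show ?thesis
  proof eventually_elim
    case (elim m)
    show ?case
    proof (intro allI impI ballI d(2))
      fix l s assume l: "l < 2 ^ m" and s: "s \<in> {dyadic T m l..dyadic T m (Suc l)}"
      have m: "dyadic T m l \<in> {0..T}" "dyadic T m (Suc l) \<in> {0..T}"
        using l T by (auto intro!: dyadic_mem simp del: atLeastAtMost_iff)
      show "s \<in> {0..T}" using s m by auto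
      show "\<bar>s - dyadic T m l\<bar> \<le> d" using s dyadic_step[of T m l] elim by auto
      show "dyadic T m l \<in> {0..T}" by fact
    qed
  qed
qed

section \<open>Convergence in probability\<close>

lemma exists_strict_mono_above:
  fixes m0 :: "nat \<Rightarrow> nat"
  obtains h where "strict_mono h" "\<And>n. m0 n \<le> h n"
proof
  let ?h = "\<lambda>n. \<Sum>k\<le>n. Suc (m0 k)"
  show "strict_mono ?h" by (rule strict_monoI_Suc) simp
  show "m0 n \<le> ?h n" for n
    by (rule order_trans[OF _ member_le_sum[of n]]) auto
qed

text \<open>One subsequence has to serve the whole family. Level \<open>h n\<close> is so large that
  each of the members 0 to n exceeds (1/2)^n with probability below (1/2)^n; Borel-Cantelli is then
  applied to every member separately, and countably many null sets are discarded.\<close>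

lemma tends_in_prob_subseq:
  assumes "prob_space M" and Z: "countable Z" "\<And>f. f \<in> Z \<Longrightarrow> tends_to_zero_in_prob M f"
  obtains h where "strict_mono h" "AE \<omega> in M. \<forall>f\<in>Z. (\<lambda>n. f (h n) \<omega>) \<longlonglongrightarrow> 0"
proof (cases "Z = {}")
  case True
  then show ?thesis using that[of id] by (auto simp: strict_mono_id)
next
  case False
  interpret prob_space M by fact
  define c where "c = from_nat_into Z"
  have cZ: "c i \<in> Z" for i using False unfolding c_def by (rule from_nat_into)
  have rc: "range c = Z" unfolding c_def using False Z by (simp add: range_from_nat_into)
  have meas [measurable]: "c i m \<in> borel_measurable M" for i m
    using Z(2)[OF cZ[of i]] by (simp add: tends_to_zero_in_prob_def)
  have lim: "(\<lambda>m. measure M {\<omega> \<in> space M. c i m \<omega> > ennreal e}) \<longlonglongrightarrow> 0" if "e > 0" for i e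
    using Z(2)[OF cZ[of i]] that by (simp add: tends_to_zero_in_prob_def)
  have "\<exists>m0. \<forall>m\<ge>m0. \<forall>i\<in>{..n}. measure M {\<omega> \<in> space M. c i m \<omega> > ennreal ((1/2)^n)} < (1/2)^n" for n :: nat
  proof -
    have "\<forall>\<^sub>F m in sequentially. \<forall>i\<in>{..n}. measure M {\<omega> \<in> space M. c i m \<omega> > ennreal ((1/2)^n)} < (1/2)^n"
      by (intro eventually_ball_finite finite_atMost ballI order_tendstoD(2)[OF lim]) auto
    then show ?thesis by (simp add: eventually_sequentially)
  qed
  then obtain m0 where m0: "\<And>n m i. m \<ge> m0 n \<Longrightarrow> i \<le> n \<Longrightarrow>
      measure M {\<omega> \<in> space M. c i m \<omega> > ennreal ((1/2)^n)} < (1/2)^n" for n :: nat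
    by (metis atMost_iff)
  obtain h where h: "strict_mono h" "\<And>n. m0 n \<le> h n" using exists_strict_mono_above by blast
  have "AE \<omega> in M. (\<lambda>n. c i (h n) \<omega>) \<longlonglongrightarrow> 0" for i
  proof -
    \<comment> \<open>The shift by \<open>i\<close> is there because the choice of \<open>h\<close>
      controls member \<open>i\<close> only from index \<open>i\<close> on.\<close>
    define B where "B n = {\<omega> \<in> space M. c i (h (n + i)) \<omega> > ennreal ((1/2)^(n + i))}" for n
    have "AE \<omega> in M. eventually (\<lambda>n. \<omega> \<in> space M - B n) sequentially"
    proof (rule borel_cantelli_AE1)
      show "B n \<in> sets M" for n unfolding B_def by measurable
      show "emeasure M (B n) < \<infinity>" for n by (simp add: emeasure_eq_measure)
      show "summable (\<lambda>n. measure M (B n))"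
      proof (rule summable_comparison_test'[where N = 0])
        show "summable (\<lambda>n. (1/2)^i * (1/2 :: real)^n)" by (intro summable_mult summable_geometric) auto
        show "norm (measure M (B n)) \<le> (1/2)^i * (1/2)^n" for n
          using m0[of "n + i" "h (n + i)" i] h(2)[of "n + i"] by (simp add: B_def power_add mult.commute)
      qed
    qed
    then show ?thesis
    proof (eventually_elim)
      fix \<omega> assume "eventually (\<lambda>n. \<omega> \<in> space M - B n) sequentially"
      then have "\<forall>\<^sub>F n in sequentially. c i (h (n + i)) \<omega> \<le> ennreal ((1/2)^(n + i))"
        by eventually_elim (auto simp: B_def not_less)
      moreover have "(\<lambda>n. ennreal ((1/2)^(n + i))) \<longlonglongrightarrow> 0"
        using tendsto_ennrealI[OF LIMSEQ_ignore_initial_segment[OF LIMSEQ_power_zero[of "1/2 :: real"], of i]]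
        by simp
      ultimately have "(\<lambda>n. c i (h (n + i)) \<omega>) \<longlonglongrightarrow> 0"
        by (rule tendsto_sandwich[OF _ _ tendsto_const, rotated -2]) auto
      then show "(\<lambda>n. c i (h n) \<omega>) \<longlonglongrightarrow> 0" by (rule LIMSEQ_offset)
    qed
  qed
  then have "AE \<omega> in M. \<forall>i. (\<lambda>n. c i (h n) \<omega>) \<longlonglongrightarrow> 0" by (simp add: AE_all_countable)
  then have "AE \<omega> in M. \<forall>f\<in>Z. (\<lambda>n. f (h n) \<omega>) \<longlonglongrightarrow> 0"
    unfolding rc[symmetric] by simp
  with h(1) show ?thesis using that by blast
qed

text \<open>An argument in the style of Lenglart's inequality: \<open>g m q\<close> approximates
  \<open>g0 m\<close> and is dominated by \<open>V m q\<close> in the sense of \<open>est\<close>.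
  The bound \<open>b / a\<close> depends neither on \<open>m\<close> nor on \<open>q\<close>, so it
  passes to the limit in \<open>q\<close> by continuity from below; as the dominating quantity
  becomes small with \<open>m\<close>, \<open>b\<close> may then be taken small compared with
  \<open>a\<close>.\<close>

lemma tends_in_prob_double_limit:
  fixes g V :: "nat \<Rightarrow> nat \<Rightarrow> 'a \<Rightarrow> ennreal" and g0 :: "nat \<Rightarrow> 'a \<Rightarrow> ennreal"
  assumes "prob_space M"
    and [measurable]: "\<And>m q. g m q \<in> borel_measurable M" "\<And>m q. V m q \<in> borel_measurable M"
      "\<And>m. g0 m \<in> borel_measurable M"
    and lim: "AE \<omega> in M. \<forall>m. (\<lambda>q. g m q \<omega>) \<longlonglongrightarrow> g0 m \<omega>"
    and V: "AE \<omega> in M. (\<lambda>m. limsup (\<lambda>q. V m q \<omega>)) \<longlonglongrightarrow> 0"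
    and est: "\<And>m q a b. 0 < a \<Longrightarrow> 0 < b \<Longrightarrow>
       measure M {\<omega> \<in> space M. g m q \<omega> > ennreal a \<and> V m q \<omega> \<le> ennreal b} \<le> b / a"
  shows "tends_to_zero_in_prob M g0"
  unfolding tends_to_zero_in_prob_def
proof (intro conjI allI impI)
  interpret prob_space M by fact
  fix a :: real assume a: "0 < a"
  define U where "U m \<omega> = limsup (\<lambda>q. V m q \<omega>)" for m \<omega>
  have [measurable]: "U m \<in> borel_measurable M" for m unfolding U_def by measurable
  have key: "measure M {\<omega> \<in> space M. g0 m \<omega> > ennreal a \<and> U m \<omega> < ennreal b} \<le> b / a" if b: "0 < b" for m b
  proof -
    \<comment> \<open>Both inequalities hold for all large \<open>q\<close>, with a threshold that
      depends on the sample point. The events \<open>S Q\<close> fix the threshold; their increasing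
      union contains the event in question up to a null set.\<close>
    define S where "S Q = {\<omega> \<in> space M. \<forall>q\<ge>Q. g m q \<omega> > ennreal a \<and> V m q \<omega> \<le> ennreal b}" for Q
    have [measurable]: "S Q \<in> sets M" for Q unfolding S_def by measurable
    have inc: "incseq S" unfolding S_def incseq_def by auto
    have "measure M {\<omega> \<in> space M. g0 m \<omega> > ennreal a \<and> U m \<omega> < ennreal b} \<le> measure M (\<Union>Q. S Q)"
    proof (rule finite_measure_mono_AE)
      show "AE \<omega> in M. \<omega> \<in> {\<omega> \<in> space M. g0 m \<omega> > ennreal a \<and> U m \<omega> < ennreal b} \<longrightarrow> \<omega> \<in> (\<Union>Q. S Q)"
        using lim
      proof eventually_elim
        case (elim \<omega>)
        show ?case
        proof
          assume *: "\<omega> \<in> {\<omega> \<in> space M. g0 m \<omega> > ennreal a \<and> U m \<omega> < ennreal b}"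
          then have "\<forall>\<^sub>F q in sequentially. g m q \<omega> > ennreal a"
            using elim by (intro order_tendstoD(1)[where y = "g0 m \<omega>"]) auto
          moreover have "\<forall>\<^sub>F q in sequentially. V m q \<omega> < ennreal b"
            using * unfolding U_def by (auto intro: Limsup_lessD)
          ultimately have "\<forall>\<^sub>F q in sequentially. g m q \<omega> > ennreal a \<and> V m q \<omega> \<le> ennreal b"
            by eventually_elim auto
          then show "\<omega> \<in> (\<Union>Q. S Q)" using * by (auto simp: S_def eventually_sequentially)
        qed
      qed
    qed measurable
    also have "\<dots> \<le> b / a"
    proof (rule LIMSEQ_le_const2)
      show "(\<lambda>Q. measure M (S Q)) \<longlonglongrightarrow> measure M (\<Union>Q. S Q)"
        using inc by (intro finite_Lim_measure_incseq) auto
      show "\<exists>N. \<forall>Q\<ge>N. measure M (S Q) \<le> b / a"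
      proof (intro exI allI impI)
        fix Q :: nat
        have "measure M (S Q) \<le> measure M {\<omega> \<in> space M. g m Q \<omega> > ennreal a \<and> V m Q \<omega> \<le> ennreal b}"
          by (intro finite_measure_mono) (auto simp: S_def)
        also have "\<dots> \<le> b / a" using est a b by blast
        finally show "measure M (S Q) \<le> b / a" .
      qed
    qed
    finally show ?thesis .
  qed
  have U0: "(\<lambda>m. measure M {\<omega> \<in> space M. U m \<omega> \<ge> ennreal b}) \<longlonglongrightarrow> 0" if b: "0 < b" for b
  proof -
    \<comment> \<open>Almost sure convergence of \<open>U\<close> becomes convergence in probability
      through its tails: the events \<open>R m\<close> decrease to a null set.\<close>
    define R where "R m = {\<omega> \<in> space M. \<exists>k\<ge>m. U k \<omega> \<ge> ennreal b}" for m
    have [measurable]: "R m \<in> sets M" for m unfolding R_def by measurable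
    have "(\<lambda>m. measure M (R m)) \<longlonglongrightarrow> measure M (\<Inter>m. R m)"
      by (intro finite_Lim_measure_decseq) (auto simp: R_def decseq_def intro: order_trans)
    moreover have "measure M (\<Inter>m. R m) = 0"
    proof -
      have "AE \<omega> in M. \<omega> \<notin> (\<Inter>m. R m)"
        using V
      proof eventually_elim
        case (elim \<omega>)
        then have "\<forall>\<^sub>F m in sequentially. U m \<omega> < ennreal b"
          using b unfolding U_def by (intro order_tendstoD(2)) auto
        then obtain m where "\<And>k. k \<ge> m \<Longrightarrow> U k \<omega> < ennreal b" by (auto simp: eventually_sequentially)
        then have "\<omega> \<notin> R m" unfolding R_def using leD by blast
        then show ?case by auto
      qed
      then show ?thesis by (subst prob_eq_0) (auto intro: sets.countable_INT'')
    qed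
    ultimately have "(\<lambda>m. measure M (R m)) \<longlonglongrightarrow> 0" by simp
    then show ?thesis
      by (rule tendsto_sandwich[OF _ _ tendsto_const, rotated -1])
        (auto intro!: always_eventually finite_measure_mono simp: R_def)
  qed
  show "(\<lambda>m. measure M {\<omega> \<in> space M. g0 m \<omega> > ennreal a}) \<longlonglongrightarrow> 0"
  proof (rule order_tendstoI)
    fix c :: real assume "c < 0"
    then show "\<forall>\<^sub>F m in sequentially. c < measure M {\<omega> \<in> space M. g0 m \<omega> > ennreal a}"
      by (intro always_eventually allI) (rule less_le_trans, auto)
  next
    fix c :: real assume c: "0 < c"
    \<comment> \<open>With this value \<open>b / a\<close> is \<open>c / 2\<close>, which leaves the
      other half of \<open>c\<close> for the exceptional event where \<open>U m\<close> is not below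
      \<open>b\<close>.\<close>
    define b where "b = a * c / 2"
    have b: "0 < b" using a c by (simp add: b_def)
    have "\<forall>\<^sub>F m in sequentially. measure M {\<omega> \<in> space M. U m \<omega> \<ge> ennreal b} < c / 2"
      using c by (intro order_tendstoD(2)[OF U0[OF b]]) auto
    then show "\<forall>\<^sub>F m in sequentially. measure M {\<omega> \<in> space M. g0 m \<omega> > ennreal a} < c"
    proof eventually_elim
      case (elim m)
      have "measure M {\<omega> \<in> space M. g0 m \<omega> > ennreal a} \<le>
        measure M ({\<omega> \<in> space M. g0 m \<omega> > ennreal a \<and> U m \<omega> < ennreal b} \<union> {\<omega> \<in> space M. U m \<omega> \<ge> ennreal b})"
        by (intro finite_measure_mono) auto
      also have "\<dots> \<le> measure M {\<omega> \<in> space M. g0 m \<omega> > ennreal a \<and> U m \<omega> < ennreal b} +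
         measure M {\<omega> \<in> space M. U m \<omega> \<ge> ennreal b}"
        by (intro measure_Un_le) measurable
      also have "\<dots> < b / a + c / 2" using key[OF b, of m] elim by linarith
      also have "\<dots> = c" using a by (simp add: b_def)
      finally show ?case .
    qed
  qed
qed measurable

section \<open>Sums of increments of a Brownian motion\<close>

locale filtered_brownian_motion = prob_space M for M :: "'a measure" +
  fixes F :: "real \<Rightarrow> 'a measure" and W :: "real \<Rightarrow> 'a \<Rightarrow> real"
  assumes usual: "usual_conditions M F" and bm: "brownian_motion M F W"
begin

lemma subalgebra_F: "0 \<le> t \<Longrightarrow> subalgebra M (F t)"
  using usual by (simp add: usual_conditions_def)

lemma space_F: "space (F t) = space M"
proof -
  have "filtration (space M) F" using usual unfolding usual_conditions_def by auto
  then show ?thesis by (rule filtration.space_F)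
qed

lemma F_measurable_M: "f \<in> borel_measurable (F t) \<Longrightarrow> 0 \<le> t \<Longrightarrow> f \<in> borel_measurable M"
  by (rule measurable_from_subalg[OF subalgebra_F])

lemma F_measurable_mono: "f \<in> borel_measurable (F s) \<Longrightarrow> s \<le> t \<Longrightarrow> f \<in> borel_measurable (F t)"
proof -
  assume "f \<in> borel_measurable (F s)" "s \<le> t"
  moreover have "subalgebra (F t) (F s)"
    using usual filtration.sets_F_mono[of "space M" F s t] \<open>s \<le> t\<close>
    by (auto simp: subalgebra_def space_F usual_conditions_def)
  ultimately show ?thesis by (intro measurable_from_subalg[of "F t" "F s"])
qed

lemma W_adapted: "0 \<le> t \<Longrightarrow> W t \<in> borel_measurable (F t)"
  using bm unfolding brownian_motion_def continuous_adapted_def by blast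

lemma W_measurable: "0 \<le> t \<Longrightarrow> W t \<in> borel_measurable M"
  by (rule F_measurable_M[OF W_adapted])

lemma increment_distributed:
  "0 \<le> s \<Longrightarrow> s < t \<Longrightarrow> distributed M lborel (\<lambda>\<omega>. W t \<omega> - W s \<omega>) (normal_density 0 (sqrt (t - s)))"
  using bm unfolding brownian_motion_def by blast

lemma increment_moments:
  assumes "0 \<le> s" "s \<le> t"
  shows "integrable M (\<lambda>\<omega>. (W t \<omega> - W s \<omega>)\<^sup>2)" "expectation (\<lambda>\<omega>. (W t \<omega> - W s \<omega>)\<^sup>2) = t - s"
    "integrable M (\<lambda>\<omega>. W t \<omega> - W s \<omega>)" "expectation (\<lambda>\<omega>. W t \<omega> - W s \<omega>) = 0"
proof -
  have [measurable]: "W t \<in> borel_measurable M" "W s \<in> borel_measurable M"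
    using assms by (simp_all add: W_measurable)
  have *: "integrable M (\<lambda>\<omega>. (W t \<omega> - W s \<omega>)\<^sup>2) \<and> expectation (\<lambda>\<omega>. (W t \<omega> - W s \<omega>)\<^sup>2) = t - s
    \<and> expectation (\<lambda>\<omega>. W t \<omega> - W s \<omega>) = 0"
  proof (cases "s = t")
    case False
    then have st: "s < t" using assms by simp
    note d = increment_distributed[OF assms(1) st]
    have e: "expectation (\<lambda>\<omega>. W t \<omega> - W s \<omega>) = 0"
      using normal_distributed_expectation[OF _ d] st by simp
    have "variance (\<lambda>\<omega>. W t \<omega> - W s \<omega>) = (sqrt (t - s))\<^sup>2"
      using normal_distributed_variance[OF _ d] st by simp
    then have v: "expectation (\<lambda>\<omega>. (W t \<omega> - W s \<omega>)\<^sup>2) = t - s" using e st by simp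
    \<comment> \<open>The Bochner integral of a non-integrable function is 0, whereas this integral
      is \<open>t - s > 0\<close>.\<close>
    moreover have "integrable M (\<lambda>\<omega>. (W t \<omega> - W s \<omega>)\<^sup>2)"
      using v st not_integrable_integral_eq[of M "\<lambda>\<omega>. (W t \<omega> - W s \<omega>)\<^sup>2"] by fastforce
    ultimately show ?thesis using e by simp
  qed simp
  then show "integrable M (\<lambda>\<omega>. (W t \<omega> - W s \<omega>)\<^sup>2)" "expectation (\<lambda>\<omega>. (W t \<omega> - W s \<omega>)\<^sup>2) = t - s"
    "expectation (\<lambda>\<omega>. W t \<omega> - W s \<omega>) = 0" by auto
  show "integrable M (\<lambda>\<omega>. W t \<omega> - W s \<omega>)"
    by (rule square_integrable_imp_integrable) (use * in \<open>simp_all\<close>)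
qed

lemma increment_indep:
  assumes "\<psi> \<in> borel_measurable (F s)" "0 \<le> s" "s < t"
  shows "indep_var borel \<psi> borel (\<lambda>\<omega>. W t \<omega> - W s \<omega>)"
  unfolding indep_var_eq
proof (intro conjI)
  show "random_variable borel \<psi>" by (rule F_measurable_M[OF assms(1,2)])
  have [measurable]: "W t \<in> borel_measurable M" "W s \<in> borel_measurable M"
    using assms by (simp_all add: W_measurable)
  show "random_variable borel (\<lambda>\<omega>. W t \<omega> - W s \<omega>)" by measurable
  let ?D = "{(\<lambda>\<omega>. W t \<omega> - W s \<omega>) -` A \<inter> space M | A. A \<in> sets borel}"
  \<comment> \<open>The preimages of the Borel sets already form a sigma-algebra, so generating one
    adds nothing.\<close>
  have D: "sigma_sets (space M) ?D = ?D"
    using sets_vimage_algebra2[of "\<lambda>\<omega>. W t \<omega> - W s \<omega>" "space M" "borel :: real measure"]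
      sets_vimage_algebra[of "space M" "\<lambda>\<omega>. W t \<omega> - W s \<omega>" "borel :: real measure"] by simp
  have P: "sigma_sets (space M) {\<psi> -` A \<inter> space M |A. A \<in> sets borel} \<subseteq> sets (F s)"
  proof -
    have "sigma_sets (space (F s)) {\<psi> -` A \<inter> space M |A. A \<in> sets borel} \<subseteq> sets (F s)"
      using measurable_sets[OF assms(1)] by (intro sets.sigma_sets_subset) (auto simp: space_F)
    then show ?thesis by (simp add: space_F)
  qed
  have "indep_set (sets (F s)) ?D" using bm assms unfolding brownian_motion_def by blast
  then show "indep_set (sigma_sets (space M) {\<psi> -` A \<inter> space M |A. A \<in> sets borel}) (sigma_sets (space M) ?D)"
    unfolding D indep_set_def using P by (elim indep_sets_mono_sets) (auto split: bool.splits)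
qed

text \<open>The Ito isometry for elementary sums. In a mixed product the increment over the later
  interval has mean 0 and is independent of all the other factors; on the diagonal the squared
  coefficient is independent of the squared increment. The index type is left open because the cells
  used later are pairs of a grid interval and a step of a simple process.\<close>

lemma simple_sum_orthogonal:
  fixes a b :: "'i \<Rightarrow> real" and \<psi> :: "'i \<Rightarrow> 'a \<Rightarrow> real"
  assumes J: "finite J"
    and ab: "\<And>i. i \<in> J \<Longrightarrow> 0 \<le> a i" "\<And>i. i \<in> J \<Longrightarrow> a i \<le> b i"
    and meas: "\<And>i. i \<in> J \<Longrightarrow> \<psi> i \<in> borel_measurable (F (a i))"
    and bdd: "\<And>i. i \<in> J \<Longrightarrow> \<exists>C. \<forall>\<omega>. \<bar>\<psi> i \<omega>\<bar> \<le> C"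
    and ord: "\<And>i k. i \<in> J \<Longrightarrow> k \<in> J \<Longrightarrow> i \<noteq> k \<Longrightarrow> b i \<le> a k \<or> b k \<le> a i"
  shows "integrable M (\<lambda>\<omega>. (\<Sum>i\<in>J. \<psi> i \<omega> * (W (b i) \<omega> - W (a i) \<omega>))\<^sup>2)"
    and "expectation (\<lambda>\<omega>. (\<Sum>i\<in>J. \<psi> i \<omega> * (W (b i) \<omega> - W (a i) \<omega>))\<^sup>2) =
      (\<Sum>i\<in>J. (b i - a i) * expectation (\<lambda>\<omega>. (\<psi> i \<omega>)\<^sup>2))"
proof -
  define D where "D i \<omega> = W (b i) \<omega> - W (a i) \<omega>" for i \<omega>
  let ?P = "\<lambda>i \<omega>. \<psi> i \<omega> * D i \<omega>"
  define E where "E i k = (if i = k then (b i - a i) * expectation (\<lambda>\<omega>. (\<psi> i \<omega>)\<^sup>2) else 0)" for i k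
  have b0: "0 \<le> b i" if "i \<in> J" for i using ab that by (meson order_trans)
  have \<psi>M [measurable]: "\<psi> i \<in> borel_measurable M" if "i \<in> J" for i
    using meas[OF that] ab(1)[OF that] by (rule F_measurable_M)
  have DM [measurable]: "D i \<in> borel_measurable M" if "i \<in> J" for i
    unfolding D_def using ab b0 that by (intro borel_measurable_diff W_measurable) auto
  have Dint: "integrable M (D i)" "expectation (D i) = 0" "integrable M (\<lambda>\<omega>. (D i \<omega>)\<^sup>2)"
    "expectation (\<lambda>\<omega>. (D i \<omega>)\<^sup>2) = b i - a i" if "i \<in> J" for i
    using increment_moments[of "a i" "b i"] ab that unfolding D_def by auto
  have bddmult: "integrable M (\<lambda>\<omega>. \<psi> i \<omega> * f \<omega>)" if "i \<in> J" "integrable M f" for i f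
  proof -
    obtain C where C: "\<And>\<omega>. \<bar>\<psi> i \<omega>\<bar> \<le> C" using bdd[OF \<open>i \<in> J\<close>] by auto
    have [measurable]: "\<psi> i \<in> borel_measurable M" "f \<in> borel_measurable M"
      using that \<psi>M by auto
    show ?thesis
    proof (rule Bochner_Integration.integrable_bound)
      show "integrable M (\<lambda>\<omega>. C * f \<omega>)" using that by simp
      show "AE \<omega> in M. norm (\<psi> i \<omega> * f \<omega>) \<le> norm (C * f \<omega>)"
        using C by (intro always_eventually allI) (simp add: abs_mult mult_right_mono order_trans[OF C abs_ge_self])
    qed measurable
  qed
  have off: "integrable M (\<lambda>\<omega>. (?P i \<omega>) * (?P k \<omega>)) \<and>
      expectation (\<lambda>\<omega>. (?P i \<omega>) * (?P k \<omega>)) = 0"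
    if ik: "i \<in> J" "k \<in> J" "b i \<le> a k" for i k
  proof (cases "a k = b k")
    case True
    then show ?thesis by (simp add: D_def)
  next
    case False
    then have lt: "a k < b k" using ab ik by force
    \<comment> \<open>All factors except the later increment; they are known at time
      \<open>a k\<close>.\<close>
    let ?G = "\<lambda>\<omega>. \<psi> k \<omega> * (?P i \<omega>)"
    have [measurable]: "\<psi> i \<in> borel_measurable (F (a k))" "\<psi> k \<in> borel_measurable (F (a k))"
      "W (a i) \<in> borel_measurable (F (a k))" "W (b i) \<in> borel_measurable (F (a k))"
      using ik ab meas b0 by (auto intro: F_measurable_mono[where t = "a k"] W_adapted F_measurable_mono[OF W_adapted] dest: order_trans)
    have G: "?G \<in> borel_measurable (F (a k))" unfolding D_def by measurable
    have ind: "indep_var borel ?G borel (D k)"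
      using increment_indep[OF G ab(1)[OF ik(2)] lt] unfolding D_def .
    have Gi: "integrable M ?G" using ik Dint by (intro bddmult) auto
    have 1: "integrable M (\<lambda>\<omega>. ?G \<omega> * D k \<omega>)"
      using indep_var_integrable[OF ind Gi] Dint ik by auto
    have 2: "expectation (\<lambda>\<omega>. ?G \<omega> * D k \<omega>) = 0"
      using indep_var_lebesgue_integral[OF ind Gi] Dint ik by auto
    have "(\<lambda>\<omega>. (?P i \<omega>) * (?P k \<omega>)) = (\<lambda>\<omega>. ?G \<omega> * D k \<omega>)"
      by (auto simp: mult_ac)
    with 1 2 show ?thesis by simp
  qed
  have diag: "integrable M (\<lambda>\<omega>. (?P i \<omega>) * (?P i \<omega>)) \<and>
      expectation (\<lambda>\<omega>. (?P i \<omega>) * (?P i \<omega>)) = (b i - a i) * expectation (\<lambda>\<omega>. (\<psi> i \<omega>)\<^sup>2)"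
    if i: "i \<in> J" for i
  proof (cases "a i = b i")
    case True
    then show ?thesis by (simp add: D_def)
  next
    case False
    then have lt: "a i < b i" using ab i by force
    have "indep_var borel ((\<lambda>x. x\<^sup>2) \<circ> \<psi> i) borel ((\<lambda>x. x\<^sup>2) \<circ> D i)"
      using increment_indep[OF meas[OF i] ab(1)[OF i] lt]
      by (intro indep_var_compose[of borel _ borel]) (auto simp: D_def[abs_def])
    then have ind: "indep_var borel (\<lambda>\<omega>. (\<psi> i \<omega>)\<^sup>2) borel (\<lambda>\<omega>. (D i \<omega>)\<^sup>2)" by (simp add: comp_def)
    have "integrable M (\<lambda>\<omega>. \<psi> i \<omega> * (\<psi> i \<omega> * 1))" using i by (intro bddmult) auto
    then have Gi: "integrable M (\<lambda>\<omega>. (\<psi> i \<omega>)\<^sup>2)" by (simp add: power2_eq_square)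
    have 1: "integrable M (\<lambda>\<omega>. (\<psi> i \<omega>)\<^sup>2 * (D i \<omega>)\<^sup>2)"
      using indep_var_integrable[OF ind Gi] Dint i by auto
    have 2: "expectation (\<lambda>\<omega>. (\<psi> i \<omega>)\<^sup>2 * (D i \<omega>)\<^sup>2) = expectation (\<lambda>\<omega>. (\<psi> i \<omega>)\<^sup>2) * (b i - a i)"
      using indep_var_lebesgue_integral[OF ind Gi] Dint i by auto
    have "(\<lambda>\<omega>. (?P i \<omega>) * (?P i \<omega>)) = (\<lambda>\<omega>. (\<psi> i \<omega>)\<^sup>2 * (D i \<omega>)\<^sup>2)"
      by (auto simp: power2_eq_square mult_ac)
    with 1 2 show ?thesis by (simp add: mult.commute)
  qed
  have all: "integrable M (\<lambda>\<omega>. (?P i \<omega>) * (?P k \<omega>)) \<and>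
      expectation (\<lambda>\<omega>. (?P i \<omega>) * (?P k \<omega>)) = E i k" if "i \<in> J" "k \<in> J" for i k
  proof (cases "i = k")
    case True
    then show ?thesis using diag[of i] that by (simp add: E_def)
  next
    case False
    then show ?thesis using ord[OF that False] off[of i k] off[of k i] that
      by (auto simp: E_def mult.commute)
  qed
  have eq: "(\<lambda>\<omega>. (\<Sum>i\<in>J. ?P i \<omega>)\<^sup>2) = (\<lambda>\<omega>. \<Sum>i\<in>J. \<Sum>k\<in>J. (?P i \<omega>) * (?P k \<omega>))"
    by (simp add: power2_eq_square sum_product)
  have "integrable M (\<lambda>\<omega>. (\<Sum>i\<in>J. ?P i \<omega>)\<^sup>2)"
    unfolding eq using all by (intro Bochner_Integration.integrable_sum) auto
  moreover have "expectation (\<lambda>\<omega>. (\<Sum>i\<in>J. ?P i \<omega>)\<^sup>2) = (\<Sum>i\<in>J. \<Sum>k\<in>J. E i k)"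
  proof -
    have "expectation (\<lambda>\<omega>. \<Sum>i\<in>J. \<Sum>k\<in>J. (?P i \<omega>) * (?P k \<omega>)) =
      (\<Sum>i\<in>J. expectation (\<lambda>\<omega>. \<Sum>k\<in>J. (?P i \<omega>) * (?P k \<omega>)))"
      using all by (intro Bochner_Integration.integral_sum Bochner_Integration.integrable_sum) auto
    also have "\<dots> = (\<Sum>i\<in>J. \<Sum>k\<in>J. expectation (\<lambda>\<omega>. (?P i \<omega>) * (?P k \<omega>)))"
      using all by (intro sum.cong Bochner_Integration.integral_sum) auto
    finally show ?thesis unfolding eq using all by (simp cong: sum.cong)
  qed
  moreover have "(\<Sum>i\<in>J. \<Sum>k\<in>J. E i k) = (\<Sum>i\<in>J. (b i - a i) * expectation (\<lambda>\<omega>. (\<psi> i \<omega>)\<^sup>2))"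
    using J by (simp add: E_def)
  ultimately show "integrable M (\<lambda>\<omega>. (\<Sum>i\<in>J. \<psi> i \<omega> * (W (b i) \<omega> - W (a i) \<omega>))\<^sup>2)"
    and "expectation (\<lambda>\<omega>. (\<Sum>i\<in>J. \<psi> i \<omega> * (W (b i) \<omega> - W (a i) \<omega>))\<^sup>2) =
      (\<Sum>i\<in>J. (b i - a i) * expectation (\<lambda>\<omega>. (\<psi> i \<omega>)\<^sup>2))"
    by (simp_all add: D_def)
qed

text \<open>Stopping the integrand just before its accumulated square exceeds \<open>\<beta>\<close> makes it bounded
  without changing the sums on the event in question.\<close>

lemma simple_sum_truncation_estimate:
  fixes a b :: "'i \<Rightarrow> real" and \<psi> :: "'i \<Rightarrow> 'a \<Rightarrow> real" and \<rho> :: "'i \<Rightarrow> nat"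
  assumes I: "finite I" "inj_on \<rho> I"
    and ab: "\<And>i. i \<in> I \<Longrightarrow> 0 \<le> a i" "\<And>i. i \<in> I \<Longrightarrow> a i \<le> b i"
    and ord: "\<And>i k. i \<in> I \<Longrightarrow> k \<in> I \<Longrightarrow> \<rho> i < \<rho> k \<Longrightarrow> b i \<le> a k"
    and meas: "\<And>i. i \<in> I \<Longrightarrow> \<psi> i \<in> borel_measurable (F (a i))"
    and L: "finite L" "\<And>l. l \<in> L \<Longrightarrow> J l \<subseteq> I" "disjoint_family_on J L"
    and pos: "0 < \<alpha>" "0 < \<beta>"
  shows "measure M {\<omega> \<in> space M. \<alpha> < (\<Sum>l\<in>L. (\<Sum>i\<in>J l. \<psi> i \<omega> * (W (b i) \<omega> - W (a i) \<omega>))\<^sup>2) \<and>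
      (\<Sum>i\<in>I. (\<psi> i \<omega>)\<^sup>2 * (b i - a i)) \<le> \<beta>} \<le> \<beta> / \<alpha>"
proof -
  let ?D = "\<lambda>i \<omega>. W (b i) \<omega> - W (a i) \<omega>"
  let ?Q = "\<lambda>\<omega>. \<Sum>i\<in>I. (\<psi> i \<omega>)\<^sup>2 * (b i - a i)"
  let ?E = "\<lambda>\<omega>. \<alpha> < (\<Sum>l\<in>L. (\<Sum>i\<in>J l. \<psi> i \<omega> * (?D i \<omega>))\<^sup>2)"
  \<comment> \<open>\<open>\<rho>\<close> numbers the cells in temporal order. The term of
    \<open>i\<close> itself is included: it is known at the left end point \<open>a i\<close>, so
    one can stop before the bound is exceeded and still have a coefficient measurable at
    \<open>a i\<close>.\<close>
  define A where "A i \<omega> = (\<Sum>k | k \<in> I \<and> \<rho> k \<le> \<rho> i. (\<psi> k \<omega>)\<^sup>2 * (b k - a k))" for i \<omega>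
  \<comment> \<open>On a degenerate cell the accumulated square says nothing about the size of the
    coefficient. There it is set to 0, which changes no sum because the increment of
    \<open>W\<close> vanishes.\<close>
  define \<Psi> where "\<Psi> i \<omega> = (if a i < b i \<and> A i \<omega> \<le> \<beta> then \<psi> i \<omega> else 0)" for i \<omega>
  have nn: "0 \<le> (\<psi> k \<omega>)\<^sup>2 * (b k - a k)" if "k \<in> I" for k \<omega> using ab that by simp
  have \<Psi>meas: "\<Psi> i \<in> borel_measurable (F (a i))" if i: "i \<in> I" for i
  proof -
    have "\<psi> k \<in> borel_measurable (F (a i))" if k: "k \<in> I" "\<rho> k \<le> \<rho> i" for k
    proof (rule F_measurable_mono[OF meas[OF k(1)]])
      show "a k \<le> a i"
      proof (cases "\<rho> k = \<rho> i")
        case True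
        then show ?thesis using I(2) i k by (auto dest: inj_onD)
      next
        case False
        then show ?thesis using ord[OF k(1) i] ab(2)[OF k(1)] k by linarith
      qed
    qed
    then have [measurable]: "A i \<in> borel_measurable (F (a i))" unfolding A_def by measurable
    have [measurable]: "\<psi> i \<in> borel_measurable (F (a i))" using meas i .
    show ?thesis unfolding \<Psi>_def by measurable
  qed
  have \<Psi>bdd: "\<exists>C. \<forall>\<omega>. \<bar>\<Psi> i \<omega>\<bar> \<le> C" if i: "i \<in> I" for i
  proof (cases "a i < b i")
    case True
    have "\<bar>\<Psi> i \<omega>\<bar> \<le> sqrt (\<beta> / (b i - a i))" for \<omega>
    proof (cases "A i \<omega> \<le> \<beta>")
      case A: True
      have "(\<psi> i \<omega>)\<^sup>2 * (b i - a i) \<le> A i \<omega>"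
        unfolding A_def using I i by (intro member_le_sum) (auto intro: nn)
      then have "(\<psi> i \<omega>)\<^sup>2 \<le> \<beta> / (b i - a i)" using True A by (simp add: field_simps)
      then show ?thesis unfolding \<Psi>_def using True A by (auto intro: real_le_rsqrt)
    qed (use True pos in \<open>simp add: \<Psi>_def\<close>)
    then show ?thesis by blast
  qed (auto simp: \<Psi>_def intro: exI[of _ 0])
  have total: "(\<Sum>i\<in>I. (\<Psi> i \<omega>)\<^sup>2 * (b i - a i)) \<le> \<beta>" for \<omega>
  proof -
    define G where "G = {i \<in> I. A i \<omega> \<le> \<beta>}"
    have "(\<Sum>i\<in>I. (\<Psi> i \<omega>)\<^sup>2 * (b i - a i)) = (\<Sum>i\<in>G. (\<Psi> i \<omega>)\<^sup>2 * (b i - a i))"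
      using I by (intro sum.mono_neutral_right) (auto simp: G_def \<Psi>_def)
    also have "\<dots> \<le> (\<Sum>i\<in>G. (\<psi> i \<omega>)\<^sup>2 * (b i - a i))"
      by (intro sum_mono) (auto simp: \<Psi>_def G_def nn)
    also have "\<dots> \<le> \<beta>"
    proof (cases "G = {}")
      case False
      have fG: "finite G" using I by (simp add: G_def)
      \<comment> \<open>The cell of \<open>G\<close> that is last in time; its accumulated square
        \<open>A g \<omega>\<close> already contains the terms of all of \<open>G\<close>.\<close>
      obtain g where g: "g \<in> G" "\<And>i. i \<in> G \<Longrightarrow> \<rho> i \<le> \<rho> g"
      proof -
        have "Max (\<rho> ` G) \<in> \<rho> ` G" using fG False by simp
        then obtain g where "g \<in> G" "\<rho> g = Max (\<rho> ` G)" by auto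
        then show ?thesis using that[of g] fG by auto
      qed
      have "(\<Sum>i\<in>G. (\<psi> i \<omega>)\<^sup>2 * (b i - a i)) \<le> A g \<omega>"
        unfolding A_def using I g nn by (intro sum_mono2) (auto simp: G_def)
      also have "\<dots> \<le> \<beta>" using g by (simp add: G_def)
      finally show ?thesis .
    qed (use pos in simp)
    finally show ?thesis .
  qed
  define g where "g \<omega> = (\<Sum>l\<in>L. (\<Sum>i\<in>J l. \<Psi> i \<omega> * (?D i \<omega>))\<^sup>2)" for \<omega>
  have fJ: "finite (J l)" if "l \<in> L" for l using L that I by (auto intro: finite_subset)
  have ordJ: "b i \<le> a k \<or> b k \<le> a i" if "l \<in> L" "i \<in> J l" "k \<in> J l" "i \<noteq> k" for l i k
  proof -
    have ik: "i \<in> I" "k \<in> I" using L that by auto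
    then have "\<rho> i \<noteq> \<rho> k" using I that by (simp add: inj_on_eq_iff)
    with ik show ?thesis using ord[of i k] ord[of k i] by (meson linorder_less_linear)
  qed
  have blk: "integrable M (\<lambda>\<omega>. (\<Sum>i\<in>J l. \<Psi> i \<omega> * (?D i \<omega>))\<^sup>2)"
    "expectation (\<lambda>\<omega>. (\<Sum>i\<in>J l. \<Psi> i \<omega> * (?D i \<omega>))\<^sup>2) =
      (\<Sum>i\<in>J l. (b i - a i) * expectation (\<lambda>\<omega>. (\<Psi> i \<omega>)\<^sup>2))" if l: "l \<in> L" for l
  proof -
    have sub: "i \<in> I" if "i \<in> J l" for i using L(2)[OF l] that by auto
    note * = fJ[OF l] ab(1)[OF sub] ab(2)[OF sub] \<Psi>meas[OF sub] \<Psi>bdd[OF sub] ordJ[OF l]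
    show "integrable M (\<lambda>\<omega>. (\<Sum>i\<in>J l. \<Psi> i \<omega> * (?D i \<omega>))\<^sup>2)"
      by (rule simple_sum_orthogonal(1); fact *)
    show "expectation (\<lambda>\<omega>. (\<Sum>i\<in>J l. \<Psi> i \<omega> * (?D i \<omega>))\<^sup>2) =
      (\<Sum>i\<in>J l. (b i - a i) * expectation (\<lambda>\<omega>. (\<Psi> i \<omega>)\<^sup>2))"
      by (rule simple_sum_orthogonal(2); fact *)
  qed
  have gint: "integrable M g" unfolding g_def using blk by (intro Bochner_Integration.integrable_sum) auto
  have \<Psi>M [measurable]: "\<Psi> i \<in> borel_measurable M" if "i \<in> I" for i
    using \<Psi>meas[OF that] ab(1)[OF that] by (rule F_measurable_M)
  have \<Psi>int: "integrable M (\<lambda>\<omega>. (\<Psi> i \<omega>)\<^sup>2)" if "i \<in> I" for i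
  proof -
    obtain C where C: "\<And>\<omega>. \<bar>\<Psi> i \<omega>\<bar> \<le> C" using \<Psi>bdd[OF \<open>i \<in> I\<close>] by auto
    have "(\<Psi> i \<omega>)\<^sup>2 \<le> C\<^sup>2" for \<omega> using C[of \<omega>] by (simp add: abs_le_square_iff[symmetric])
    then show ?thesis using that \<Psi>M[OF that] by (intro integrable_const_bound[where B = "C\<^sup>2"]) auto
  qed
  have "expectation g = (\<Sum>l\<in>L. \<Sum>i\<in>J l. (b i - a i) * expectation (\<lambda>\<omega>. (\<Psi> i \<omega>)\<^sup>2))"
    unfolding g_def using blk by (simp add: Bochner_Integration.integral_sum)
  also have "\<dots> = (\<Sum>i\<in>(\<Union>l\<in>L. J l). (b i - a i) * expectation (\<lambda>\<omega>. (\<Psi> i \<omega>)\<^sup>2))"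
    using L fJ by (intro sum.UNION_disjoint[symmetric]) (auto simp: disjoint_family_on_def)
  also have "\<dots> \<le> (\<Sum>i\<in>I. (b i - a i) * expectation (\<lambda>\<omega>. (\<Psi> i \<omega>)\<^sup>2))"
    using L I ab by (intro sum_mono2) auto
  also have "\<dots> = expectation (\<lambda>\<omega>. \<Sum>i\<in>I. (\<Psi> i \<omega>)\<^sup>2 * (b i - a i))"
    using \<Psi>int by (subst Bochner_Integration.integral_sum) (auto simp: mult.commute)
  also have "\<dots> \<le> expectation (\<lambda>\<omega>. \<beta>)"
    using total \<Psi>int by (intro integral_mono Bochner_Integration.integrable_sum) auto
  finally have Eg: "expectation g \<le> \<beta>" by (simp add: prob_space)
  have [measurable]: "g \<in> borel_measurable M" using gint by auto
  have "measure M {\<omega> \<in> space M. ?E \<omega> \<and>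
      (?Q \<omega>) \<le> \<beta>} \<le> measure M {\<omega> \<in> space M. \<alpha> \<le> g \<omega>}"
  proof (rule finite_measure_mono)
    show "{\<omega> \<in> space M. ?E \<omega> \<and>
      (?Q \<omega>) \<le> \<beta>} \<subseteq> {\<omega> \<in> space M. \<alpha> \<le> g \<omega>}"
    proof safe
      fix \<omega> assume *: "?E \<omega>"
        and le: "(?Q \<omega>) \<le> \<beta>"
      have "\<Psi> i \<omega> * (?D i \<omega>) = \<psi> i \<omega> * (?D i \<omega>)" if i: "i \<in> I" for i
      proof (cases "a i < b i")
        case True
        have "A i \<omega> \<le> (?Q \<omega>)"
          unfolding A_def using I nn by (intro sum_mono2) auto
        then show ?thesis using le True by (simp add: \<Psi>_def)
      next
        case False
        then have "a i = b i" using ab(2)[OF i] by simp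
        then show ?thesis by simp
      qed
      then have "g \<omega> = (\<Sum>l\<in>L. (\<Sum>i\<in>J l. \<psi> i \<omega> * (?D i \<omega>))\<^sup>2)"
        unfolding g_def using L(2) by (intro sum.cong refl arg_cong[where f = "\<lambda>x. x\<^sup>2"]) auto
      with * show "\<alpha> \<le> g \<omega>" by simp
    qed
  qed measurable
  also have "\<dots> \<le> expectation g / \<alpha>"
  proof (rule integral_Markov_inequality_measure[where A = "space M"])
    show "AE \<omega> in M. 0 \<le> g \<omega>" by (simp add: g_def sum_nonneg)
  qed (use gint pos in auto)
  also have "\<dots> \<le> \<beta> / \<alpha>" using Eg pos by (simp add: divide_right_mono)
  finally show ?thesis .
qed

end

section \<open>Riemann sums of Ito integrals\<close>

lemma steps_mono:
  fixes \<tau> :: "nat \<Rightarrow> real"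
  assumes "\<forall>i<n. \<tau> i \<le> \<tau> (Suc i)" "i \<le> j" "j \<le> n"
  shows "\<tau> i \<le> \<tau> j"
  using assms(2,3)
proof (induction j rule: dec_induct)
  case (step j)
  then show ?case using assms(1) by (meson Suc_le_eq less_imp_le order_trans)
qed simp

text \<open>For \<open>a \<le> b\<close> this is the projection onto the interval from
  \<open>a\<close> to \<open>b\<close>. Cells outside the interval collapse to a point, so no case
  distinction is needed to describe a common refinement.\<close>

definition clip :: "real \<Rightarrow> real \<Rightarrow> real \<Rightarrow> real" where
  "clip a b x = max a (min x b)"

lemma clip_mono: "x \<le> y \<Longrightarrow> clip a b x \<le> clip a b y"
  by (auto simp: clip_def)

lemma clip_bounds: "a \<le> b \<Longrightarrow> a \<le> clip a b x \<and> clip a b x \<le> b"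
  by (auto simp: clip_def)

text \<open>Each step of the simple process contributes the part of its cell that lies between
  \<open>a\<close> and \<open>b\<close>. Increments of the integral along a grid thereby become
  elementary sums over the common refinement of the grid and the steps.\<close>

lemma simple_integral_increment:
  assumes "a \<le> b"
  shows "simple_integral W n \<tau> \<xi> b \<omega> - simple_integral W n \<tau> \<xi> a \<omega> =
    (\<Sum>i<n. \<xi> i \<omega> * (W (clip a b (\<tau> (Suc i))) \<omega> - W (clip a b (\<tau> i)) \<omega>))"
proof -
  have *: "W (min x b) \<omega> - W (min x a) \<omega> = W (clip a b x) \<omega> - W a \<omega>" for x
    using assms by (auto simp: clip_def min_def max_def)
  have "(W (min (\<tau> (Suc i)) b) \<omega> - W (min (\<tau> i) b) \<omega>) - (W (min (\<tau> (Suc i)) a) \<omega> - W (min (\<tau> i) a) \<omega>)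
     = W (clip a b (\<tau> (Suc i))) \<omega> - W (clip a b (\<tau> i)) \<omega>" for i
    using *[of "\<tau> (Suc i)"] *[of "\<tau> i"] by linarith
  then show ?thesis
    unfolding simple_integral_def sum_subtractf[symmetric] right_diff_distrib[symmetric] by simp
qed

lemma clip_telescope:
  fixes n :: nat
  assumes "a \<le> b" "\<tau> 0 \<le> a" "b \<le> \<tau> n"
  shows "(\<Sum>i<n. W (clip a b (\<tau> (Suc i))) \<omega> - W (clip a b (\<tau> i)) \<omega> :: real) = W b \<omega> - W a \<omega>"
proof -
  have "clip a b (\<tau> n) = b" "clip a b (\<tau> 0) = a" using assms by (auto simp: clip_def)
  then show ?thesis using sum_lessThan_telescope[of "\<lambda>i. W (clip a b (\<tau> i)) \<omega>" n] by simp
qed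

text \<open>A simple process may start after 0 and end before \<open>T\<close>; its clipped cells
  would then fail to cover the grid intervals, and the increments of \<open>W\<close> over them
  would not telescope. Steps with coefficient 0 are added at both ends.\<close>

lemma simple_integrand_pad:
  assumes s: "simple_integrand F n \<tau> \<xi>"
  obtains n' \<tau>' \<xi>' where "simple_integrand F n' \<tau>' \<xi>'" "\<tau>' 0 = 0" "T \<le> \<tau>' n'"
    "\<And>u \<omega>. simple_process n' \<tau>' \<xi>' u \<omega> = simple_process n \<tau> \<xi> u \<omega>"
    "\<And>u \<omega>. simple_integral W n' \<tau>' \<xi>' u \<omega> = simple_integral W n \<tau> \<xi> u \<omega>"
proof
  \<comment> \<open>The maximum keeps the points ordered when the old ones already reach beyond
    \<open>T\<close>.\<close>
  define \<tau>' where "\<tau>' i = (case i of 0 \<Rightarrow> 0 | Suc j \<Rightarrow> if j \<le> n then \<tau> j else max T (\<tau> n))" for i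
  define \<xi>' where "\<xi>' i = (case i of 0 \<Rightarrow> (\<lambda>_. 0) | Suc j \<Rightarrow> if j < n then \<xi> j else (\<lambda>_. 0))" for i
  show "simple_integrand F (Suc (Suc n)) \<tau>' \<xi>'"
    unfolding simple_integrand_def
  proof (intro conjI allI impI)
    fix i assume i: "i < Suc (Suc n)"
    show "\<tau>' i \<le> \<tau>' (Suc i)"
    proof (cases i)
      case 0
      then show ?thesis using s by (simp add: \<tau>'_def simple_integrand_def)
    next
      case (Suc j)
      then show ?thesis using s i by (cases "j = n") (auto simp: \<tau>'_def simple_integrand_def)
    qed
    show "\<xi>' i \<in> borel_measurable (F (\<tau>' i))"
      using s by (auto simp: \<xi>'_def \<tau>'_def simple_integrand_def split: nat.split)
    show "\<exists>K. \<forall>\<omega>. \<bar>\<xi>' i \<omega>\<bar> \<le> K"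
      using s by (auto simp: \<xi>'_def simple_integrand_def split: nat.split)
  qed (simp add: \<tau>'_def)
  show "\<tau>' 0 = 0" "T \<le> \<tau>' (Suc (Suc n))" by (simp_all add: \<tau>'_def)
  have sum: "(\<Sum>i<Suc (Suc n). \<xi>' i \<omega> * f (\<tau>' i) (\<tau>' (Suc i))) = (\<Sum>i<n. \<xi> i \<omega> * f (\<tau> i) (\<tau> (Suc i)))" for \<omega> and f :: "real \<Rightarrow> real \<Rightarrow> real"
  proof -
    have "(\<Sum>i<Suc (Suc n). \<xi>' i \<omega> * f (\<tau>' i) (\<tau>' (Suc i))) = (\<Sum>i<Suc n. \<xi>' (Suc i) \<omega> * f (\<tau>' (Suc i)) (\<tau>' (Suc (Suc i))))"
      by (subst sum.lessThan_Suc_shift) (simp add: \<xi>'_def)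
    also have "\<dots> = (\<Sum>i<n. \<xi>' (Suc i) \<omega> * f (\<tau>' (Suc i)) (\<tau>' (Suc (Suc i))))" by (simp add: \<xi>'_def)
    also have "\<dots> = (\<Sum>i<n. \<xi> i \<omega> * f (\<tau> i) (\<tau> (Suc i)))"
      by (intro sum.cong) (auto simp: \<xi>'_def \<tau>'_def)
    finally show ?thesis .
  qed
  show "simple_process (Suc (Suc n)) \<tau>' \<xi>' u \<omega> = simple_process n \<tau> \<xi> u \<omega>" for u \<omega>
    unfolding simple_process_def using sum[of \<omega> "\<lambda>a b. indicator {a<..b} u"] .
  show "simple_integral W (Suc (Suc n)) \<tau>' \<xi>' u \<omega> = simple_integral W n \<tau> \<xi> u \<omega>" for u \<omega>
    unfolding simple_integral_def using sum[of \<omega> "\<lambda>a b. W (min b u) \<omega> - W (min a u) \<omega>"] .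
qed

text \<open>The lexicographic order of the pairs of grid interval and step is the temporal order of
  the cells; both the orthogonality and the truncation rely on this.\<close>

lemma clip_ordered:
  fixes t \<tau> :: "nat \<Rightarrow> real"
  assumes "mono t" "\<forall>i<n. \<tau> i \<le> \<tau> (Suc i)" "i < n" "i' < n" "l < l' \<or> (l = l' \<and> i < i')"
  shows "clip (t l) (t (Suc l)) (\<tau> (Suc i)) \<le> clip (t l') (t (Suc l')) (\<tau> i')"
  using assms(5)
proof
  assume "l < l'"
  then have "t (Suc l) \<le> t l'" using assms(1) by (simp add: monoD Suc_leI)
  moreover have "t l \<le> t (Suc l)" "t l' \<le> t (Suc l')" using assms(1) by (auto simp: monoD)
  ultimately show ?thesis using clip_bounds by (meson order_trans)
next
  assume "l = l' \<and> i < i'"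
  then show ?thesis using steps_mono[OF assms(2), of "Suc i" i'] assms(4) by (auto intro: clip_mono)
qed

text \<open>On a nonempty cell the simple process has the value \<open>\<xi> i\<close>, so for every
  \<open>s\<close> in the cell \<open>\<xi> i - H (t l)\<close> is the approximation error at
  \<open>s\<close> plus an oscillation of \<open>H\<close> within one grid interval. The inequality
  (a + b)^2 \<le> 2 a^2 + 2 b^2 separates the two, and integration over the disjoint cells gives the
  two terms on the right.\<close>

lemma simple_error_bound:
  fixes t \<tau> \<xi> z :: "nat \<Rightarrow> real" and H :: "real \<Rightarrow> real" and N n :: nat
  defines "a \<equiv> \<lambda>l i. clip (t l) (t (Suc l)) (\<tau> i)" and "b \<equiv> \<lambda>l i. clip (t l) (t (Suc l)) (\<tau> (Suc i))"
  assumes t: "mono t" "t 0 = 0" "t N = T" and \<tau>: "\<forall>i<n. \<tau> i \<le> \<tau> (Suc i)"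
    and H: "continuous_on {0..T} H" and w: "\<And>l s. l < N \<Longrightarrow> s \<in> {t l..t (Suc l)} \<Longrightarrow> \<bar>H s - H (t l)\<bar> \<le> w"
    and z: "\<And>l. l < N \<Longrightarrow> \<bar>z l\<bar> \<le> B"
  shows "ennreal (\<Sum>l<N. \<Sum>i<n. (if a l i < b l i then z l * (\<xi> i - H (t l)) else 0)\<^sup>2 * (b l i - a l i)) \<le>
     ennreal (2 * B\<^sup>2) * (\<integral>\<^sup>+s\<in>{0..T}. ennreal (((\<Sum>i<n. \<xi> i * indicator {\<tau> i<..\<tau> (Suc i)} s) - H s)\<^sup>2) \<partial>lborel)
     + ennreal (2 * B\<^sup>2 * T * w\<^sup>2)"
proof -
  let ?P = "{..<N} \<times> {..<n}"
  define S where "S p = {a (fst p) (snd p)<..b (fst p) (snd p)}" for p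
  define \<phi> where "\<phi> s = (\<Sum>i<n. \<xi> i * indicator {\<tau> i<..\<tau> (Suc i)} s)" for s
  \<comment> \<open>Cutting \<open>H\<close> off outside \<open>{0..T}\<close> makes it Borel
    measurable, since continuity is assumed only on that interval.\<close>
  define Hc where "Hc s = indicator {0..T} s *\<^sub>R H s" for s
  have T: "0 \<le> T" using t monoD[OF t(1), of 0 N] by simp
  have [measurable]: "Hc \<in> borel_measurable borel"
    unfolding Hc_def using H by (intro borel_measurable_continuous_on_indicator) auto
  have [measurable]: "\<phi> \<in> borel_measurable borel" unfolding \<phi>_def by measurable
  have tl: "t l \<le> t (Suc l)" for l using t(1) by (simp add: monoD)
  have ab: "a l i \<le> b l i" if "i < n" for l i unfolding a_def b_def using \<tau> that by (auto intro: clip_mono)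
  have Ssub: "S p \<subseteq> {t (fst p)..t (Suc (fst p))}" for p
    unfolding S_def a_def b_def
    using clip_bounds[OF tl[of "fst p"], of "\<tau> (snd p)"] clip_bounds[OF tl[of "fst p"], of "\<tau> (Suc (snd p))"]
    by auto
  have S0T: "S p \<subseteq> {0..T}" if "p \<in> ?P" for p
  proof -
    have "0 \<le> t (fst p)" "t (Suc (fst p)) \<le> T"
      using monoD[OF t(1), of 0 "fst p"] monoD[OF t(1), of "Suc (fst p)" N] t that by auto
    then show ?thesis using Ssub[of p] by fastforce
  qed
  have \<phi>S: "\<phi> s = \<xi> (snd p)" if p: "p \<in> ?P" and s: "s \<in> S p" for p s
  proof -
    let ?i = "snd p"
    have i: "?i < n" using p by auto
    have mem: "s \<in> {\<tau> ?i<..\<tau> (Suc ?i)}"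
      using s tl[of "fst p"] by (auto simp: S_def a_def b_def clip_def split: if_splits)
    have "s \<notin> {\<tau> k<..\<tau> (Suc k)}" if "k < n" "k \<noteq> ?i" for k
    proof (cases "k < ?i")
      case True
      then have "\<tau> (Suc k) \<le> \<tau> ?i" using steps_mono[OF \<tau>, of "Suc k" ?i] i by simp
      then show ?thesis using mem by auto
    next
      case False
      then have "\<tau> (Suc ?i) \<le> \<tau> k" using steps_mono[OF \<tau>, of "Suc ?i" k] that by simp
      then show ?thesis using mem by auto
    qed
    then have 0: "(\<Sum>k\<in>{..<n} - {?i}. \<xi> k * indicator {\<tau> k<..\<tau> (Suc k)} s) = 0"
      by (intro sum.neutral) auto
    have "\<phi> s = \<xi> ?i * indicator {\<tau> ?i<..\<tau> (Suc ?i)} s + (\<Sum>k\<in>{..<n} - {?i}. \<xi> k * indicator {\<tau> k<..\<tau> (Suc k)} s)"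
      unfolding \<phi>_def using i by (intro sum.remove) auto
    then show ?thesis unfolding 0 using mem by simp
  qed
  have disj: "disjoint_family_on S ?P"
    unfolding disjoint_family_on_def
  proof (intro ballI impI)
    fix p p' assume p: "p \<in> ?P" and p': "p' \<in> ?P" and ne: "p \<noteq> p'"
    obtain l i l' i' where eq: "p = (l, i)" "p' = (l', i')" by (cases p, cases p')
    have "b l i \<le> a l' i' \<or> b l' i' \<le> a l i"
    proof (cases "l < l' \<or> (l = l' \<and> i < i')")
      case True
      then show ?thesis unfolding a_def b_def using clip_ordered[OF t(1) \<tau>] p p' eq by auto
    next
      case False
      then have "l' < l \<or> (l' = l \<and> i' < i)" using ne eq by auto
      then show ?thesis unfolding a_def b_def using clip_ordered[OF t(1) \<tau>] p p' eq by auto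
    qed
    then show "S p \<inter> S p' = {}" by (auto simp: S_def eq)
  qed
  define c where "c p = (if a (fst p) (snd p) < b (fst p) (snd p) then z (fst p) * (\<xi> (snd p) - H (t (fst p))) else 0)\<^sup>2" for p
  define G where "G s = ennreal (2 * B\<^sup>2 * ((\<phi> s - Hc s)\<^sup>2 + w\<^sup>2))" for s
  have [measurable]: "G \<in> borel_measurable borel" unfolding G_def by measurable
  have cG: "ennreal (c p) \<le> G s" if p: "p \<in> ?P" and s: "s \<in> S p" for p s
  proof -
    have Hs: "Hc s = H s" using S0T[OF p] s by (auto simp: Hc_def)
    have w': "\<bar>H s - H (t (fst p))\<bar> \<le> w" using p s Ssub[of p] by (intro w) auto
    have z': "(z (fst p))\<^sup>2 \<le> B\<^sup>2"
    proof -
      have "\<bar>z (fst p)\<bar> \<le> \<bar>B\<bar>" using z[of "fst p"] p by fastforce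
      then show ?thesis by (simp add: abs_le_square_iff)
    qed
    have "(\<xi> (snd p) - H (t (fst p)))\<^sup>2 = ((\<phi> s - Hc s) + (H s - H (t (fst p))))\<^sup>2"
      using \<phi>S[OF p s] Hs by simp
    also have "\<dots> \<le> 2 * (\<phi> s - Hc s)\<^sup>2 + 2 * (H s - H (t (fst p)))\<^sup>2"
      using sum_squares_bound[of "\<phi> s - Hc s" "H s - H (t (fst p))"] by (simp add: power2_sum)
    also have "\<dots> \<le> 2 * (\<phi> s - Hc s)\<^sup>2 + 2 * w\<^sup>2"
    proof -
      have "\<bar>H s - H (t (fst p))\<bar> \<le> \<bar>w\<bar>" using w' by simp
      then show ?thesis by (simp add: abs_le_square_iff)
    qed
    finally have 1: "(\<xi> (snd p) - H (t (fst p)))\<^sup>2 \<le> 2 * ((\<phi> s - Hc s)\<^sup>2 + w\<^sup>2)" by simp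
    have "c p \<le> (z (fst p))\<^sup>2 * (\<xi> (snd p) - H (t (fst p)))\<^sup>2"
      by (simp add: c_def power_mult_distrib)
    also have "\<dots> \<le> B\<^sup>2 * (2 * ((\<phi> s - Hc s)\<^sup>2 + w\<^sup>2))" using z' 1 by (intro mult_mono) auto
    finally show ?thesis unfolding G_def by (intro ennreal_leI) (simp add: algebra_simps)
  qed
  have "ennreal (\<Sum>l<N. \<Sum>i<n. (if a l i < b l i then z l * (\<xi> i - H (t l)) else 0)\<^sup>2 * (b l i - a l i))
     = ennreal (\<Sum>p\<in>?P. c p * (b (fst p) (snd p) - a (fst p) (snd p)))"
    by (simp add: sum.cartesian_product c_def case_prod_beta)
  also have "\<dots> = (\<Sum>p\<in>?P. ennreal (c p * (b (fst p) (snd p) - a (fst p) (snd p))))"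
    using ab by (intro sum_ennreal[symmetric]) (auto simp: c_def)
  also have "\<dots> = (\<Sum>p\<in>?P. \<integral>\<^sup>+s. ennreal (c p) * indicator (S p) s \<partial>lborel)"
  proof (intro sum.cong refl)
    fix p assume "p \<in> ?P"
    then have "a (fst p) (snd p) \<le> b (fst p) (snd p)" using ab by auto
    then show "ennreal (c p * (b (fst p) (snd p) - a (fst p) (snd p))) = (\<integral>\<^sup>+s. ennreal (c p) * indicator (S p) s \<partial>lborel)"
      unfolding S_def by (subst nn_integral_cmult_indicator) (auto simp: ennreal_mult c_def)
  qed
  also have "\<dots> \<le> (\<Sum>p\<in>?P. \<integral>\<^sup>+s. G s * indicator (S p) s \<partial>lborel)"
    using cG by (intro sum_mono nn_integral_mono) (auto split: split_indicator)
  also have "\<dots> = (\<integral>\<^sup>+s. (\<Sum>p\<in>?P. G s * indicator (S p) s) \<partial>lborel)"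
    by (intro nn_integral_sum[symmetric]) (simp add: S_def)
  also have "\<dots> \<le> (\<integral>\<^sup>+s. G s * indicator {0..T} s \<partial>lborel)"
  proof (intro nn_integral_mono)
    fix s
    have "(\<Sum>p\<in>?P. G s * indicator (S p) s) = G s * indicator (\<Union>p\<in>?P. S p) s"
      using disj by (subst indicator_UN_disjoint) (auto simp: sum_distrib_left)
    also have "\<dots> \<le> G s * indicator {0..T} s"
    proof (cases "s \<in> (\<Union>p\<in>?P. S p)")
      case True
      then have "s \<in> {0..T}" using S0T by blast
      then show ?thesis by (simp add: indicator_def)
    next
      case False
      then have "indicator (\<Union>p\<in>?P. S p) s = (0 :: ennreal)" by (rule indicator_simps)
      then show ?thesis by simp
    qed
    finally show "(\<Sum>p\<in>?P. G s * indicator (S p) s) \<le> G s * indicator {0..T} s" .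
  qed
  also have "\<dots> = (\<integral>\<^sup>+s. ennreal (2 * B\<^sup>2) * (ennreal ((\<phi> s - Hc s)\<^sup>2) * indicator {0..T} s)
      + ennreal (2 * B\<^sup>2 * w\<^sup>2) * indicator {0..T} s \<partial>lborel)"
    by (intro nn_integral_cong)
      (auto simp: G_def distrib_left ennreal_plus ennreal_mult split: split_indicator)
  also have "\<dots> = ennreal (2 * B\<^sup>2) * (\<integral>\<^sup>+s. ennreal ((\<phi> s - Hc s)\<^sup>2) * indicator {0..T} s \<partial>lborel)
      + ennreal (2 * B\<^sup>2 * w\<^sup>2) * ennreal T"
    using T by (subst nn_integral_add; simp add: nn_integral_cmult nn_integral_cmult_indicator)
  also have "ennreal (2 * B\<^sup>2 * w\<^sup>2) * ennreal T = ennreal (2 * B\<^sup>2 * T * w\<^sup>2)"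
    using T by (simp add: ennreal_mult[symmetric] mult_ac)
  also have "(\<integral>\<^sup>+s. ennreal ((\<phi> s - Hc s)\<^sup>2) * indicator {0..T} s \<partial>lborel) =
      (\<integral>\<^sup>+s. ennreal ((\<phi> s - H s)\<^sup>2) * indicator {0..T} s \<partial>lborel)"
    by (intro nn_integral_cong) (auto simp: Hc_def split: split_indicator)
  finally show ?thesis unfolding \<phi>_def .
qed

section \<open>Left-point approximation of the increments of an Ito integral\<close>

context filtered_brownian_motion begin

text \<open>The grouping lets one statement serve twice: with a single group it controls the
  weighted sum of the errors, with singleton groups and weight 1 their sum of squares. For a simple
  approximation of the integral the error is an elementary sum over the refined cells, so the
  truncation estimate applies; the double limit carries the result over to \<open>I\<close>.\<close>

theorem ito_riemann_sums:
  fixes H I z :: "real \<Rightarrow> 'a \<Rightarrow> real" and grp :: "nat \<Rightarrow> nat \<Rightarrow> nat" and T :: real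
  defines "t \<equiv> dyadic T"
  assumes I: "is_ito_integral M F W H I" and z: "continuous_adapted M F z" and T: "0 < T"
  shows "tends_to_zero_in_prob M (\<lambda>m \<omega>. ennreal (\<Sum>r<2^m. (\<Sum>l | l < 2^m \<and> grp m l = r.
     z (t m l) \<omega> * (I (t m (Suc l)) \<omega> - I (t m l) \<omega> - H (t m l) \<omega> * (W (t m (Suc l)) \<omega> - W (t m l) \<omega>)))\<^sup>2))"
proof -
  have T0: "0 \<le> T" using T by simp
  let ?dW = "\<lambda>m l \<omega>. W (t m (Suc l)) \<omega> - W (t m l) \<omega>"
  obtain n \<tau> \<xi> where si: "\<And>m. simple_integrand F (n m) (\<tau> m) (\<xi> m)"
    and conv: "\<And>t. 0 \<le> t \<Longrightarrow> tends_to_zero_in_prob M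
             (\<lambda>m \<omega>. \<integral>\<^sup>+ s\<in>{0..t}. ennreal ((simple_process (n m) (\<tau> m) (\<xi> m) s \<omega> - H s \<omega>)\<^sup>2) \<partial>lborel) \<and>
           tends_to_zero_in_prob M
             (\<lambda>m \<omega>. SUP s\<in>{0..t}. ennreal \<bar>simple_integral W (n m) (\<tau> m) (\<xi> m) s \<omega> - I s \<omega>\<bar>)"
    and Had: "continuous_adapted M F H" and Iad: "continuous_adapted M F I"
    using I unfolding is_ito_integral_def by blast
  define f1 where "f1 m \<omega> = (\<integral>\<^sup>+ s\<in>{0..T}. ennreal ((simple_process (n m) (\<tau> m) (\<xi> m) s \<omega> - H s \<omega>)\<^sup>2) \<partial>lborel)" for m \<omega>
  define f2 where "f2 m \<omega> = (SUP s\<in>{0..T}. ennreal \<bar>simple_integral W (n m) (\<tau> m) (\<xi> m) s \<omega> - I s \<omega>\<bar>)" for m \<omega>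
  have ff: "tends_to_zero_in_prob M f1" "tends_to_zero_in_prob M f2"
    using conv[OF T0] unfolding f1_def[abs_def] f2_def[abs_def] by auto
  \<comment> \<open>Both approximation errors should vanish almost surely, as the double limit is
    taken path by path in \<open>q\<close>.\<close>
  obtain k where k: "strict_mono k" "AE \<omega> in M. \<forall>f\<in>{f1, f2}. (\<lambda>q. f (k q) \<omega>) \<longlonglongrightarrow> 0"
    by (rule tends_in_prob_subseq[OF prob_space_axioms, of "{f1, f2}"]) (use ff in auto)
  have "\<exists>n' \<tau>' \<xi>'. simple_integrand F n' \<tau>' \<xi>' \<and> \<tau>' 0 = 0 \<and> T \<le> \<tau>' n' \<and>
    (\<forall>u \<omega>. simple_process n' \<tau>' \<xi>' u \<omega> = simple_process (n (k q)) (\<tau> (k q)) (\<xi> (k q)) u \<omega>) \<and>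
    (\<forall>u \<omega>. simple_integral W n' \<tau>' \<xi>' u \<omega> = simple_integral W (n (k q)) (\<tau> (k q)) (\<xi> (k q)) u \<omega>)" for q
    by (rule simple_integrand_pad[OF si, of T "k q" W]) blast
  then obtain nn \<sigma> x where pad: "\<And>q. simple_integrand F (nn q) (\<sigma> q) (x q)" "\<And>q. \<sigma> q 0 = 0" "\<And>q. T \<le> \<sigma> q (nn q)"
    "\<And>q u \<omega>. simple_process (nn q) (\<sigma> q) (x q) u \<omega> = simple_process (n (k q)) (\<tau> (k q)) (\<xi> (k q)) u \<omega>"
    "\<And>q u \<omega>. simple_integral W (nn q) (\<sigma> q) (x q) u \<omega> = simple_integral W (n (k q)) (\<tau> (k q)) (\<xi> (k q)) u \<omega>"
    by metis
  have \<sigma>mono: "\<forall>i<nn q. \<sigma> q i \<le> \<sigma> q (Suc i)" for q using pad(1)[of q] by (simp add: simple_integrand_def)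
  have xmeas: "i < nn q \<Longrightarrow> x q i \<in> borel_measurable (F (\<sigma> q i))" for q i using pad(1)[of q] by (simp add: simple_integrand_def)
  have tmono: "mono (t m)" for m unfolding t_def using T0 by (rule dyadic_mono)
  have tt: "t m l \<le> t m (Suc l)" for m l using tmono by (simp add: monoD)
  have t0: "0 \<le> t m l" for m l using monoD[OF tmono, of 0 l m] by (simp add: t_def)
  have tT: "l < 2 ^ m \<Longrightarrow> t m (Suc l) \<le> T" for m l using dyadic_mem[OF T0, of "Suc l" m] by (simp add: t_def)
  define a where "a m q l i = clip (t m l) (t m (Suc l)) (\<sigma> q i)" for m q l i
  let ?da = "\<lambda>m q l i \<omega>. W (a m q l (Suc i)) \<omega> - W (a m q l i) \<omega>"
  define SI where "SI q u \<omega> = simple_integral W (nn q) (\<sigma> q) (x q) u \<omega>" for q u \<omega>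
  \<comment> \<open>The coefficient of the error on the cell given by grid interval
    \<open>fst p\<close> and step \<open>snd p\<close>. It is 0 on an empty cell, where
    \<open>x q (snd p)\<close> need not be known at the left end point.\<close>
  define \<psi> where "\<psi> m q p \<omega> = (if a m q (fst p) (snd p) < a m q (fst p) (Suc (snd p))
     then z (t m (fst p)) \<omega> * (x q (snd p) \<omega> - H (t m (fst p)) \<omega>) else 0)" for m q p \<omega>
  define g where "g m q \<omega> = ennreal (\<Sum>r<2^m. (\<Sum>l | l < 2^m \<and> grp m l = r.
     z (t m l) \<omega> * (SI q (t m (Suc l)) \<omega> - SI q (t m l) \<omega> - H (t m l) \<omega> * (?dW m l \<omega>)))\<^sup>2)" for m q \<omega>
  define V where "V m q \<omega> = ennreal (\<Sum>p\<in>{..<2^m} \<times> {..<nn q}.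
      (\<psi> m q p \<omega>)\<^sup>2 * (a m q (fst p) (Suc (snd p)) - a m q (fst p) (snd p)))" for m q \<omega>
  have a_bounds: "t m l \<le> a m q l i" "a m q l i \<le> t m (Suc l)" for m q l i
    unfolding a_def using clip_bounds[OF tt] by auto
  have a0: "0 \<le> a m q l i" for m q l i using a_bounds(1)[of m l q i] t0[of m l] by simp
  have a_le: "i < nn q \<Longrightarrow> a m q l i \<le> a m q l (Suc i)" for m q l i
    unfolding a_def using \<sigma>mono[of q] by (auto intro: clip_mono)
  have zF: "0 \<le> u \<Longrightarrow> z u \<in> borel_measurable (F u)" for u using z by (simp add: continuous_adapted_def)
  have HF: "0 \<le> u \<Longrightarrow> H u \<in> borel_measurable (F u)" for u using Had by (simp add: continuous_adapted_def)
  have IF: "0 \<le> u \<Longrightarrow> I u \<in> borel_measurable (F u)" for u using Iad by (simp add: continuous_adapted_def)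
  have [measurable]: "z (t m l) \<in> borel_measurable M" "H (t m l) \<in> borel_measurable M"
    "I (t m l) \<in> borel_measurable M" "W (t m l) \<in> borel_measurable M" "W (a m q l i) \<in> borel_measurable M" for m q l i
    by (rule F_measurable_M[OF zF[OF t0] t0] F_measurable_M[OF HF[OF t0] t0] F_measurable_M[OF IF[OF t0] t0]
        W_measurable[OF t0] W_measurable[OF a0])+
  have \<psi>F: "\<psi> m q p \<in> borel_measurable (F (a m q (fst p) (snd p)))" if p: "snd p < nn q" for m q p
  proof (cases "a m q (fst p) (snd p) < a m q (fst p) (Suc (snd p))")
    case True
    let ?u = "a m q (fst p) (snd p)"
    have "\<sigma> q (snd p) \<le> ?u" using True tt[of m "fst p"] by (auto simp: a_def clip_def split: if_splits)
    then have [measurable]: "x q (snd p) \<in> borel_measurable (F ?u)"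
      using xmeas[OF p] by (rule F_measurable_mono[rotated])
    have [measurable]: "z (t m (fst p)) \<in> borel_measurable (F ?u)" "H (t m (fst p)) \<in> borel_measurable (F ?u)"
      by (rule F_measurable_mono[OF zF[OF t0] a_bounds(1)], rule F_measurable_mono[OF HF[OF t0] a_bounds(1)])
    show ?thesis unfolding \<psi>_def using True by simp
  next
    case False
    then show ?thesis unfolding \<psi>_def by simp
  qed
  have \<psi>M: "\<psi> m q p \<in> borel_measurable M" if "snd p < nn q" for m q p
    using \<psi>F[OF that] a0 by (rule F_measurable_M)
  have block: "(\<Sum>i<nn q. \<psi> m q (l, i) \<omega> * (?da m q l i \<omega>)) =
      z (t m l) \<omega> * (SI q (t m (Suc l)) \<omega> - SI q (t m l) \<omega> - H (t m l) \<omega> * (?dW m l \<omega>))"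
    if l: "l < 2 ^ m" for m q l \<omega>
  proof -
    have "(\<Sum>i<nn q. \<psi> m q (l, i) \<omega> * (?da m q l i \<omega>)) =
       (\<Sum>i<nn q. z (t m l) \<omega> * (x q i \<omega> * (?da m q l i \<omega>)
          - H (t m l) \<omega> * (?da m q l i \<omega>)))"
    proof (intro sum.cong refl)
      fix i assume "i \<in> {..<nn q}"
      then have "a m q l i \<le> a m q l (Suc i)" using a_le by auto
      then consider "a m q l i < a m q l (Suc i)" | "a m q l i = a m q l (Suc i)" by linarith
      then show "\<psi> m q (l, i) \<omega> * (?da m q l i \<omega>) =
        z (t m l) \<omega> * (x q i \<omega> * (?da m q l i \<omega>)
          - H (t m l) \<omega> * (?da m q l i \<omega>))"
        by cases (simp_all add: \<psi>_def algebra_simps)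
    qed
    also have "\<dots> = z (t m l) \<omega> * ((\<Sum>i<nn q. x q i \<omega> * (?da m q l i \<omega>))
          - H (t m l) \<omega> * (\<Sum>i<nn q. ?da m q l i \<omega>))"
      by (simp only: sum_distrib_left[symmetric] sum_subtractf)
    also have "(\<Sum>i<nn q. x q i \<omega> * (?da m q l i \<omega>)) = SI q (t m (Suc l)) \<omega> - SI q (t m l) \<omega>"
      unfolding SI_def a_def by (rule simple_integral_increment[OF tt, symmetric])
    also have "(\<Sum>i<nn q. ?da m q l i \<omega>) = ?dW m l \<omega>"
      unfolding a_def using tt[of m l] t0[of m l] tT[OF l] pad(2)[of q] pad(3)[of q] by (intro clip_telescope) auto
    finally show ?thesis .
  qed
  define Jr where "Jr m q r = {l. l < 2^m \<and> grp m l = r} \<times> {..<nn q}" for m q r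
  have blocks: "(\<Sum>p\<in>Jr m q r. \<psi> m q p \<omega> * (?da m q (fst p) (snd p) \<omega>)) =
     (\<Sum>l | l < 2^m \<and> grp m l = r. z (t m l) \<omega> * (SI q (t m (Suc l)) \<omega> - SI q (t m l) \<omega>
         - H (t m l) \<omega> * (?dW m l \<omega>)))" for m q r \<omega>
  proof -
    have "(\<Sum>l | l < 2^m \<and> grp m l = r. z (t m l) \<omega> * (SI q (t m (Suc l)) \<omega> - SI q (t m l) \<omega>
         - H (t m l) \<omega> * (?dW m l \<omega>))) =
       (\<Sum>l | l < 2^m \<and> grp m l = r. \<Sum>i<nn q. \<psi> m q (l, i) \<omega> * (?da m q l i \<omega>))"
      by (intro sum.cong refl block[symmetric]) simp
    then show ?thesis unfolding Jr_def by (simp add: sum.cartesian_product case_prod_beta)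
  qed
  have gM [measurable]: "g m q \<in> borel_measurable M" for m q
    unfolding g_def blocks[symmetric]
    by (intro measurable_compose[OF _ measurable_ennreal] borel_measurable_sum borel_measurable_power
      borel_measurable_times \<psi>M borel_measurable_diff) (auto simp: Jr_def)
  have VM [measurable]: "V m q \<in> borel_measurable M" for m q
    unfolding V_def
    by (intro measurable_compose[OF _ measurable_ennreal] borel_measurable_sum borel_measurable_power
      borel_measurable_times \<psi>M borel_measurable_const) auto
  show ?thesis
  proof (rule tends_in_prob_double_limit[OF prob_space_axioms gM VM])
    show "(\<lambda>\<omega>. ennreal (\<Sum>r<2^m. (\<Sum>l | l < 2^m \<and> grp m l = r.
     z (t m l) \<omega> * (I (t m (Suc l)) \<omega> - I (t m l) \<omega> - H (t m l) \<omega> * (?dW m l \<omega>)))\<^sup>2)) \<in> borel_measurable M" for m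
      by measurable
    show "AE \<omega> in M. \<forall>m. (\<lambda>q. g m q \<omega>) \<longlonglongrightarrow> ennreal (\<Sum>r<2^m. (\<Sum>l | l < 2^m \<and> grp m l = r.
     z (t m l) \<omega> * (I (t m (Suc l)) \<omega> - I (t m l) \<omega> - H (t m l) \<omega> * (?dW m l \<omega>)))\<^sup>2)"
      using k(2)
    proof eventually_elim
      case (elim \<omega>)
      have SI: "(\<lambda>q. SI q u \<omega>) \<longlonglongrightarrow> I u \<omega>" if u: "u \<in> {0..T}" for u
      proof -
        have "(\<lambda>q. ennreal \<bar>SI q u \<omega> - I u \<omega>\<bar>) \<longlonglongrightarrow> 0"
        proof (rule tendsto_sandwich[OF _ _ tendsto_const])
          show "(\<lambda>q. f2 (k q) \<omega>) \<longlonglongrightarrow> 0" using elim by simp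
          show "\<forall>\<^sub>F q in sequentially. ennreal \<bar>SI q u \<omega> - I u \<omega>\<bar> \<le> f2 (k q) \<omega>"
            unfolding f2_def SI_def pad(5) using u by (intro always_eventually allI SUP_upper)
        qed auto
        then have "(\<lambda>q. \<bar>SI q u \<omega> - I u \<omega>\<bar>) \<longlonglongrightarrow> 0" by (subst (asm) ennreal_tendsto_0_iff) auto
        then show ?thesis by (simp add: tendsto_rabs_zero_iff LIM_zero_cancel)
      qed
      show ?case unfolding g_def
      proof (intro allI tendsto_ennrealI tendsto_sum tendsto_power tendsto_mult tendsto_diff tendsto_const)
        fix m r l :: nat
        assume "l \<in> {l. l < 2 ^ m \<and> grp m l = r}"
        then have "t m l \<in> {0..T}" "t m (Suc l) \<in> {0..T}" unfolding t_def using T0 by (auto intro!: dyadic_mem simp del: atLeastAtMost_iff)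
        then show "(\<lambda>q. SI q (t m (Suc l)) \<omega>) \<longlonglongrightarrow> I (t m (Suc l)) \<omega>" "(\<lambda>q. SI q (t m l) \<omega>) \<longlonglongrightarrow> I (t m l) \<omega>"
          by (auto intro!: SI simp del: atLeastAtMost_iff)
      qed
    qed
    have "AE \<omega> in M. continuous_on {0..} (\<lambda>t. z t \<omega>)" "AE \<omega> in M. continuous_on {0..} (\<lambda>t. H t \<omega>)"
      using z Had by (auto simp: continuous_adapted_def)
    then show "AE \<omega> in M. (\<lambda>m. limsup (\<lambda>q. V m q \<omega>)) \<longlonglongrightarrow> 0"
      using k(2)
    proof eventually_elim
      case (elim \<omega>)
      have cz: "continuous_on {0..T} (\<lambda>t. z t \<omega>)" and cH: "continuous_on {0..T} (\<lambda>t. H t \<omega>)"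
        using elim by (auto intro: continuous_on_subset)
      have "bounded ((\<lambda>t. z t \<omega>) ` {0..T})"
        using cz by (intro compact_imp_bounded compact_continuous_image) auto
      then obtain B where B: "0 < B" "\<And>u. u \<in> {0..T} \<Longrightarrow> \<bar>z u \<omega>\<bar> \<le> B" by (auto simp: bounded_pos)
      show ?case
      proof (rule order_tendstoI)
        fix e :: ennreal assume "0 < e"
        then obtain e0 where e0: "0 < e0" "ennreal e0 < e"
          by (metis ennreal_0 ennreal_less_zero_iff less_ennreal.rep_eq dense ennreal_cases order_less_le_trans ennreal_lessI
              not_less_iff_gr_or_eq top.not_eq_extremum less_top_ennreal)
        \<comment> \<open>Makes the oscillation term \<open>2 * B\<^sup>2 * T * w\<^sup>2\<close>
          equal to \<open>e0\<close>; the other term of the error bound vanishes as \<open>q\<close>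
          grows.\<close>
        define w where "w = sqrt (e0 / (2 * B\<^sup>2 * T))"
        have w: "0 < w" "2 * B\<^sup>2 * T * w\<^sup>2 = e0" using e0 B T by (simp_all add: w_def)
        from dyadic_small_osc[OF T cH w(1)] show "\<forall>\<^sub>F m in sequentially. limsup (\<lambda>q. V m q \<omega>) < e"
        proof eventually_elim
          case inner: (elim m)
          have "V m q \<omega> \<le> ennreal (2 * B\<^sup>2) * f1 (k q) \<omega> + ennreal (2 * B\<^sup>2 * T * w\<^sup>2)" for q
          proof -
            have "V m q \<omega> = ennreal (\<Sum>l<2^m. \<Sum>i<nn q. (if clip (t m l) (t m (Suc l)) (\<sigma> q i) < clip (t m l) (t m (Suc l)) (\<sigma> q (Suc i))
                then z (t m l) \<omega> * (x q i \<omega> - H (t m l) \<omega>) else 0)\<^sup>2 * (clip (t m l) (t m (Suc l)) (\<sigma> q (Suc i)) - clip (t m l) (t m (Suc l)) (\<sigma> q i)))"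
              unfolding V_def \<psi>_def a_def by (simp add: sum.cartesian_product case_prod_beta)
            also have "\<dots> \<le> ennreal (2 * B\<^sup>2) * (\<integral>\<^sup>+s\<in>{0..T}. ennreal (((\<Sum>i<nn q. x q i \<omega> * indicator {\<sigma> q i<..\<sigma> q (Suc i)} s) - H s \<omega>)\<^sup>2) \<partial>lborel)
               + ennreal (2 * B\<^sup>2 * T * w\<^sup>2)"
            proof (rule simple_error_bound[OF tmono _ _ \<sigma>mono cH])
              show "\<bar>H s \<omega> - H (t m l) \<omega>\<bar> \<le> w" if "l < 2 ^ m" "s \<in> {t m l..t m (Suc l)}" for l s
                using inner that unfolding t_def dist_real_def by blast
              show "\<bar>z (t m l) \<omega>\<bar> \<le> B" if "l < 2 ^ m" for l
                unfolding t_def using that T0 by (intro B dyadic_mem) auto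
            qed (simp_all add: t_def)
            also have "(\<integral>\<^sup>+s\<in>{0..T}. ennreal (((\<Sum>i<nn q. x q i \<omega> * indicator {\<sigma> q i<..\<sigma> q (Suc i)} s) - H s \<omega>)\<^sup>2) \<partial>lborel) = f1 (k q) \<omega>"
              by (simp only: f1_def pad(4)[symmetric]) (simp only: simple_process_def)
            finally show ?thesis .
          qed
          moreover have "(\<lambda>q. ennreal (2 * B\<^sup>2) * f1 (k q) \<omega> + ennreal (2 * B\<^sup>2 * T * w\<^sup>2)) \<longlonglongrightarrow> ennreal (2 * B\<^sup>2) * 0 + ennreal (2 * B\<^sup>2 * T * w\<^sup>2)"
            using elim(3) by (intro tendsto_add tendsto_const ennreal_tendsto_cmult) auto
          ultimately have "limsup (\<lambda>q. V m q \<omega>) \<le> ennreal (2 * B\<^sup>2) * 0 + ennreal (2 * B\<^sup>2 * T * w\<^sup>2)"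
            using Limsup_mono[of "\<lambda>q. V m q \<omega>" _ sequentially] lim_imp_Limsup
            by (metis (no_types, lifting) always_eventually trivial_limit_sequentially)
          also have "\<dots> < e" using e0(2) unfolding w(2) by simp
          finally show "limsup (\<lambda>q. V m q \<omega>) < e" .
        qed
      qed simp
    qed
    fix m q :: nat and \<alpha> \<beta> :: real assume pos: "0 < \<alpha>" "0 < \<beta>"
    let ?I = "{..<2^m} \<times> {..<nn q}"
    have "measure M {\<omega> \<in> space M. \<alpha> < (\<Sum>r\<in>{..<2^m}. (\<Sum>p\<in>Jr m q r. \<psi> m q p \<omega> * (?da m q (fst p) (snd p) \<omega>))\<^sup>2) \<and>
      (\<Sum>p\<in>?I. (\<psi> m q p \<omega>)\<^sup>2 * (a m q (fst p) (Suc (snd p)) - a m q (fst p) (snd p))) \<le> \<beta>} \<le> \<beta> / \<alpha>"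
    \<comment> \<open>This numbering counts the pairs lexicographically, hence in temporal
      order.\<close>
    proof (rule simple_sum_truncation_estimate[where \<rho> = "\<lambda>p. fst p * nn q + snd p"])
      show "inj_on (\<lambda>p. fst p * nn q + snd p) ?I"
      proof (rule inj_onI, clarsimp)
        fix l i l' i' assume "i < nn q" "i' < nn q" "l * nn q + i = l' * nn q + i'"
        then show "l = l' \<and> i = i'"
          by (metis add.commute div_mult_self3 mod_mult_self3 mod_less div_less add_0 gr_implies_not0)
      qed
      fix p p' assume p: "p \<in> ?I" and p': "p' \<in> ?I" and lt: "fst p * nn q + snd p < fst p' * nn q + snd p'"
      have "fst p < fst p' \<or> (fst p = fst p' \<and> snd p < snd p')"
      proof (cases "fst p' < fst p")
        case True
        then have "Suc (fst p') * nn q \<le> fst p * nn q" by (intro mult_le_mono1) simp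
        then show ?thesis using lt p' by (auto simp: algebra_simps)
      next
        case False
        then show ?thesis using lt by (cases "fst p = fst p'") auto
      qed
      then show "a m q (fst p) (Suc (snd p)) \<le> a m q (fst p') (snd p')"
        unfolding a_def using p p' by (intro clip_ordered[OF tmono \<sigma>mono]) auto
    next
      show "disjoint_family_on (Jr m q) {..<2^m}" by (auto simp: disjoint_family_on_def Jr_def)
    qed (use pos a0 a_le \<psi>F in \<open>auto simp: Jr_def\<close>)
    moreover have "{\<omega> \<in> space M. g m q \<omega> > ennreal \<alpha> \<and> V m q \<omega> \<le> ennreal \<beta>} =
     {\<omega> \<in> space M. \<alpha> < (\<Sum>r\<in>{..<2^m}. (\<Sum>p\<in>Jr m q r. \<psi> m q p \<omega> * (?da m q (fst p) (snd p) \<omega>))\<^sup>2) \<and>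
      (\<Sum>p\<in>?I. (\<psi> m q p \<omega>)\<^sup>2 * (a m q (fst p) (Suc (snd p)) - a m q (fst p) (snd p))) \<le> \<beta>}"
      unfolding g_def V_def blocks using pos by (auto simp: ennreal_less_iff)
    ultimately show "measure M {\<omega> \<in> space M. g m q \<omega> > ennreal \<alpha> \<and> V m q \<omega> \<le> ennreal \<beta>} \<le> \<beta> / \<alpha>" by simp
  qed
qed

end

section \<open>The scalar Stratonovich equation along a path\<close>

text \<open>Taylor's remainder together with exp 1 \<le> 3; the division by 2 in the remainder is
  given away.\<close>

lemma exp_second_order_bound:
  fixes z :: complex
  assumes "norm z \<le> 1"
  shows "norm (exp (- z) - (1 - z + z\<^sup>2 / 2)) \<le> 3 * norm z ^ 3"
proof -
  have "norm (exp (-z) - (\<Sum>k\<le>2. (-z) ^ k / fact k)) \<le> exp \<bar>Re (-z)\<bar> * (norm (-z)) ^ Suc 2 / fact 2"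
    by (rule Taylor_exp)
  also have "(\<Sum>k\<le>2. (-z) ^ k / fact k) = 1 - z + z\<^sup>2 / 2"
    by (simp add: numeral_2_eq_2 power2_eq_square)
  also have "exp \<bar>Re (-z)\<bar> * (norm (-z)) ^ Suc 2 / fact 2 \<le> 3 * norm z ^ 3"
  proof -
    have "exp \<bar>Re (-z)\<bar> \<le> exp 1" using assms abs_Re_le_cmod[of z] by simp
    also have "\<dots> \<le> (3::real)" using exp_le by simp
    finally have "exp \<bar>Re (-z)\<bar> * norm z ^ 3 \<le> 3 * norm z ^ 3" by (intro mult_right_mono) auto
    moreover have "0 \<le> norm z ^ 3" by simp
    moreover have "exp \<bar>Re (-z)\<bar> * (norm (-z)) ^ Suc 2 / fact 2 = exp \<bar>Re (-z)\<bar> * norm z ^ 3 / 2"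
      by (simp add: eval_nat_numeral)
    ultimately show ?thesis by linarith
  qed
  finally show ?thesis .
qed

text \<open>Terms that are uniformly negligible compared with terms of bounded sum. The comparison
  terms will be step lengths, squares of \<open>\<theta>\<close> and increments of a path of bounded
  variation.\<close>

lemma sum_small_tendsto_0:
  fixes x :: "nat \<Rightarrow> nat \<Rightarrow> complex" and y :: "nat \<Rightarrow> nat \<Rightarrow> real"
  assumes small: "\<And>e. 0 < e \<Longrightarrow> \<forall>\<^sub>F n in sequentially. \<forall>l<N n. norm (x n l) \<le> e * y n l"
    and bound: "\<And>n. (\<Sum>l<N n. y n l) \<le> C"
  shows "(\<lambda>n. \<Sum>l<N n. norm (x n l)) \<longlonglongrightarrow> 0"
proof (rule tendstoI)
  fix e :: real assume e: "0 < e"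
  define e' where "e' = e / (2 * (\<bar>C\<bar> + 1))"
  have e': "0 < e'" using e by (simp add: e'_def)
  show "\<forall>\<^sub>F n in sequentially. dist (\<Sum>l<N n. norm (x n l)) 0 < e"
    using small[OF e']
  proof eventually_elim
    case (elim n)
    have "(\<Sum>l<N n. norm (x n l)) \<le> (\<Sum>l<N n. e' * y n l)" using elim by (intro sum_mono) auto
    also have "\<dots> \<le> e' * C" using bound[of n] e' by (simp add: sum_distrib_left[symmetric])
    also have "\<dots> \<le> e' * (\<bar>C\<bar> + 1)" using e' by (intro mult_left_mono) auto
    also have "\<dots> = e / 2" by (simp add: e'_def field_simps)
    also have "\<dots> < e" using e by simp
    finally show ?case by (simp add: sum_nonneg dist_real_def)
  qed
qed

lemma sum_norm_tendsto_0:
  fixes x :: "nat \<Rightarrow> nat \<Rightarrow> 'b::real_normed_vector"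
  assumes "(\<lambda>n. \<Sum>l<N n. norm (x n l)) \<longlonglongrightarrow> 0"
  shows "(\<lambda>n. \<Sum>l<N n. x n l) \<longlonglongrightarrow> 0"
  using assms by (rule Lim_null_comparison[OF always_eventually, rotated]) (simp add: norm_sum)

lemma sum_bounded_factor_tendsto_0:
  fixes x z :: "nat \<Rightarrow> nat \<Rightarrow> complex"
  assumes "(\<lambda>n. \<Sum>l<N n. norm (x n l)) \<longlonglongrightarrow> 0" "\<And>n l. l < N n \<Longrightarrow> norm (z n l) \<le> B"
  shows "(\<lambda>n. \<Sum>l<N n. norm (z n l * x n l)) \<longlonglongrightarrow> 0"
proof (rule tendsto_sandwich[OF _ _ tendsto_const])
  show "(\<lambda>n. B * (\<Sum>l<N n. norm (x n l))) \<longlonglongrightarrow> 0" using tendsto_mult_right_zero[OF assms(1)] .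
  show "\<forall>\<^sub>F n in sequentially. (\<Sum>l<N n. norm (z n l * x n l)) \<le> B * (\<Sum>l<N n. norm (x n l))"
    by (intro always_eventually allI) (auto simp: sum_distrib_left norm_mult intro!: sum_mono mult_right_mono assms(2))
qed (auto intro!: always_eventually sum_nonneg)

text \<open>Replacing \<open>D\<close> by its discrete counterpart \<open>M\<close> cancels the two second-order terms
  \<open>y * t\<^sup>2 / 2\<close>, as in the Stratonovich chain rule.\<close>

lemma second_order_expansion:
  fixes y dy t G d E D M k r :: complex
  assumes dy: "dy = y * t + G" and G: "G = d + E + D / 2" and M: "M = D - dy * (t - k)"
  shows "(y + dy) * (1 - t + t\<^sup>2 / 2 + r) - y =
    d + E + M / 2 - G * t / 2 - k * dy / 2 + dy * t\<^sup>2 / 2 + (y + dy) * r"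
proof -
  have D: "D = 2 * (G - d - E)" unfolding G by (simp add: field_simps)
  show ?thesis unfolding M D dy by (simp add: field_simps power2_eq_square)
qed

text \<open>Deterministic data on one path. \<open>J j\<close> stands for the Ito integral of
  \<open>\<nu> j * Y\<close> against \<open>w j\<close> and \<open>D j\<close> for the covariation
  of the two, but they are known only through limits along the levels \<open>h n\<close>. In
  \<open>cov\<close> the number \<open>r * 2 ^ (h n - q)\<close> is the index of the time
  \<open>T * r / 2 ^ q\<close> on level \<open>h n\<close> as soon as \<open>q \<le> h n\<close>.
  \<open>Z\<close> is the reciprocal of the expected exponential, normalised to 1 at time 0, so the
  aim is to show that \<open>Z * Y\<close> keeps its initial value.\<close>

locale stratonovich_path =
  fixes T :: real and Y :: "real \<Rightarrow> complex" and J D :: "'l::finite \<Rightarrow> real \<Rightarrow> complex"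
    and w :: "'l \<Rightarrow> real \<Rightarrow> real" and \<kappa> y :: complex and \<nu> :: "'l \<Rightarrow> complex"
    and h :: "nat \<Rightarrow> nat" and V K :: real
    and N :: "nat \<Rightarrow> nat" and g :: "nat \<Rightarrow> nat \<Rightarrow> real" and Z :: "real \<Rightarrow> complex"
  defines "N \<equiv> \<lambda>n. 2 ^ h n" and "g \<equiv> \<lambda>n. dyadic T (h n)"
    and "Z \<equiv> \<lambda>u. exp (- (\<kappa> * of_real u + (\<Sum>j\<in>UNIV. \<nu> j * of_real (w j u - w j 0))))"
  assumes T: "0 < T"
    and contY: "continuous_on {0..T} Y"
    and contw: "\<And>j. continuous_on {0..T} (w j)"
    and contD: "\<And>j. continuous_on {0..T} (D j)"
    and eq: "\<And>u. u \<in> {0..T} \<Longrightarrow> Y u = y + \<kappa> * integral {0..u} Y + (\<Sum>j\<in>UNIV. J j u + D j u / 2)"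
    and h: "strict_mono h"
    and varD: "\<And>j n. (\<Sum>l<N n. norm (D j (g n (Suc l)) - D j (g n l))) \<le> V"
    and quadw: "\<And>j n. (\<Sum>l<N n. (w j (g n (Suc l)) - w j (g n l))\<^sup>2) \<le> K"
    and ito: "\<And>j. (\<lambda>n. \<Sum>l<N n. Z (g n l) * (J j (g n (Suc l)) - J j (g n l)
        - \<nu> j * Y (g n l) * of_real (w j (g n (Suc l)) - w j (g n l)))) \<longlonglongrightarrow> 0"
    and ito2: "\<And>j. (\<lambda>n. \<Sum>l<N n. (norm (J j (g n (Suc l)) - J j (g n l)
        - \<nu> j * Y (g n l) * of_real (w j (g n (Suc l)) - w j (g n l))))\<^sup>2) \<longlonglongrightarrow> 0"
    and cov: "\<And>j q r. r \<le> 2 ^ q \<Longrightarrow> (\<lambda>n. \<Sum>l<r * 2 ^ (h n - q). \<nu> j * (Y (g n (Suc l)) - Y (g n l))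
        * of_real (w j (g n (Suc l)) - w j (g n l))) \<longlonglongrightarrow> D j (T * real r / 2 ^ q)"
begin

lemma g_mem: "l \<le> N n \<Longrightarrow> g n l \<in> {0..T}"
  unfolding g_def N_def using T by (intro dyadic_mem) auto

lemma g_0 [simp]: "g n 0 = 0" and g_N [simp]: "g n (N n) = T"
  by (simp_all add: g_def N_def)

lemma g_step: "g n (Suc l) - g n l = T / 2 ^ h n"
  by (simp add: g_def dyadic_step)

lemma h_ge: "\<forall>\<^sub>F n in sequentially. q \<le> h n"
proof -
  have "\<And>n. n \<ge> q \<Longrightarrow> q \<le> h n" using h by (meson order_trans strict_mono_imp_increasing)
  then show ?thesis by (auto simp: eventually_sequentially)
qed

lemma small_osc_step:
  fixes f :: "real \<Rightarrow> 'b::metric_space"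
  assumes f: "continuous_on {0..T} f" and e: "0 < e"
  shows "\<forall>\<^sub>F n in sequentially. \<forall>l<N n. \<forall>u\<in>{g n l..g n (Suc l)}. dist (f u) (f (g n l)) \<le> e"
  using eventually_subseq[OF h dyadic_small_osc[OF T f e]] unfolding g_def N_def .

section \<open>The terms of the expansion over a single cell\<close>

definition "dw j n l = w j (g n (Suc l)) - w j (g n l)"
definition "dY n l = Y (g n (Suc l)) - Y (g n l)"
definition "dD j n l = D j (g n (Suc l)) - D j (g n l)"
text \<open>The increment of the exponent of \<open>1 / Z\<close>, and so the relative increment of
  \<open>Y\<close> to first order. What \<open>dY\<close> contains beyond
  \<open>Y * \<theta>\<close> is collected in \<open>G\<close> below.\<close>

definition "\<theta> n l = \<kappa> * of_real (T / 2 ^ h n) + (\<Sum>j\<in>UNIV. \<nu> j * of_real (dw j n l))"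
definition "drift n l = \<kappa> * (integral {g n l..g n (Suc l)} Y - Y (g n l) * of_real (T / 2 ^ h n))"
definition "err j n l = J j (g n (Suc l)) - J j (g n l) - \<nu> j * Y (g n l) * of_real (dw j n l)"
definition "G n l = drift n l + (\<Sum>j\<in>UNIV. err j n l) + (\<Sum>j\<in>UNIV. dD j n l) / 2"
text \<open>The given covariation compared with its discrete counterpart on one cell. These terms
  need not be absolutely summable to something small; only their sums over long blocks of cells tend
  to 0.\<close>

definition "mism j n l = dD j n l - \<nu> j * dY n l * of_real (dw j n l)"
definition "\<rho> n l = exp (- \<theta> n l) - (1 - \<theta> n l + (\<theta> n l)\<^sup>2 / 2)"

lemma contZ: "continuous_on {0..T} Z"
  unfolding Z_def using contw by (intro continuous_intros) auto

lemma bounded_on: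
  fixes f :: "real \<Rightarrow> complex"
  assumes "continuous_on {0..T} f"
  shows "\<exists>B. 0 < B \<and> (\<forall>u\<in>{0..T}. norm (f u) \<le> B)"
  using compact_imp_bounded[OF compact_continuous_image[OF assms]] by (auto simp: bounded_pos)

text \<open>Both integrals in the equation are replaced by their left-point values, which add up to
  \<open>Y * \<theta>\<close>. The replacement errors and half the increments of the covariations
  make up \<open>G\<close>.\<close>

lemma dY_eq:
  assumes "l < N n"
  shows "dY n l = Y (g n l) * \<theta> n l + G n l"
proof -
  have m: "g n l \<in> {0..T}" "g n (Suc l) \<in> {0..T}" using assms g_mem by auto
  have le: "g n l \<le> g n (Suc l)" using g_step[of n l] T by (simp add: algebra_simps)
  have "integral {0..g n l} Y + integral {g n l..g n (Suc l)} Y = integral {0..g n (Suc l)} Y"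
    using m le contY by (intro Henstock_Kurzweil_Integration.integral_combine integrable_continuous_interval)
      (auto intro: continuous_on_subset)
  then have i: "integral {0..g n (Suc l)} Y = integral {0..g n l} Y + integral {g n l..g n (Suc l)} Y" by simp
  have 1: "dY n l = \<kappa> * integral {g n l..g n (Suc l)} Y + (\<Sum>j\<in>UNIV. J j (g n (Suc l)) - J j (g n l)) + (\<Sum>j\<in>UNIV. dD j n l) / 2"
    unfolding dY_def eq[OF m(1)] eq[OF m(2)] i dD_def
    by (simp add: sum.distrib sum_subtractf sum_divide_distrib diff_divide_distrib distrib_left)
  have 2: "(\<Sum>j\<in>UNIV. err j n l) = (\<Sum>j\<in>UNIV. J j (g n (Suc l)) - J j (g n l)) - Y (g n l) * (\<Sum>j\<in>UNIV. \<nu> j * of_real (dw j n l))"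
    unfolding err_def sum_subtractf sum_distrib_left by (simp add: mult_ac)
  show ?thesis
    unfolding 1 G_def 2 drift_def \<theta>_def by (simp add: algebra_simps)
qed

lemma Z_step: "Z (g n (Suc l)) = Z (g n l) * exp (- \<theta> n l)"
proof -
  have "\<kappa> * of_real (g n (Suc l)) + (\<Sum>j\<in>UNIV. \<nu> j * of_real (w j (g n (Suc l)) - w j 0)) =
    \<kappa> * of_real (g n l) + (\<Sum>j\<in>UNIV. \<nu> j * of_real (w j (g n l) - w j 0)) + \<theta> n l"
    unfolding \<theta>_def g_step[of n l, symmetric] dw_def
    by (simp add: algebra_simps sum.distrib sum_subtractf)
  then show ?thesis unfolding Z_def by (simp add: exp_add[symmetric] exp_diff exp_minus field_simps)
qed

text \<open>The sum of each of the seven terms over the grid tends to 0. The increment of the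
  covariation, which is of the same order as the square of \<open>\<theta>\<close>, has been
  absorbed into \<open>mism\<close> except where it is multiplied by another small factor inside
  \<open>G\<close>.\<close>

lemma product_step:
  assumes "l < N n"
  shows "Z (g n (Suc l)) * Y (g n (Suc l)) - Z (g n l) * Y (g n l) =
    Z (g n l) * drift n l + (\<Sum>j\<in>UNIV. Z (g n l) * err j n l) + (\<Sum>j\<in>UNIV. Z (g n l) * mism j n l) / 2
     - Z (g n l) * (G n l * \<theta> n l) / 2 - Z (g n l) * (\<kappa> * dY n l * of_real (T / 2 ^ h n)) / 2
     + Z (g n l) * (dY n l * (\<theta> n l)\<^sup>2) / 2 + Z (g n l) * (Y (g n (Suc l)) * \<rho> n l)"
proof -
  let ?Y = "Y (g n l)" and ?t = "\<theta> n l"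
  have Y': "Y (g n (Suc l)) = ?Y + dY n l" by (simp add: dY_def)
  have e: "exp (- ?t) = 1 - ?t + ?t\<^sup>2 / 2 + \<rho> n l" by (simp add: \<rho>_def)
  have m: "(\<Sum>j\<in>UNIV. mism j n l) = (\<Sum>j\<in>UNIV. dD j n l) - dY n l * (?t - \<kappa> * of_real (T / 2 ^ h n))"
    by (simp add: mism_def \<theta>_def sum_subtractf sum_distrib_left mult_ac)
  have "Y (g n (Suc l)) * exp (- ?t) - ?Y =
    drift n l + (\<Sum>j\<in>UNIV. err j n l) + (\<Sum>j\<in>UNIV. mism j n l) / 2 - G n l * ?t / 2
    - \<kappa> * dY n l * of_real (T / 2 ^ h n) / 2 + dY n l * ?t\<^sup>2 / 2 + Y (g n (Suc l)) * \<rho> n l"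
    unfolding e Y'
    using second_order_expansion[OF dY_eq[OF assms] G_def m] by (simp add: mult_ac)
  then have "Z (g n l) * (Y (g n (Suc l)) * exp (- ?t) - ?Y) = Z (g n l) * (
    drift n l + (\<Sum>j\<in>UNIV. err j n l) + (\<Sum>j\<in>UNIV. mism j n l) / 2 - G n l * ?t / 2
    - \<kappa> * dY n l * of_real (T / 2 ^ h n) / 2 + dY n l * ?t\<^sup>2 / 2 + Y (g n (Suc l)) * \<rho> n l)" by simp
  then show ?thesis
    unfolding Z_step sum_distrib_left[symmetric] by (simp add: algebra_simps)
qed

lemma sum_step: "(\<Sum>l<N n. T / 2 ^ h n) = T"
  by (simp add: N_def)

lemma sum_step_le: "(\<Sum>l<N n. T / 2 ^ h n) \<le> T"
  by (simp add: N_def)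

text \<open>Cauchy-Schwarz over the finitely many \<open>j\<close>, which gives the factor
  \<open>CARD('l)\<close>, after splitting off the linear part by (a + b)^2 \<le> 2 a^2 + 2
  b^2.\<close>

lemma norm_\<theta>_sq: "(norm (\<theta> n l))\<^sup>2 \<le>
   2 * (norm \<kappa> * (T / 2 ^ h n))\<^sup>2 + 2 * CARD('l) * (\<Sum>j\<in>UNIV. (norm (\<nu> j) * \<bar>dw j n l\<bar>)\<^sup>2)"
proof -
  let ?S = "\<Sum>j\<in>UNIV. norm (\<nu> j) * \<bar>dw j n l\<bar>"
  have "norm (\<theta> n l) \<le> norm \<kappa> * (T / 2 ^ h n) + ?S"
  proof -
    have "norm (\<theta> n l) \<le> norm (\<kappa> * of_real (T / 2 ^ h n)) + norm (\<Sum>j\<in>UNIV. \<nu> j * complex_of_real (dw j n l))"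
      unfolding \<theta>_def by (rule norm_triangle_ineq)
    also have "norm (\<Sum>j\<in>UNIV. \<nu> j * complex_of_real (dw j n l)) \<le> (\<Sum>j\<in>UNIV. norm (\<nu> j * complex_of_real (dw j n l)))"
      by (rule norm_sum)
    also have "\<dots> = ?S" by (simp add: norm_mult)
    also have "norm (\<kappa> * of_real (T / 2 ^ h n)) = norm \<kappa> * (T / 2 ^ h n)"
      using T by (simp add: norm_mult norm_divide norm_power)
    finally show ?thesis by simp
  qed
  then have "(norm (\<theta> n l))\<^sup>2 \<le> (norm \<kappa> * (T / 2 ^ h n) + ?S)\<^sup>2" by (intro power_mono) auto
  also have "\<dots> \<le> 2 * (norm \<kappa> * (T / 2 ^ h n))\<^sup>2 + 2 * ?S\<^sup>2"
    using sum_squares_bound[of "norm \<kappa> * (T / 2 ^ h n)" ?S] by (simp add: power2_sum)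
  also have "?S\<^sup>2 \<le> (\<Sum>j\<in>UNIV. (norm (\<nu> j) * \<bar>dw j n l\<bar>)\<^sup>2) * CARD('l)"
    by (rule sum_squared_le_sum_of_squares)
  finally show ?thesis by (simp add: mult_ac)
qed

lemma sum_\<theta>_sq_bounded: "\<exists>C. \<forall>n. (\<Sum>l<N n. (norm (\<theta> n l))\<^sup>2) \<le> C"
proof -
  define C where "C = 2 * (norm \<kappa>)\<^sup>2 * T * T + 2 * CARD('l) * (\<Sum>j\<in>UNIV. (norm (\<nu> j))\<^sup>2 * K)"
  have "(\<Sum>l<N n. (norm (\<theta> n l))\<^sup>2) \<le> C" for n
  proof -
    have "(\<Sum>l<N n. (norm (\<theta> n l))\<^sup>2) \<le> (\<Sum>l<N n. 2 * (norm \<kappa> * (T / 2 ^ h n))\<^sup>2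
        + 2 * CARD('l) * (\<Sum>j\<in>UNIV. (norm (\<nu> j) * \<bar>dw j n l\<bar>)\<^sup>2))"
      by (intro sum_mono norm_\<theta>_sq)
    also have "\<dots> = (\<Sum>l<N n. 2 * (norm \<kappa> * (T / 2 ^ h n))\<^sup>2)
        + 2 * CARD('l) * (\<Sum>j\<in>UNIV. (norm (\<nu> j))\<^sup>2 * (\<Sum>l<N n. (dw j n l)\<^sup>2))"
      unfolding sum.distrib sum_distrib_left[symmetric]
      by (subst sum.swap) (simp add: power_mult_distrib sum_distrib_left)
    also have "\<dots> \<le> C"
      unfolding C_def
    proof (intro add_mono mult_left_mono sum_mono)
      have "T / 2 ^ h n \<le> T" using T by (simp add: pos_divide_le_eq mult_le_cancel_left1)
      then have "(T / 2 ^ h n)\<^sup>2 \<le> T * (T / 2 ^ h n)" using T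
        by (simp only: power2_eq_square) (intro mult_right_mono, auto)
      then have "(\<Sum>l<N n. 2 * (norm \<kappa> * (T / 2 ^ h n))\<^sup>2) \<le> (\<Sum>l<N n. 2 * (norm \<kappa>)\<^sup>2 * (T * (T / 2 ^ h n)))"
        unfolding power_mult_distrib mult.assoc by (intro sum_mono mult_left_mono) auto
      also have "\<dots> = 2 * (norm \<kappa>)\<^sup>2 * T * (\<Sum>l<N n. T / 2 ^ h n)"
        by (simp add: sum_distrib_left mult_ac)
      finally show "(\<Sum>l<N n. 2 * (norm \<kappa> * (T / 2 ^ h n))\<^sup>2) \<le> 2 * (norm \<kappa>)\<^sup>2 * T * T"
        unfolding sum_step .
      show "(\<Sum>l<N n. (dw j n l)\<^sup>2) \<le> K" for j using quadw unfolding dw_def .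
    qed auto
    finally show ?thesis .
  qed
  then show ?thesis by blast
qed

lemma small_\<theta>: "0 < e \<Longrightarrow> \<forall>\<^sub>F n in sequentially. \<forall>l<N n. norm (\<theta> n l) \<le> e"
proof -
  assume e: "0 < e"
  let ?f = "\<lambda>u. \<kappa> * of_real u + (\<Sum>j\<in>UNIV. \<nu> j * of_real (w j u))"
  have "continuous_on {0..T} ?f" using contw by (intro continuous_intros) auto
  from small_osc_step[OF this e] show ?thesis
  proof eventually_elim
    case (elim n)
    show ?case
    proof (intro allI impI)
      fix l assume l: "l < N n"
      have "\<theta> n l = ?f (g n (Suc l)) - ?f (g n l)"
        unfolding \<theta>_def g_step[of n l, symmetric] dw_def by (simp add: algebra_simps sum.distrib sum_subtractf)
      moreover have "g n l \<le> g n (Suc l)" using g_step[of n l] T by (simp add: algebra_simps)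
      ultimately show "norm (\<theta> n l) \<le> e" using elim l by (auto simp: dist_norm)
    qed
  qed
qed

lemma small_step:
  fixes f :: "real \<Rightarrow> 'b::real_normed_vector"
  assumes "continuous_on {0..T} f" "0 < e"
  shows "\<forall>\<^sub>F n in sequentially. \<forall>l<N n. norm (f (g n (Suc l)) - f (g n l)) \<le> e"
  using small_osc_step[OF assms]
proof eventually_elim
  case (elim n)
  have "g n l \<le> g n (Suc l)" for l using g_step[of n l] T by (simp add: algebra_simps)
  then show ?case using elim by (auto simp: dist_norm)
qed

lemma drift_small: "0 < e \<Longrightarrow> \<forall>\<^sub>F n in sequentially. \<forall>l<N n. norm (drift n l) \<le> e * (T / 2 ^ h n)"
proof -
  assume e: "0 < e"
  define e' where "e' = e / (norm \<kappa> + 1)"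
  have e': "0 < e'" using e unfolding e'_def by (intro divide_pos_pos add_nonneg_pos) auto
  from small_osc_step[OF contY e'] show ?thesis
  proof eventually_elim
    case (elim n)
    show ?case
    proof (intro allI impI)
      fix l assume l: "l < N n"
      have m: "g n l \<in> {0..T}" "g n (Suc l) \<in> {0..T}" using l g_mem by auto
      have le: "g n l \<le> g n (Suc l)" using g_step[of n l] T by (simp add: algebra_simps)
      have Yi: "Y integrable_on {g n l..g n (Suc l)}"
        using m contY by (intro integrable_continuous_interval) (auto intro: continuous_on_subset)
      have i: "integral {g n l..g n (Suc l)} (\<lambda>u. Y u - Y (g n l)) =
          integral {g n l..g n (Suc l)} Y - Y (g n l) * of_real (T / 2 ^ h n)"
        using le Yi g_step[of n l]
        by (subst Henstock_Kurzweil_Integration.integral_diff) (auto simp: scaleR_conv_of_real mult.commute)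
      have "norm (integral {g n l..g n (Suc l)} (\<lambda>u. Y u - Y (g n l))) \<le> e' * (g n (Suc l) - g n l)"
        using le m elim l contY
        by (intro integral_bound) (auto intro!: continuous_intros intro: continuous_on_subset simp: dist_norm)
      then have "norm (drift n l) \<le> norm \<kappa> * (e' * (T / 2 ^ h n))"
        unfolding drift_def i[symmetric] norm_mult g_step by (intro mult_left_mono) auto
      also have "\<dots> = (norm \<kappa> * e') * (T / 2 ^ h n)" by simp
      also have "\<dots> \<le> e * (T / 2 ^ h n)"
      proof (intro mult_right_mono)
        have "norm \<kappa> * e' \<le> (norm \<kappa> + 1) * e'" using e' by (intro mult_right_mono) auto
        also have "\<dots> = e" unfolding e'_def
          by (simp add: add_nonneg_eq_0_iff)
        finally show "norm \<kappa> * e' \<le> e" .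
      qed (use T in auto)
      finally show "norm (drift n l) \<le> e * (T / 2 ^ h n)" .
    qed
  qed
qed

text \<open>Each part of \<open>G\<close> is small for a different reason. The drift error is of
  smaller order than the step length; the Ito errors have a vanishing sum of squares and meet
  \<open>b\<close> through Cauchy-Schwarz; the covariation has bounded variation, so uniform
  smallness of \<open>b\<close> suffices. The factor \<open>b\<close> will be
  \<open>\<theta>\<close> or an increment of some \<open>w j\<close>.\<close>

lemma sum_G_mult_tendsto_0:
  fixes b :: "nat \<Rightarrow> nat \<Rightarrow> complex"
  assumes small: "\<And>e. 0 < e \<Longrightarrow> \<forall>\<^sub>F n in sequentially. \<forall>l<N n. norm (b n l) \<le> e"
    and bound: "\<And>n. (\<Sum>l<N n. (norm (b n l))\<^sup>2) \<le> C"
  shows "(\<lambda>n. \<Sum>l<N n. norm (G n l * b n l)) \<longlonglongrightarrow> 0"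
proof -
  have 1: "(\<lambda>n. \<Sum>l<N n. norm (drift n l * b n l)) \<longlonglongrightarrow> 0"
  proof (rule sum_small_tendsto_0[OF _ sum_step_le])
    fix e :: real assume e: "0 < e"
    show "\<forall>\<^sub>F n in sequentially. \<forall>l<N n. norm (drift n l * b n l) \<le> e * (T / 2 ^ h n)"
      using drift_small[OF e] small[OF zero_less_one]
    proof eventually_elim
      case (elim n)
      then show ?case using e T by (auto simp: norm_mult intro!: mult_mono[of _ "e * (T / 2 ^ h n)" _ 1, simplified])
    qed
  qed
  have 2: "(\<lambda>n. \<Sum>l<N n. norm (err j n l * b n l)) \<longlonglongrightarrow> 0" for j
  proof (rule tendsto_sandwich[OF _ _ tendsto_const])
    have "(\<lambda>n. \<Sum>l<N n. (norm (err j n l))\<^sup>2) \<longlonglongrightarrow> 0"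
      using ito2[of j] unfolding err_def dw_def .
    from tendsto_mult_left_zero[OF tendsto_real_sqrt[OF this, simplified], of "sqrt C"]
    show "(\<lambda>n. sqrt (\<Sum>l<N n. (norm (err j n l))\<^sup>2) * sqrt C) \<longlonglongrightarrow> 0" by simp
    show "\<forall>\<^sub>F n in sequentially. (\<Sum>l<N n. norm (err j n l * b n l)) \<le> sqrt (\<Sum>l<N n. (norm (err j n l))\<^sup>2) * sqrt C"
    proof (intro always_eventually allI)
      fix n
      have "(\<Sum>l<N n. norm (err j n l * b n l)) \<le> sqrt (\<Sum>l<N n. (norm (err j n l))\<^sup>2) * sqrt (\<Sum>l<N n. (norm (b n l))\<^sup>2)"
        using L2_set_mult_ineq[of "\<lambda>l. norm (err j n l)" "\<lambda>l. norm (b n l)" "{..<N n}"]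
        by (simp add: L2_set_def norm_mult)
      also have "\<dots> \<le> sqrt (\<Sum>l<N n. (norm (err j n l))\<^sup>2) * sqrt C"
        using bound by (intro mult_left_mono real_sqrt_le_mono) (auto intro: sum_nonneg)
      finally show "(\<Sum>l<N n. norm (err j n l * b n l)) \<le> sqrt (\<Sum>l<N n. (norm (err j n l))\<^sup>2) * sqrt C" .
    qed
  qed (auto intro!: always_eventually sum_nonneg)
  have 3: "(\<lambda>n. \<Sum>l<N n. norm (dD j n l * b n l)) \<longlonglongrightarrow> 0" for j
  proof (rule sum_small_tendsto_0)
    show "(\<Sum>l<N n. norm (dD j n l)) \<le> V" for n using varD unfolding dD_def .
    fix e :: real assume e: "0 < e"
    show "\<forall>\<^sub>F n in sequentially. \<forall>l<N n. norm (dD j n l * b n l) \<le> e * norm (dD j n l)"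
      using small[OF e] by eventually_elim (auto simp: norm_mult mult.commute intro!: mult_right_mono)
  qed
  show ?thesis
  proof (rule tendsto_sandwich[OF _ _ tendsto_const])
    show "(\<lambda>n. (\<Sum>l<N n. norm (drift n l * b n l)) + (\<Sum>j\<in>UNIV. \<Sum>l<N n. norm (err j n l * b n l))
        + (\<Sum>j\<in>UNIV. \<Sum>l<N n. norm (dD j n l * b n l)) / 2) \<longlonglongrightarrow> 0"
      by (rule tendsto_eq_rhs) (rule tendsto_add tendsto_divide tendsto_sum tendsto_const 1 2 3 | simp)+
    show "\<forall>\<^sub>F n in sequentially. (\<Sum>l<N n. norm (G n l * b n l)) \<le>
       (\<Sum>l<N n. norm (drift n l * b n l)) + (\<Sum>j\<in>UNIV. \<Sum>l<N n. norm (err j n l * b n l))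
        + (\<Sum>j\<in>UNIV. \<Sum>l<N n. norm (dD j n l * b n l)) / 2"
    proof (intro always_eventually allI)
      fix n
      have "norm (G n l * b n l) \<le> norm (drift n l * b n l) + (\<Sum>j\<in>UNIV. norm (err j n l * b n l))
        + (\<Sum>j\<in>UNIV. norm (dD j n l * b n l)) / 2" for l
      proof -
        have "norm (G n l * b n l) = norm (drift n l * b n l + (\<Sum>j\<in>UNIV. err j n l * b n l) + (\<Sum>j\<in>UNIV. dD j n l * b n l) / 2)"
          by (simp add: G_def distrib_right sum_distrib_right sum_divide_distrib)
        also have "\<dots> \<le> norm (drift n l * b n l) + norm (\<Sum>j\<in>UNIV. err j n l * b n l) + norm (\<Sum>j\<in>UNIV. dD j n l * b n l) / 2"
          using norm_triangle_ineq[of "drift n l * b n l + (\<Sum>j\<in>UNIV. err j n l * b n l)" "(\<Sum>j\<in>UNIV. dD j n l * b n l) / 2"]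
            norm_triangle_ineq[of "drift n l * b n l" "\<Sum>j\<in>UNIV. err j n l * b n l"]
          by (simp only: norm_divide norm_numeral)
        also have "\<dots> \<le> norm (drift n l * b n l) + (\<Sum>j\<in>UNIV. norm (err j n l * b n l)) + (\<Sum>j\<in>UNIV. norm (dD j n l * b n l)) / 2"
          by (rule add_mono[OF add_mono[OF order_refl norm_sum] divide_right_mono[OF norm_sum]]) simp
        finally show ?thesis .
      qed
      then have "(\<Sum>l<N n. norm (G n l * b n l)) \<le> (\<Sum>l<N n. norm (drift n l * b n l) + (\<Sum>j\<in>UNIV. norm (err j n l * b n l))
        + (\<Sum>j\<in>UNIV. norm (dD j n l * b n l)) / 2)" by (intro sum_mono)
      also have "\<dots> = (\<Sum>l<N n. norm (drift n l * b n l)) + (\<Sum>j\<in>UNIV. \<Sum>l<N n. norm (err j n l * b n l))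
        + (\<Sum>j\<in>UNIV. \<Sum>l<N n. norm (dD j n l * b n l)) / 2"
        unfolding sum.distrib sum_divide_distrib[symmetric]
        by (subst (1 2) sum.swap) simp
      finally show "(\<Sum>l<N n. norm (G n l * b n l)) \<le> (\<Sum>l<N n. norm (drift n l * b n l)) + (\<Sum>j\<in>UNIV. \<Sum>l<N n. norm (err j n l * b n l))
        + (\<Sum>j\<in>UNIV. \<Sum>l<N n. norm (dD j n l * b n l)) / 2" .
    qed
  qed (auto intro!: always_eventually sum_nonneg)
qed

text \<open>After inserting \<open>Y * \<theta> + G\<close> for \<open>dY\<close>, the first part is
  bounded by the inequality ab \<le> (a^2 + b^2) / 2 and the two bounded sums of squares. The second
  part tends to 0, hence the summand 1 in the bound and the restriction to large
  \<open>n\<close>.\<close>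

lemma sum_dY_dw_bounded: "\<exists>C. \<forall>\<^sub>F n in sequentially. (\<Sum>l<N n. norm (dY n l * of_real (dw j n l))) \<le> C"
proof -
  obtain Ct where Ct: "\<And>n. (\<Sum>l<N n. (norm (\<theta> n l))\<^sup>2) \<le> Ct" using sum_\<theta>_sq_bounded by auto
  obtain B where B: "0 < B" "\<And>u. u \<in> {0..T} \<Longrightarrow> norm (Y u) \<le> B" using bounded_on[OF contY] by auto
  let ?b = "\<lambda>n l. complex_of_real (dw j n l)"
  have arith: "a * b \<le> (a\<^sup>2 + b\<^sup>2) / 2" for a b :: real using sum_squares_bound[of a b] by simp
  have bsq: "(\<Sum>l<N n. (norm (?b n l))\<^sup>2) \<le> K" for n
    using quadw[where j = j and n = n] by (simp add: dw_def del: of_real_diff)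
  have "(\<lambda>n. \<Sum>l<N n. norm (G n l * ?b n l)) \<longlonglongrightarrow> 0"
  proof (rule sum_G_mult_tendsto_0[OF _ bsq])
    fix e :: real assume "0 < e"
    from small_step[OF contw[of j] this] show "\<forall>\<^sub>F n in sequentially. \<forall>l<N n. norm (?b n l) \<le> e"
      by (simp add: dw_def del: of_real_diff)
  qed
  then have "\<forall>\<^sub>F n in sequentially. (\<Sum>l<N n. norm (G n l * ?b n l)) < 1" by (rule order_tendstoD(2)) simp
  then have "\<forall>\<^sub>F n in sequentially. (\<Sum>l<N n. norm (dY n l * ?b n l)) \<le> B * ((Ct + K) / 2) + 1"
  proof eventually_elim
    case (elim n)
    have "norm (dY n l * ?b n l) \<le> B * (((norm (\<theta> n l))\<^sup>2 + (norm (?b n l))\<^sup>2) / 2) + norm (G n l * ?b n l)"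
      if l: "l < N n" for l
    proof -
      have "norm (dY n l * ?b n l) = norm (Y (g n l) * (\<theta> n l * ?b n l) + G n l * ?b n l)"
        by (simp only: dY_eq[OF l] distrib_right mult.assoc)
      also have "\<dots> \<le> norm (Y (g n l)) * (norm (\<theta> n l) * norm (?b n l)) + norm (G n l * ?b n l)"
        using norm_triangle_ineq[of "Y (g n l) * (\<theta> n l * ?b n l)" "G n l * ?b n l"] by (simp only: norm_mult)
      also have "norm (Y (g n l)) * (norm (\<theta> n l) * norm (?b n l)) \<le> B * (((norm (\<theta> n l))\<^sup>2 + (norm (?b n l))\<^sup>2) / 2)"
      proof (rule mult_mono)
        show "norm (Y (g n l)) \<le> B" using l by (intro B g_mem) auto
        show "norm (\<theta> n l) * norm (?b n l) \<le> ((norm (\<theta> n l))\<^sup>2 + (norm (?b n l))\<^sup>2) / 2"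
          by (rule arith)
      qed (use B in auto)
      finally show ?thesis by simp
    qed
    then have "(\<Sum>l<N n. norm (dY n l * ?b n l)) \<le>
      (\<Sum>l<N n. B * (((norm (\<theta> n l))\<^sup>2 + (norm (?b n l))\<^sup>2) / 2) + norm (G n l * ?b n l))"
      by (intro sum_mono) auto
    also have "\<dots> = B * (((\<Sum>l<N n. (norm (\<theta> n l))\<^sup>2) + (\<Sum>l<N n. (norm (?b n l))\<^sup>2)) / 2)
        + (\<Sum>l<N n. norm (G n l * ?b n l))"
      by (simp only: sum.distrib sum_distrib_left[symmetric] sum_divide_distrib[symmetric])
    also have "\<dots> \<le> B * ((Ct + K) / 2) + 1"
      using elim Ct[of n] bsq[of n] B(1) by (intro add_mono mult_left_mono divide_right_mono) auto
    finally show ?case .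
  qed
  then show ?thesis by blast
qed

text \<open>The argument known from weak convergence of measures: \<open>mism\<close> has bounded
  total variation and its sums over each fixed dyadic block tend to 0, so its sums against a
  continuous weight do. \<open>Z\<close> is frozen at the left ends of the blocks of a coarse level
  \<open>q\<close>; the error is the oscillation of \<open>Z\<close> within a block times the total
  variation.\<close>

lemma sum_Z_mism_tendsto_0: "(\<lambda>n. \<Sum>l<N n. Z (g n l) * mism j n l) \<longlonglongrightarrow> 0"
proof (rule tendstoI)
  fix e :: real assume e: "0 < e"
  obtain C1 where C1: "\<forall>\<^sub>F n in sequentially. (\<Sum>l<N n. norm (dY n l * of_real (dw j n l))) \<le> C1"
    using sum_dY_dw_bounded[of j] by auto
  define C where "C = \<bar>V\<bar> + norm (\<nu> j) * \<bar>C1\<bar> + 1"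
  have C: "0 < C" unfolding C_def by (intro add_nonneg_pos add_nonneg_nonneg) auto
  have var: "\<forall>\<^sub>F n in sequentially. (\<Sum>l<N n. norm (mism j n l)) \<le> C"
    using C1
  proof eventually_elim
    case (elim n)
    have "norm (mism j n l) \<le> norm (dD j n l) + norm (\<nu> j) * norm (dY n l * of_real (dw j n l))" for l
      unfolding mism_def using norm_triangle_ineq4[of "dD j n l" "\<nu> j * dY n l * of_real (dw j n l)"]
      by (simp add: norm_mult mult.assoc)
    then have "(\<Sum>l<N n. norm (mism j n l)) \<le> (\<Sum>l<N n. norm (dD j n l) + norm (\<nu> j) * norm (dY n l * of_real (dw j n l)))"
      by (intro sum_mono)
    also have "\<dots> = (\<Sum>l<N n. norm (dD j n l)) + norm (\<nu> j) * (\<Sum>l<N n. norm (dY n l * of_real (dw j n l)))"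
      by (simp only: sum.distrib sum_distrib_left[symmetric])
    also have "\<dots> \<le> \<bar>V\<bar> + norm (\<nu> j) * \<bar>C1\<bar>"
      using varD[where j = j and n = n] elim unfolding dD_def[symmetric] by (intro add_mono mult_left_mono) auto
    finally show ?case by (simp add: C_def)
  qed
  \<comment> \<open>Allows the freezing of \<open>Z\<close> to cost at most
    \<open>e / 2\<close>.\<close>
  define \<eta> where "\<eta> = e / (2 * C)"
  have \<eta>: "0 < \<eta>" using e C by (simp add: \<eta>_def)
  obtain \<delta> where \<delta>: "0 < \<delta>" "\<And>u v. u \<in> {0..T} \<Longrightarrow> v \<in> {0..T} \<Longrightarrow> \<bar>u - v\<bar> \<le> \<delta> \<Longrightarrow> dist (Z u) (Z v) \<le> \<eta>"
    using interval_small_osc[OF contZ \<eta>] by metis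
  obtain q where q: "T / 2 ^ q \<le> \<delta>"
  proof -
    obtain q where "(1/2) ^ q < \<delta> / T" using \<delta> T real_arch_pow_inv[of "\<delta> / T" "1/2"] by auto
    then have "T / 2 ^ q \<le> \<delta>" using T by (simp add: field_simps power_divide)
    then show ?thesis using that by blast
  qed
  \<comment> \<open>The number of cells of level \<open>h n\<close> in one block of level
    \<open>q\<close>, once \<open>q \<le> h n\<close>.\<close>
  define b where "b n = (2::nat) ^ (h n - q)" for n
  have Nb: "N n = 2 ^ q * b n" if "q \<le> h n" for n
    using that unfolding N_def b_def by (metis le_add_diff_inverse power_add)
  have gb: "g n (r * b n) = T * real r / 2 ^ q" if "q \<le> h n" for n r
  proof -
    have "(2::real) ^ h n = 2 ^ q * real (b n)"
      using Nb[OF that] unfolding N_def by (metis of_nat_mult of_nat_numeral of_nat_power)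
    moreover have "real (b n) \<noteq> 0" by (simp add: b_def)
    ultimately show ?thesis by (simp add: g_def dyadic_def)
  qed
  define S where "S n r = (\<Sum>l<r * b n. mism j n l)" for n r
  \<comment> \<open>The increments of \<open>D j\<close> telescope to a difference from
    \<open>D j 0\<close>, whereas \<open>cov\<close> yields \<open>D j\<close> itself; hence a limit
    \<open>- D j 0\<close>. It is the same for every \<open>r\<close> and drops out of the
    differences in \<open>A\<close>.\<close>
  have S: "(\<lambda>n. S n r) \<longlonglongrightarrow> - D j 0" if r: "r \<le> 2 ^ q" for r
  proof -
    have "(\<lambda>n. D j (T * real r / 2 ^ q) - D j 0 - (\<Sum>l<r * 2 ^ (h n - q). \<nu> j * (Y (g n (Suc l)) - Y (g n l))
        * of_real (w j (g n (Suc l)) - w j (g n l)))) \<longlonglongrightarrow> D j (T * real r / 2 ^ q) - D j 0 - D j (T * real r / 2 ^ q)"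
      by (intro tendsto_intros cov[OF r])
    moreover have "\<forall>\<^sub>F n in sequentially. D j (T * real r / 2 ^ q) - D j 0 - (\<Sum>l<r * 2 ^ (h n - q). \<nu> j * (Y (g n (Suc l)) - Y (g n l))
        * of_real (w j (g n (Suc l)) - w j (g n l))) = S n r"
      using h_ge[of q]
    proof eventually_elim
      case (elim n)
      have "(\<Sum>l<r * b n. dD j n l) = D j (g n (r * b n)) - D j (g n 0)"
        unfolding dD_def by (rule sum_lessThan_telescope)
      then show ?case
        unfolding S_def mism_def sum_subtractf gb[OF elim] by (simp add: b_def dY_def dw_def)
    qed
    ultimately show ?thesis by (auto intro: Lim_transform_eventually)
  qed
  \<comment> \<open>The sum with frozen weights. The number of blocks does not change with
    \<open>n\<close>, so the limit may be taken in each block.\<close>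
  define A where "A n = (\<Sum>r<2^q. Z (T * real r / 2 ^ q) * (S n (Suc r) - S n r))" for n
  have "A \<longlonglongrightarrow> (\<Sum>r<2^q. Z (T * real r / 2 ^ q) * (- D j 0 - (- D j 0)))"
    unfolding A_def by (intro tendsto_intros S) auto
  then have "A \<longlonglongrightarrow> 0" by simp
  then have A: "\<forall>\<^sub>F n in sequentially. norm (A n) < e / 2"
    using e by (auto dest!: tendstoD[where e = "e/2"])
  show "\<forall>\<^sub>F n in sequentially. dist (\<Sum>l<N n. Z (g n l) * mism j n l) 0 < e"
    using A var h_ge[of q]
  proof eventually_elim
    case (elim n)
    have SS: "S n (Suc r) - S n r = (\<Sum>l=r * b n..<r * b n + b n. mism j n l)" for r
      unfolding S_def lessThan_atLeast0 by (subst sum_diff_nat_ivl) (auto simp: add.commute)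
    have "norm ((\<Sum>l<N n. Z (g n l) * mism j n l) - A n) =
      norm ((\<Sum>r<2^q. (\<Sum>l=r * b n..<r * b n + b n. Z (g n l) * mism j n l)) - A n)"
      unfolding Nb[OF elim(3)] by (simp add: sum.nat_group)
    also have "\<dots> = norm (\<Sum>r<2^q. \<Sum>l=r * b n..<r * b n + b n. (Z (g n l) - Z (T * real r / 2 ^ q)) * mism j n l)"
      unfolding A_def SS by (simp add: sum_subtractf sum_distrib_left left_diff_distrib)
    also have "\<dots> \<le> (\<Sum>r<2^q. \<Sum>l=r * b n..<r * b n + b n. \<eta> * norm (mism j n l))"
    proof (intro sum_norm_le)
      fix r l assume r: "r \<in> {..<2^q}" and l: "l \<in> {r * b n..<r * b n + b n}"
      have "r * b n + b n \<le> N n"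
        using r mult_le_mono1[of "Suc r" "2^q" "b n"] unfolding Nb[OF elim(3)] by simp
      then have m: "g n l \<in> {0..T}" "g n (r * b n) \<in> {0..T}" using l g_mem[of l n] g_mem[of "r * b n" n] by auto
      have "\<bar>g n l - g n (r * b n)\<bar> = T * (real l - real (r * b n)) / 2 ^ h n"
        using l T by (simp add: g_def dyadic_def diff_divide_distrib[symmetric] right_diff_distrib[symmetric] abs_mult del: of_nat_mult)
      also have "\<dots> \<le> T * real (b n) / 2 ^ h n"
        using l T by (intro divide_right_mono mult_left_mono) (auto simp del: of_nat_mult)
      also have "\<dots> = T / 2 ^ q" using gb[OF elim(3), of 1] by (simp add: g_def dyadic_def)
      finally have "dist (Z (g n l)) (Z (g n (r * b n))) \<le> \<eta>" using q m by (intro \<delta>) auto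
      then show "norm ((Z (g n l) - Z (T * real r / 2 ^ q)) * mism j n l) \<le> \<eta> * norm (mism j n l)"
        unfolding gb[OF elim(3)] by (simp add: norm_mult dist_norm mult_right_mono)
    qed
    also have "\<dots> = \<eta> * (\<Sum>l<N n. norm (mism j n l))"
      unfolding Nb[OF elim(3)] sum.nat_group by (rule sum_distrib_left[symmetric])
    also have "\<dots> \<le> \<eta> * C" using elim \<eta> by (intro mult_left_mono) auto
    also have "\<dots> = e / 2" using C by (simp add: \<eta>_def)
    finally have "norm ((\<Sum>l<N n. Z (g n l) * mism j n l) - A n) \<le> e / 2" .
    then show ?case using elim(1) norm_triangle_ineq2[of "\<Sum>l<N n. Z (g n l) * mism j n l" "A n"] by simp
  qed
qed

text \<open>The telescoped sum is the same on every level, yet all of its seven parts tend to 0, so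
  it is 0. The weighted Ito errors and the mismatch of the covariations vanish only by cancellation;
  the other five sums vanish in absolute value.\<close>

theorem solution_formula: "Z T * Y T = Y 0"
proof -
  obtain Ct where Ct: "\<And>n. (\<Sum>l<N n. (norm (\<theta> n l))\<^sup>2) \<le> Ct" using sum_\<theta>_sq_bounded by auto
  obtain BY where BY: "0 < BY" "\<And>u. u \<in> {0..T} \<Longrightarrow> norm (Y u) \<le> BY" using bounded_on[OF contY] by auto
  obtain BZ where BZ: "0 < BZ" "\<And>u. u \<in> {0..T} \<Longrightarrow> norm (Z u) \<le> BZ" using bounded_on[OF contZ] by auto
  have weight: "(\<lambda>n. \<Sum>l<N n. Z (g n l) * x n l) \<longlonglongrightarrow> 0"
    if "(\<lambda>n. \<Sum>l<N n. norm (x n l)) \<longlonglongrightarrow> 0" for x :: "nat \<Rightarrow> nat \<Rightarrow> complex"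
    by (rule sum_norm_tendsto_0, rule sum_bounded_factor_tendsto_0[OF that, where B = BZ])
      (auto intro!: BZ g_mem)
  have 1: "(\<lambda>n. \<Sum>l<N n. Z (g n l) * drift n l) \<longlonglongrightarrow> 0"
    by (rule weight[OF sum_small_tendsto_0[OF drift_small sum_step_le]])
  have 2: "(\<lambda>n. \<Sum>l<N n. Z (g n l) * err j n l) \<longlonglongrightarrow> 0" for j
    using ito[of j] unfolding err_def dw_def .
  have 4: "(\<lambda>n. \<Sum>l<N n. Z (g n l) * (G n l * \<theta> n l)) \<longlonglongrightarrow> 0"
    by (rule weight[OF sum_G_mult_tendsto_0[OF small_\<theta> Ct]])
  have dY: "\<forall>\<^sub>F n in sequentially. \<forall>l<N n. norm (dY n l) \<le> e" if "0 < e" for e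
    using small_step[OF contY that] by (simp add: dY_def)
  have 5: "(\<lambda>n. \<Sum>l<N n. Z (g n l) * (\<kappa> * dY n l * of_real (T / 2 ^ h n))) \<longlonglongrightarrow> 0"
  proof -
    have "(\<lambda>n. \<Sum>l<N n. Z (g n l) * (dY n l * of_real (T / 2 ^ h n))) \<longlonglongrightarrow> 0"
    proof (rule weight[OF sum_small_tendsto_0[OF _ sum_step_le]])
      fix e :: real assume e: "0 < e"
      show "\<forall>\<^sub>F n in sequentially. \<forall>l<N n. norm (dY n l * of_real (T / 2 ^ h n)) \<le> e * (T / 2 ^ h n)"
        using dY[OF e]
      proof eventually_elim
        case (elim n)
        have "norm (complex_of_real (T / 2 ^ h n)) = T / 2 ^ h n" using T by (simp add: norm_divide norm_power)
        moreover have "0 \<le> T / 2 ^ h n" using T by simp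
        ultimately show ?case using elim by (simp only: norm_mult) (blast intro: mult_right_mono)
      qed
    qed
    from tendsto_mult_right_zero[OF this, of \<kappa>] show ?thesis by (simp add: sum_distrib_left mult_ac)
  qed
  have 6: "(\<lambda>n. \<Sum>l<N n. Z (g n l) * (dY n l * (\<theta> n l)\<^sup>2)) \<longlonglongrightarrow> 0"
  proof (rule weight[OF sum_small_tendsto_0[OF _ Ct]])
    fix e :: real assume e: "0 < e"
    show "\<forall>\<^sub>F n in sequentially. \<forall>l<N n. norm (dY n l * (\<theta> n l)\<^sup>2) \<le> e * (norm (\<theta> n l))\<^sup>2"
      using dY[OF e] by eventually_elim (auto simp: norm_mult norm_power intro!: mult_right_mono)
  qed
  have "(\<lambda>n. \<Sum>l<N n. norm (\<rho> n l)) \<longlonglongrightarrow> 0"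
  proof (rule sum_small_tendsto_0[OF _ Ct])
    fix e :: real assume e: "0 < e"
    then have m: "0 < min 1 (e / 3)" by simp
    show "\<forall>\<^sub>F n in sequentially. \<forall>l<N n. norm (\<rho> n l) \<le> e * (norm (\<theta> n l))\<^sup>2"
      using small_\<theta>[OF m]
    proof eventually_elim
      case (elim n)
      show ?case
      proof (intro allI impI)
        fix l assume "l < N n"
        then have t: "norm (\<theta> n l) \<le> 1" "norm (\<theta> n l) \<le> e / 3" using elim by auto
        have "norm (\<rho> n l) \<le> 3 * norm (\<theta> n l) * (norm (\<theta> n l))\<^sup>2"
          unfolding \<rho>_def using exp_second_order_bound[OF t(1)] by (simp add: power3_eq_cube power2_eq_square mult.assoc)
        also have "\<dots> \<le> e * (norm (\<theta> n l))\<^sup>2" using t(2) by (intro mult_right_mono) auto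
        finally show "norm (\<rho> n l) \<le> e * (norm (\<theta> n l))\<^sup>2" .
      qed
    qed
  qed
  then have 7: "(\<lambda>n. \<Sum>l<N n. Z (g n l) * (Y (g n (Suc l)) * \<rho> n l)) \<longlonglongrightarrow> 0"
    by (rule weight[OF sum_bounded_factor_tendsto_0[where B = BY]]) (auto intro!: BY g_mem)
  have eq: "Z T * Y T - Y 0 = (\<Sum>l<N n. Z (g n l) * drift n l) + (\<Sum>j\<in>UNIV. \<Sum>l<N n. Z (g n l) * err j n l)
     + (\<Sum>j\<in>UNIV. \<Sum>l<N n. Z (g n l) * mism j n l) / 2
     - (\<Sum>l<N n. Z (g n l) * (G n l * \<theta> n l)) / 2 - (\<Sum>l<N n. Z (g n l) * (\<kappa> * dY n l * of_real (T / 2 ^ h n))) / 2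
     + (\<Sum>l<N n. Z (g n l) * (dY n l * (\<theta> n l)\<^sup>2)) / 2 + (\<Sum>l<N n. Z (g n l) * (Y (g n (Suc l)) * \<rho> n l))" (is "_ = ?R n") for n
  proof -
    have "Z T * Y T - Y 0 = Z (g n (N n)) * Y (g n (N n)) - Z (g n 0) * Y (g n 0)"
      by simp (simp add: Z_def)
    also have "\<dots> = (\<Sum>l<N n. Z (g n (Suc l)) * Y (g n (Suc l)) - Z (g n l) * Y (g n l))"
      by (rule sum_lessThan_telescope[symmetric])
    also have "\<dots> = (\<Sum>l<N n. Z (g n l) * drift n l + (\<Sum>j\<in>UNIV. Z (g n l) * err j n l) + (\<Sum>j\<in>UNIV. Z (g n l) * mism j n l) / 2
     - Z (g n l) * (G n l * \<theta> n l) / 2 - Z (g n l) * (\<kappa> * dY n l * of_real (T / 2 ^ h n)) / 2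
     + Z (g n l) * (dY n l * (\<theta> n l)\<^sup>2) / 2 + Z (g n l) * (Y (g n (Suc l)) * \<rho> n l))"
      by (intro sum.cong refl product_step) auto
    finally show ?thesis
      unfolding sum.distrib sum_subtractf sum_divide_distrib[symmetric]
        sum.swap[of "\<lambda>l j. Z (g n l) * err j n l"] sum.swap[of "\<lambda>l j. Z (g n l) * mism j n l"] .
  qed
  have "?R \<longlonglongrightarrow> 0 + (\<Sum>j\<in>(UNIV::'l set). 0) + (\<Sum>j\<in>(UNIV::'l set). 0) / 2 - 0 / 2 - 0 / 2 + 0 / 2 + 0"
    by (intro tendsto_add tendsto_diff tendsto_divide tendsto_sum tendsto_const 1 2 4 5 6 7 sum_Z_mism_tendsto_0) auto
  then have "(\<lambda>n. Z T * Y T - Y 0) \<longlonglongrightarrow> 0" unfolding eq[symmetric] by simp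
  then show ?thesis by (simp add: LIMSEQ_const_iff)
qed

end

section \<open>Exponential supermartingales\<close>

text \<open>Induction on a stronger claim that also counts the mass of \<open>f n\<close> on the
  paths that have not exceeded \<open>K\<close> so far. Passing to the next time does not increase
  this mass, and the paths that now exceed \<open>K\<close> pay for their own probability. With
  values in the extended nonnegative reals no integrability has to be tracked.\<close>

lemma (in prob_space) supermartingale_maximal_inequality:
  fixes f :: "nat \<Rightarrow> 'a \<Rightarrow> ennreal" and G :: "nat \<Rightarrow> 'a measure" and K :: ennreal
  assumes sub: "\<And>i. subalgebra M (G i)" and mono: "\<And>i j. i \<le> j \<Longrightarrow> sets (G i) \<subseteq> sets (G j)"
    and f: "\<And>i. f i \<in> borel_measurable (G i)"
    and super: "\<And>i A. A \<in> sets (G i) \<Longrightarrow> (\<integral>\<^sup>+\<omega>\<in>A. f (Suc i) \<omega> \<partial>M) \<le> (\<integral>\<^sup>+\<omega>\<in>A. f i \<omega> \<partial>M)"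
  shows "K * emeasure M {\<omega> \<in> space M. \<exists>i\<le>n. K < f i \<omega>} \<le> (\<integral>\<^sup>+\<omega>. f 0 \<omega> \<partial>M)"
proof -
  \<comment> \<open>The strict bound \<open>i < n\<close> makes \<open>B (Suc n)\<close> the
    complement of \<open>E n\<close>, and an event of \<open>G n\<close>.\<close>
  define B where "B n = {\<omega> \<in> space M. \<forall>i<n. f i \<omega> \<le> K}" for n
  define E where "E n = {\<omega> \<in> space M. \<exists>i\<le>n. K < f i \<omega>}" for n
  have spG: "space (G i) = space M" for i using sub[of i] by (simp add: subalgebra_def)
  have fG: "f i \<in> borel_measurable (G j)" if "i \<le> j" for i j
    using f[of i] mono[OF that] by (intro measurable_from_subalg[of "G j" "G i"]) (auto simp: subalgebra_def spG)
  have [measurable]: "f i \<in> borel_measurable M" for i using measurable_from_subalg[OF sub f] .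
  have BG: "B (Suc n) \<in> sets (G n)" for n
  proof -
    have "f i -` {..K} \<inter> space (G n) \<in> sets (G n)" if "i < Suc n" for i
      using that by (intro measurable_sets[OF fG]) auto
    then have "(\<Inter>i<Suc n. f i -` {..K} \<inter> space (G n)) \<in> sets (G n)" by (intro sets.finite_INT) auto
    also have "(\<Inter>i<Suc n. f i -` {..K} \<inter> space (G n)) = B (Suc n)" by (auto simp: B_def spG)
    finally show ?thesis .
  qed
  have [measurable]: "B n \<in> sets M" "E n \<in> sets M" for n unfolding B_def E_def by measurable
  have "K * emeasure M (E n) + (\<integral>\<^sup>+\<omega>\<in>B (Suc n). f n \<omega> \<partial>M) \<le> (\<integral>\<^sup>+\<omega>. f 0 \<omega> \<partial>M)"
  proof (induction n)
    case 0
    have "K * emeasure M (E 0) + (\<integral>\<^sup>+\<omega>\<in>B (Suc 0). f 0 \<omega> \<partial>M) =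
      (\<integral>\<^sup>+\<omega>. K * indicator (E 0) \<omega> + f 0 \<omega> * indicator (B (Suc 0)) \<omega> \<partial>M)"
      by (subst nn_integral_add) (auto simp: nn_integral_cmult_indicator)
    also have "\<dots> \<le> (\<integral>\<^sup>+\<omega>. f 0 \<omega> \<partial>M)"
      by (intro nn_integral_mono) (auto simp: E_def B_def split: split_indicator)
    finally show ?case .
  next
    case (Suc n)
    \<comment> \<open>First exceedance exactly at time \<open>Suc n\<close>, so that
      \<open>E (Suc n)\<close> is a disjoint union.\<close>
    define A where "A = {\<omega> \<in> B (Suc n). K < f (Suc n) \<omega>}"
    have [measurable]: "A \<in> sets M" unfolding A_def by measurable
    have EA: "E (Suc n) = E n \<union> A" "E n \<inter> A = {}"
      by (auto simp: E_def A_def B_def le_Suc_eq less_Suc_eq_le not_le not_less)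
    have "K * emeasure M (E (Suc n)) + (\<integral>\<^sup>+\<omega>\<in>B (Suc (Suc n)). f (Suc n) \<omega> \<partial>M) =
      K * emeasure M (E n) + (K * emeasure M A + (\<integral>\<^sup>+\<omega>\<in>B (Suc (Suc n)). f (Suc n) \<omega> \<partial>M))"
      unfolding EA(1) using EA(2) by (subst plus_emeasure[symmetric]) (auto simp: distrib_left add.assoc)
    also have "\<dots> \<le> K * emeasure M (E n) + (\<integral>\<^sup>+\<omega>\<in>B (Suc n). f n \<omega> \<partial>M)"
    proof (rule add_left_mono)
      have "K * emeasure M A + (\<integral>\<^sup>+\<omega>\<in>B (Suc (Suc n)). f (Suc n) \<omega> \<partial>M) =
      (\<integral>\<^sup>+\<omega>. K * indicator A \<omega> + f (Suc n) \<omega> * indicator (B (Suc (Suc n))) \<omega> \<partial>M)"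
      by (subst nn_integral_add) (auto simp: nn_integral_cmult_indicator)
    also have "\<dots> \<le> (\<integral>\<^sup>+\<omega>\<in>B (Suc n). f (Suc n) \<omega> \<partial>M)"
      by (intro nn_integral_mono) (auto simp: A_def B_def less_Suc_eq split: split_indicator)
    also have "\<dots> \<le> (\<integral>\<^sup>+\<omega>\<in>B (Suc n). f n \<omega> \<partial>M)" by (rule super[OF BG])
    finally show "K * emeasure M A + (\<integral>\<^sup>+\<omega>\<in>B (Suc (Suc n)). f (Suc n) \<omega> \<partial>M) \<le> (\<integral>\<^sup>+\<omega>\<in>B (Suc n). f n \<omega> \<partial>M)" .
    qed
    also note Suc.IH
    finally show ?case .
  qed
  then have "K * emeasure M (E n) \<le> (\<integral>\<^sup>+\<omega>. f 0 \<omega> \<partial>M)" by (rule order_trans[rotated]) simp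
  then show ?thesis unfolding E_def .
qed

text \<open>Completing the square turns the exponentially tilted density into a constant times a
  shifted normal density, which integrates to 1.\<close>

lemma normal_density_exp_moment:
  assumes "0 < \<sigma>"
  shows "(\<integral>\<^sup>+x. ennreal (normal_density 0 \<sigma> x) * ennreal (exp (c * x)) \<partial>lborel) = ennreal (exp (c\<^sup>2 * \<sigma>\<^sup>2 / 2))"
proof -
  have *: "normal_density 0 \<sigma> x * exp (c * x) = exp (c\<^sup>2 * \<sigma>\<^sup>2 / 2) * normal_density (c * \<sigma>\<^sup>2) \<sigma> x" for x
  proof -
    have "- (x - 0)\<^sup>2 / (2 * \<sigma>\<^sup>2) + c * x = c\<^sup>2 * \<sigma>\<^sup>2 / 2 + - (x - c * \<sigma>\<^sup>2)\<^sup>2 / (2 * \<sigma>\<^sup>2)"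
      using assms by (simp add: field_simps power2_eq_square)
    then have "exp (- (x - 0)\<^sup>2 / (2 * \<sigma>\<^sup>2)) * exp (c * x) = exp (c\<^sup>2 * \<sigma>\<^sup>2 / 2) * exp (- (x - c * \<sigma>\<^sup>2)\<^sup>2 / (2 * \<sigma>\<^sup>2))"
      by (simp only: exp_add[symmetric])
    then show ?thesis unfolding normal_density_def by (simp add: mult_ac)
  qed
  have "(\<integral>\<^sup>+x. ennreal (normal_density 0 \<sigma> x) * ennreal (exp (c * x)) \<partial>lborel) =
     (\<integral>\<^sup>+x. ennreal (exp (c\<^sup>2 * \<sigma>\<^sup>2 / 2)) * ennreal (normal_density (c * \<sigma>\<^sup>2) \<sigma> x) \<partial>lborel)"
    using * by (intro nn_integral_cong) (simp add: ennreal_mult[symmetric])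
  also have "\<dots> = ennreal (exp (c\<^sup>2 * \<sigma>\<^sup>2 / 2)) * (\<integral>\<^sup>+x. ennreal (normal_density (c * \<sigma>\<^sup>2) \<sigma> x) \<partial>lborel)"
    by (rule nn_integral_cmult) simp
  also have "(\<integral>\<^sup>+x. ennreal (normal_density (c * \<sigma>\<^sup>2) \<sigma> x) \<partial>lborel) = 1"
    using assms by (subst nn_integral_eq_integral) auto
  finally show ?thesis by simp
qed

lemma (in filtered_brownian_motion) increment_exp_moment:
  assumes "0 \<le> s" "s < t"
  shows "(\<integral>\<^sup>+\<omega>. ennreal (exp (c * (W t \<omega> - W s \<omega>))) \<partial>M) = ennreal (exp (c\<^sup>2 / 2 * (t - s)))"
  using distributed_nn_integral[OF increment_distributed[OF assms], of "\<lambda>x. ennreal (exp (c * x))"]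
    normal_density_exp_moment[of "sqrt (t - s)" c] assms by simp

section \<open>Joint independence of past and increments of several Brownian motions\<close>

locale independent_brownian_motions = prob_space M for M :: "'a measure" +
  fixes F :: "real \<Rightarrow> 'a measure" and W :: "'l::finite \<Rightarrow> real \<Rightarrow> 'a \<Rightarrow> real"
  assumes usual: "usual_conditions M F" and bm: "\<And>j. brownian_motion M F (W j)"
    and indep: "independent_processes M W"
begin

lemma bm_locale: "filtered_brownian_motion M F (W j)"
  using usual bm by unfold_locales

definition path :: "'l \<Rightarrow> 'a \<Rightarrow> real \<Rightarrow> real" where
  "path j \<omega> = restrict (\<lambda>t. W j t \<omega>) {0..}"

definition path_events :: "'l \<Rightarrow> 'a set set" where
  "path_events j = {path j -` A \<inter> space M | A. A \<in> sets (PiM {0..} (\<lambda>_. borel))}"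

text \<open>Only the events of \<open>F s\<close> that depend on \<open>W j\<close> alone are kept: \<open>F s\<close> is assumed to be
  independent of the increment of each Brownian motion separately, not of all of them jointly.\<close>

definition past :: "real \<Rightarrow> 'l \<Rightarrow> 'a set set" where
  "past s j = sets (F s) \<inter> path_events j"

definition increment_events :: "real \<Rightarrow> real \<Rightarrow> 'l \<Rightarrow> 'a set set" where
  "increment_events s t j = {(\<lambda>\<omega>. W j t \<omega> - W j s \<omega>) -` A \<inter> space M | A. A \<in> sets borel}"

text \<open>The filtration of the supermartingale: small enough for independence of all increments
  jointly to be derivable, yet large enough for every \<open>W j\<close> to be adapted.\<close>

definition joint_past :: "real \<Rightarrow> 'a measure" where
  "joint_past s = sigma (space M) (\<Union>j. past s j)"

lemma path_measurable: "path j \<in> measurable M (PiM {0..} (\<lambda>_. borel))"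
  using indep unfolding independent_processes_def indep_vars_def2 path_def[abs_def] by blast

lemma path_events_subset: "path_events j \<subseteq> events"
  using measurable_sets[OF path_measurable] by (auto simp: path_events_def)

lemma path_events_Int: "A \<in> path_events j \<Longrightarrow> B \<in> path_events j \<Longrightarrow> A \<inter> B \<in> path_events j"
proof -
  assume "A \<in> path_events j" "B \<in> path_events j"
  then obtain A' B' where "A' \<in> sets (PiM {0..} (\<lambda>_. borel))" "A = path j -` A' \<inter> space M"
    "B' \<in> sets (PiM {0..} (\<lambda>_. borel))" "B = path j -` B' \<inter> space M" unfolding path_events_def by blast
  then show ?thesis unfolding path_events_def
    by (intro CollectI exI[of _ "A' \<inter> B'"]) auto
qed

lemma path_eventsI:
  assumes f: "f \<in> borel_measurable (PiM {0..} (\<lambda>_. borel :: real measure))" and A: "A \<in> sets (borel :: real measure)"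
    and eq: "\<And>\<omega>. \<omega> \<in> space M \<Longrightarrow> g \<omega> = f (path j \<omega>)"
  shows "g -` A \<inter> space M \<in> path_events j"
  unfolding path_events_def
proof (intro CollectI exI conjI)
  show "f -` A \<inter> space (PiM {0..} (\<lambda>_. borel :: real measure)) \<in> sets (PiM {0..} (\<lambda>_. borel))" using f A by (rule measurable_sets)
  show "g -` A \<inter> space M = path j -` (f -` A \<inter> space (PiM {0..} (\<lambda>_. borel :: real measure))) \<inter> space M"
    using eq measurable_space[OF path_measurable, of _ j] by auto
qed

lemma increment_events_path: "0 \<le> s \<Longrightarrow> 0 \<le> t \<Longrightarrow> increment_events s t j \<subseteq> path_events j"
proof
  fix E assume st: "0 \<le> s" "0 \<le> t" and "E \<in> increment_events s t j"
  then obtain A where A: "A \<in> sets borel" "E = (\<lambda>\<omega>. W j t \<omega> - W j s \<omega>) -` A \<inter> space M" by (auto simp: increment_events_def)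
  have "(\<lambda>\<omega>. W j t \<omega> - W j s \<omega>) -` A \<inter> space M \<in> path_events j"
  proof (rule path_eventsI[OF _ A(1)])
    show "(\<lambda>f. f t - f s) \<in> borel_measurable (PiM {0..} (\<lambda>_. borel :: real measure))"
      using st by (intro borel_measurable_diff measurable_component_singleton) auto
    show "W j t \<omega> - W j s \<omega> = path j \<omega> t - path j \<omega> s" for \<omega> using st by (simp add: path_def)
  qed
  with A show "E \<in> path_events j" by simp
qed

lemma space_F: "space (F t) = space M"
  by (rule filtered_brownian_motion.space_F[OF bm_locale])

lemma W_past:
  assumes "0 \<le> u" "u \<le> s" "A \<in> sets borel"
  shows "W j u -` A \<inter> space M \<in> past s j"
proof -
  interpret filtered_brownian_motion M F "W j" by (rule bm_locale)
  have "W j u \<in> borel_measurable (F s)" using W_adapted[OF assms(1)] assms(2) by (rule F_measurable_mono)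
  then have "W j u -` A \<inter> space M \<in> sets (F s)" using measurable_sets[of "W j u" "F s" borel A] assms(3) by (simp add: space_F)
  moreover have "W j u -` A \<inter> space M \<in> path_events j"
    using assms by (intro path_eventsI[where f = "\<lambda>f. f u"] measurable_component_singleton) (auto simp: path_def)
  ultimately show ?thesis by (simp add: past_def)
qed

lemma past_subset: "past s j \<subseteq> Pow (space M)"
  by (auto simp: past_def path_events_def)

lemma sets_joint_past: "sets (joint_past s) = sigma_sets (space M) (\<Union>j. past s j)"
  unfolding joint_past_def using past_subset by (intro sets_measure_of) auto

lemma space_joint_past [simp]: "space (joint_past s) = space M"
  unfolding joint_past_def using past_subset by (intro space_measure_of) auto

lemma past_events: "past s j \<subseteq> events"
  using path_events_subset by (auto simp: past_def)

lemma subalgebra_joint_past: "subalgebra M (joint_past s)"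
  unfolding subalgebra_def sets_joint_past
proof
  show "sigma_sets (space M) (\<Union>j. past s j) \<subseteq> events"
    using past_events by (intro sets.sigma_sets_subset UN_least)
qed simp

lemma joint_past_mono: "s \<le> t \<Longrightarrow> sets (joint_past s) \<subseteq> sets (joint_past t)"
proof -
  assume "s \<le> t"
  then have "sets (F s) \<subseteq> sets (F t)"
    using usual filtration.sets_F_mono[of "space M" F s t] by (auto simp: usual_conditions_def)
  then have "(\<Union>j. past s j) \<subseteq> (\<Union>j. past t j)" by (auto simp: past_def)
  then show ?thesis unfolding sets_joint_past by (rule sigma_sets_mono')
qed

lemma W_joint_past: "0 \<le> u \<Longrightarrow> u \<le> s \<Longrightarrow> W j u \<in> borel_measurable (joint_past s)"
  using W_past[of u s _ j] by (intro measurableI) (auto simp: sets_joint_past intro!: sigma_sets.Basic)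

text \<open>Past and increment events of \<open>W j\<close> are both path events, so events with
  different \<open>j\<close> are independent because the whole paths are. For one and the same
  \<open>j\<close>, past and increment are independent by the definition of Brownian motion.
  Combining the two product formulas yields independence of the family over all pairs, which can
  afterwards be regrouped freely.\<close>

lemma indep_past_increment:
  assumes "0 \<le> s" "s < t"
  shows "indep_sets (\<lambda>(j, b). if b then past s j else increment_events s t j) UNIV"
proof -
  let ?E = "\<lambda>(j, b). if b then past s j else increment_events s t j"
  have t0: "0 \<le> t" using assms by simp
  have inc: "increment_events s t j \<subseteq> path_events j" for j using increment_events_path assms(1) t0 .
  have PE: "past s j \<subseteq> path_events j" for j by (auto simp: past_def)
  have sp: "space M \<in> path_events j" for j
    using sets.top[of "PiM {0..} (\<lambda>_. borel :: real measure)"] measurable_space[OF path_measurable, of _ j]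
    unfolding path_events_def by (intro CollectI exI[of _ "space (PiM {0..} (\<lambda>_. borel :: real measure))"]) auto
  have spE: "space M \<in> ?E p" for p
  proof -
    have "space M \<in> past s j" for j using sp[of j] sets.top[of "F s"] by (simp add: past_def space_F)
    moreover have "space M \<in> increment_events s t j" for j
      unfolding increment_events_def by (intro CollectI exI[of _ UNIV]) auto
    ultimately show ?thesis by (auto split: prod.split)
  qed
  have ind_path: "indep_sets path_events UNIV"
    using indep unfolding independent_processes_def indep_vars_def2 path_events_def path_def[abs_def] by blast
  show ?thesis
  \<comment> \<open>As the whole space belongs to every member of this finite family, the product
    formula over the full index set is enough.\<close>
  proof (subst indep_sets_finite)
    show "UNIV \<noteq> ({} :: ('l \<times> bool) set)" "finite (UNIV :: ('l \<times> bool) set)" by auto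
    show "?E p \<subseteq> events" for p
      using order_trans[OF PE path_events_subset] order_trans[OF inc path_events_subset] by (cases p) simp
    show "space M \<in> ?E p" for p by (rule spE)
    show "\<forall>A\<in>Pi UNIV ?E. prob (\<Inter>j\<in>UNIV. A j) = (\<Prod>j\<in>UNIV. prob (A j))"
    proof
      fix A assume "A \<in> Pi UNIV ?E"
      then have A: "A p \<in> ?E p" for p by (rule Pi_mem) simp
      have AT: "A (j, True) \<in> past s j" for j using A[of "(j, True)"] by simp
      have AF: "A (j, False) \<in> increment_events s t j" for j using A[of "(j, False)"] by simp
      have "(\<Inter>p\<in>UNIV. A p) = (\<Inter>j\<in>UNIV. A (j, True) \<inter> A (j, False))"
      proof safe
        fix \<omega> j b assume "\<omega> \<in> (\<Inter>j\<in>UNIV. A (j, True) \<inter> A (j, False))"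
        then show "\<omega> \<in> A (j, b)" by (cases b) auto
      qed auto
      moreover have "A (j, True) \<inter> A (j, False) \<in> path_events j" for j
        using AT[of j] AF[of j] PE inc by (intro path_events_Int) auto
      then have "prob (\<Inter>j\<in>UNIV. A (j, True) \<inter> A (j, False)) = (\<Prod>j\<in>UNIV. prob (A (j, True) \<inter> A (j, False)))"
        by (intro indep_setsD[OF ind_path]) auto
      moreover have "prob (A (j, True) \<inter> A (j, False)) = prob (A (j, True)) * prob (A (j, False))" for j
      proof -
        have "indep_set (sets (F s)) (increment_events s t j)"
          using bm[of j] assms unfolding brownian_motion_def increment_events_def by blast
        then show ?thesis using AT[of j] AF[of j] by (intro indep_setD) (auto simp: past_def)
      qed
      moreover have "(\<Prod>j\<in>UNIV. prob (A (j, True)) * prob (A (j, False))) = (\<Prod>p\<in>UNIV. prob (A p))"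
      proof -
        have "(\<Prod>j\<in>UNIV. prob (A (j, True)) * prob (A (j, False))) = (\<Prod>j\<in>UNIV. \<Prod>b\<in>UNIV. prob (A (j, b)))"
          by (simp add: UNIV_bool mult.commute)
        then show ?thesis by (simp add: prod.cartesian_product UNIV_Times_UNIV[symmetric] del: UNIV_Times_UNIV)
      qed
      ultimately show "prob (\<Inter>j\<in>UNIV. A j) = (\<Prod>j\<in>UNIV. prob (A j))" by simp
    qed
  qed
qed

text \<open>Regrouping by an option type: \<open>None\<close> collects the pasts of all the Brownian
  motions into \<open>joint_past s\<close>, and \<open>Some j\<close> keeps the increment of
  \<open>W j\<close> alone. Then \<open>Y\<close> and the exponentials of the single increments are
  independent, so the expectation factorizes.\<close>

lemma joint_increment_exp_moment:
  fixes Y :: "'a \<Rightarrow> ennreal" and c :: "'l \<Rightarrow> real"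
  assumes st: "0 \<le> s" "s < t" and Y: "Y \<in> borel_measurable (joint_past s)"
  shows "(\<integral>\<^sup>+\<omega>. Y \<omega> * ennreal (exp (\<Sum>j\<in>UNIV. c j * (W j t \<omega> - W j s \<omega>))) \<partial>M) =
    (\<integral>\<^sup>+\<omega>. Y \<omega> \<partial>M) * ennreal (exp ((\<Sum>j\<in>UNIV. (c j)\<^sup>2) / 2 * (t - s)))"
proof -
  define I :: "'l option \<Rightarrow> ('l \<times> bool) set" where
    "I o' = (case o' of None \<Rightarrow> range (\<lambda>j. (j, True)) | Some j \<Rightarrow> {(j, False)})" for o'
  define X :: "'l option \<Rightarrow> 'a \<Rightarrow> ennreal" where
    "X o' \<omega> = (case o' of None \<Rightarrow> Y \<omega> | Some j \<Rightarrow> ennreal (exp (c j * (W j t \<omega> - W j s \<omega>))))" for o' \<omega>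
  let ?E = "\<lambda>(j, b). if b then past s j else increment_events s t j"
  have t0: "0 \<le> t" using st by simp
  have Ystab: "Int_stable (past s j)" for j
    unfolding Int_stable_def past_def using path_events_Int by auto
  have Dstab: "Int_stable (increment_events s t j)" for j
    unfolding Int_stable_def increment_events_def
    by (clarsimp, rename_tac A B) (rule_tac x = "A \<inter> B" in exI, auto)
  have W [measurable]: "W j u \<in> borel_measurable M" if "0 \<le> u" for j u
    by (rule filtered_brownian_motion.W_measurable[OF bm_locale that])
  have collected: "indep_sets (\<lambda>o'. sigma_sets (space M) (\<Union>p\<in>I o'. ?E p)) UNIV"
  proof (rule indep_sets_collect_sigma)
    have "(\<Union>o'\<in>UNIV. I o') = UNIV"
    proof safe
      fix j b show "(j, b) \<in> (\<Union>o'\<in>UNIV. I o')"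
        by (rule UN_I[of "if b then None else Some j"]) (auto simp: I_def)
    qed auto
    then show "indep_sets ?E (\<Union>o'\<in>UNIV. I o')" using indep_past_increment[OF st] by simp
    show "Int_stable (?E p)" for p using Ystab Dstab by (auto split: prod.split)
    show "disjoint_family_on I UNIV" by (auto simp: disjoint_family_on_def I_def split: option.splits)
  qed
  have "indep_vars (\<lambda>_. borel) X UNIV"
    unfolding indep_vars_def2
  proof (intro conjI ballI)
    fix o' show "random_variable borel (X o')"
      using measurable_from_subalg[OF subalgebra_joint_past Y] st t0 by (cases o') (simp_all add: X_def[abs_def])
    show "indep_sets (\<lambda>o'. {X o' -` A \<inter> space M |A. A \<in> sets borel}) UNIV"
    proof (rule indep_sets_mono_sets[OF collected])
      fix o'
      show "{X o' -` A \<inter> space M |A. A \<in> sets borel} \<subseteq> sigma_sets (space M) (\<Union>p\<in>I o'. ?E p)"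
      proof (cases o')
        case None
        then show ?thesis using measurable_sets[OF Y] by (auto simp: X_def[abs_def] I_def sets_joint_past)
      next
        case (Some j)
        have "X o' -` A \<inter> space M \<in> increment_events s t j" if A: "A \<in> sets borel" for A
        proof -
          have "(\<lambda>x. ennreal (exp (c j * x))) -` A \<inter> space borel \<in> sets borel"
            using A by (intro measurable_sets[of _ borel borel]) auto
          then show ?thesis unfolding increment_events_def Some X_def
            by (intro CollectI exI[of _ "(\<lambda>x. ennreal (exp (c j * x))) -` A"]) auto
        qed
        then show ?thesis by (auto simp: Some I_def intro!: sigma_sets.Basic)
      qed
    qed
  qed
  then have "(\<integral>\<^sup>+\<omega>. (\<Prod>o'\<in>UNIV. X o' \<omega>) \<partial>M) = (\<Prod>o'\<in>UNIV. \<integral>\<^sup>+\<omega>. X o' \<omega> \<partial>M)"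
    by (intro indep_vars_nn_integral) auto
  moreover have "(\<Prod>o'\<in>UNIV. f o') = f None * (\<Prod>j\<in>UNIV. f (Some j))" for f :: "'l option \<Rightarrow> ennreal"
    unfolding UNIV_option_conv by (subst prod.insert) (auto simp: prod.reindex)
  ultimately have "(\<integral>\<^sup>+\<omega>. Y \<omega> * (\<Prod>j\<in>UNIV. ennreal (exp (c j * (W j t \<omega> - W j s \<omega>)))) \<partial>M) =
      (\<integral>\<^sup>+\<omega>. Y \<omega> \<partial>M) * (\<Prod>j\<in>UNIV. \<integral>\<^sup>+\<omega>. ennreal (exp (c j * (W j t \<omega> - W j s \<omega>))) \<partial>M)"
    by (simp add: X_def)
  moreover have "(\<Prod>j\<in>UNIV. ennreal (exp (c j * (W j t \<omega> - W j s \<omega>)))) = ennreal (exp (\<Sum>j\<in>UNIV. c j * (W j t \<omega> - W j s \<omega>)))" for \<omega>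
    by (subst prod_ennreal) (auto simp: exp_sum)
  moreover have "(\<Prod>j\<in>UNIV. \<integral>\<^sup>+\<omega>. ennreal (exp (c j * (W j t \<omega> - W j s \<omega>))) \<partial>M) = ennreal (exp ((\<Sum>j\<in>UNIV. (c j)\<^sup>2) / 2 * (t - s)))"
  proof -
    have "(\<Prod>j\<in>UNIV. \<integral>\<^sup>+\<omega>. ennreal (exp (c j * (W j t \<omega> - W j s \<omega>))) \<partial>M) = (\<Prod>j\<in>UNIV. ennreal (exp ((c j)\<^sup>2 / 2 * (t - s))))"
      by (intro prod.cong refl filtered_brownian_motion.increment_exp_moment[OF bm_locale st])
    also have "\<dots> = ennreal (exp (\<Sum>j\<in>UNIV. (c j)\<^sup>2 / 2 * (t - s)))" by (subst prod_ennreal) (auto simp: exp_sum)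
    also have "(\<Sum>j\<in>UNIV. (c j)\<^sup>2 / 2 * (t - s)) = (\<Sum>j\<in>UNIV. (c j)\<^sup>2) / 2 * (t - s)"
      by (simp only: sum_distrib_right sum_divide_distrib)
    finally show ?thesis .
  qed
  ultimately show ?thesis by simp
qed

end

text \<open>Mixtures of geometric Brownian motions. A coefficient b in front of a Brownian motion
  contributes the growth rate b^2 / 2 to the expectation, so \<open>decay\<close> says that no
  summand grows in mean.\<close>

locale exponential_mixture = independent_brownian_motions M F W
  for M :: "'a measure" and F and W :: "'l::finite \<Rightarrow> real \<Rightarrow> 'a \<Rightarrow> real" +
  fixes c \<alpha> :: "'k::finite \<Rightarrow> real" and \<beta> :: "'k \<Rightarrow> 'l \<Rightarrow> real"
  assumes c: "\<And>k. 0 \<le> c k" and decay: "\<And>k. \<alpha> k + (\<Sum>j\<in>UNIV. (\<beta> k j)\<^sup>2) / 2 \<le> 0"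
begin

text \<open>Using increments from time 0 makes the initial value equal to \<open>c k\<close> at
  every sample point and not just almost surely.\<close>

definition summand :: "'k \<Rightarrow> real \<Rightarrow> 'a \<Rightarrow> real" where
  "summand k t \<omega> = c k * exp (\<alpha> k * t + (\<Sum>j\<in>UNIV. \<beta> k j * (W j t \<omega> - W j 0 \<omega>)))"

definition mix :: "real \<Rightarrow> 'a \<Rightarrow> real" where
  "mix t \<omega> = (\<Sum>k\<in>UNIV. summand k t \<omega>)"

lemma summand_nonneg: "0 \<le> summand k t \<omega>" using c by (simp add: summand_def)

lemma summand_measurable: "0 \<le> t \<Longrightarrow> summand k t \<in> borel_measurable (joint_past t)"
proof -
  assume "0 \<le> t"
  then have [measurable]: "W j t \<in> borel_measurable (joint_past t)" "W j 0 \<in> borel_measurable (joint_past t)" for j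
    by (auto intro: W_joint_past)
  show ?thesis unfolding summand_def by measurable
qed

lemma mix_measurable: "0 \<le> t \<Longrightarrow> mix t \<in> borel_measurable (joint_past t)"
  unfolding mix_def by (intro borel_measurable_sum summand_measurable)

lemma summand_measurable_M: "0 \<le> t \<Longrightarrow> summand k t \<in> borel_measurable M"
  using measurable_from_subalg[OF subalgebra_joint_past summand_measurable] .

lemma mix_measurable_M [measurable]: "0 \<le> t \<Longrightarrow> mix t \<in> borel_measurable M"
  using measurable_from_subalg[OF subalgebra_joint_past mix_measurable] .

text \<open>The conditional expectation given \<open>joint_past s\<close>, expressed through
  integrals over events: splitting off the factor that depends on the increments after
  \<open>s\<close> leaves a deterministic constant.\<close>

lemma summand_integral:
  assumes st: "0 \<le> s" "s \<le> t" and A: "A \<in> sets (joint_past s)"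
  shows "(\<integral>\<^sup>+\<omega>\<in>A. ennreal (summand k t \<omega>) \<partial>M) =
    (\<integral>\<^sup>+\<omega>\<in>A. ennreal (summand k s \<omega>) \<partial>M) * ennreal (exp ((\<alpha> k + (\<Sum>j\<in>UNIV. (\<beta> k j)\<^sup>2) / 2) * (t - s)))"
proof (cases "s = t")
  case False
  then have lt: "s < t" using st by simp
  let ?e = "\<lambda>\<omega>. exp (\<Sum>j\<in>UNIV. \<beta> k j * (W j t \<omega> - W j s \<omega>))"
  let ?Y = "\<lambda>\<omega>. ennreal (summand k s \<omega>) * indicator A \<omega>"
  have [measurable]: "summand k s \<in> borel_measurable (joint_past s)" using st(1) by (rule summand_measurable)
  have Y: "?Y \<in> borel_measurable (joint_past s)" using A by measurable
  have W [measurable]: "W j u \<in> borel_measurable M" if "0 \<le> u" for j u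
    by (rule filtered_brownian_motion.W_measurable[OF bm_locale that])
  have YM [measurable]: "?Y \<in> borel_measurable M" using measurable_from_subalg[OF subalgebra_joint_past Y] .
  have [measurable]: "W j t \<in> borel_measurable M" "W j s \<in> borel_measurable M" for j using st by (auto intro!: W)
  have "summand k t \<omega> = exp (\<alpha> k * (t - s)) * (summand k s \<omega> * ?e \<omega>)" for \<omega>
  proof -
    have "\<alpha> k * t + (\<Sum>j\<in>UNIV. \<beta> k j * (W j t \<omega> - W j 0 \<omega>)) = \<alpha> k * (t - s) +
      (\<alpha> k * s + (\<Sum>j\<in>UNIV. \<beta> k j * (W j s \<omega> - W j 0 \<omega>)) + (\<Sum>j\<in>UNIV. \<beta> k j * (W j t \<omega> - W j s \<omega>)))"
      by (simp add: algebra_simps sum.distrib sum_subtractf)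
    then have "exp (\<alpha> k * t + (\<Sum>j\<in>UNIV. \<beta> k j * (W j t \<omega> - W j 0 \<omega>))) = exp (\<alpha> k * (t - s)) *
      (exp (\<alpha> k * s + (\<Sum>j\<in>UNIV. \<beta> k j * (W j s \<omega> - W j 0 \<omega>))) * ?e \<omega>)"
      by (simp only: exp_add)
    then show ?thesis unfolding summand_def by (simp add: mult_ac)
  qed
  then have "(\<integral>\<^sup>+\<omega>\<in>A. ennreal (summand k t \<omega>) \<partial>M) =
     (\<integral>\<^sup>+\<omega>. ennreal (exp (\<alpha> k * (t - s))) * (?Y \<omega> * ennreal (?e \<omega>)) \<partial>M)"
    by (intro nn_integral_cong) (simp add: ennreal_mult summand_nonneg mult_ac)
  also have "\<dots> = ennreal (exp (\<alpha> k * (t - s))) * (\<integral>\<^sup>+\<omega>. ?Y \<omega> * ennreal (?e \<omega>) \<partial>M)"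
    by (rule nn_integral_cmult) measurable
  also have "(\<integral>\<^sup>+\<omega>. ?Y \<omega> * ennreal (?e \<omega>) \<partial>M) = (\<integral>\<^sup>+\<omega>. ?Y \<omega> \<partial>M) * ennreal (exp ((\<Sum>j\<in>UNIV. (\<beta> k j)\<^sup>2) / 2 * (t - s)))"
    by (rule joint_increment_exp_moment[OF st(1) lt Y])
  also have "ennreal (exp (\<alpha> k * (t - s))) * ((\<integral>\<^sup>+\<omega>. ?Y \<omega> \<partial>M) * ennreal (exp ((\<Sum>j\<in>UNIV. (\<beta> k j)\<^sup>2) / 2 * (t - s)))) =
    (\<integral>\<^sup>+\<omega>. ?Y \<omega> \<partial>M) * ennreal (exp (\<alpha> k * (t - s)) * exp ((\<Sum>j\<in>UNIV. (\<beta> k j)\<^sup>2) / 2 * (t - s)))"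
    by (simp add: ennreal_mult mult_ac)
  finally show ?thesis by (simp only: exp_add[symmetric] distrib_right)
qed simp

lemma mix_integral_sum:
  assumes "0 \<le> t" "A \<in> sets M"
  shows "(\<integral>\<^sup>+\<omega>\<in>A. ennreal (mix t \<omega>) \<partial>M) = (\<Sum>k\<in>UNIV. \<integral>\<^sup>+\<omega>\<in>A. ennreal (summand k t \<omega>) \<partial>M)"
proof -
  have [measurable]: "summand k t \<in> borel_measurable M" for k using assms(1) by (rule summand_measurable_M)
  note assms(2)[measurable]
  have "(\<integral>\<^sup>+\<omega>\<in>A. ennreal (mix t \<omega>) \<partial>M) = (\<integral>\<^sup>+\<omega>. (\<Sum>k\<in>UNIV. ennreal (summand k t \<omega>) * indicator A \<omega>) \<partial>M)"
    by (intro nn_integral_cong) (simp add: mix_def sum_ennreal[symmetric] summand_nonneg sum_distrib_right del: sum_ennreal)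
  also have "\<dots> = (\<Sum>k\<in>UNIV. \<integral>\<^sup>+\<omega>\<in>A. ennreal (summand k t \<omega>) \<partial>M)"
    by (intro nn_integral_sum) measurable
  finally show ?thesis .
qed

lemma mix_supermartingale:
  assumes st: "0 \<le> s" "s \<le> t" and A: "A \<in> sets (joint_past s)"
  shows "(\<integral>\<^sup>+\<omega>\<in>A. ennreal (mix t \<omega>) \<partial>M) \<le> (\<integral>\<^sup>+\<omega>\<in>A. ennreal (mix s \<omega>) \<partial>M)"
proof -
  have AM: "A \<in> sets M" using A subalgebra_joint_past[of s] by (auto simp: subalgebra_def)
  have t0: "0 \<le> t" using st by simp
  show ?thesis
    unfolding mix_integral_sum[OF st(1) AM] mix_integral_sum[OF t0 AM] summand_integral[OF st A]
  proof (intro sum_mono)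
    fix k
    have "(\<alpha> k + (\<Sum>j\<in>UNIV. (\<beta> k j)\<^sup>2) / 2) * (t - s) \<le> 0" using decay[of k] st by (intro mult_nonpos_nonneg) auto
    then have "ennreal (exp ((\<alpha> k + (\<Sum>j\<in>UNIV. (\<beta> k j)\<^sup>2) / 2) * (t - s))) \<le> 1" by (simp add: ennreal_le_1)
    from mult_left_mono[OF this, of "\<integral>\<^sup>+\<omega>\<in>A. ennreal (summand k s \<omega>) \<partial>M"]
    show "(\<integral>\<^sup>+\<omega>\<in>A. ennreal (summand k s \<omega>) \<partial>M) * ennreal (exp ((\<alpha> k + (\<Sum>j\<in>UNIV. (\<beta> k j)\<^sup>2) / 2) * (t - s)))
      \<le> (\<integral>\<^sup>+\<omega>\<in>A. ennreal (summand k s \<omega>) \<partial>M)" by simp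
  qed
qed

lemma mix_expectation:
  assumes "0 \<le> t"
  shows "(\<integral>\<^sup>+\<omega>. ennreal (mix t \<omega>) \<partial>M) = ennreal (\<Sum>k\<in>UNIV. c k * exp ((\<alpha> k + (\<Sum>j\<in>UNIV. (\<beta> k j)\<^sup>2) / 2) * t))"
proof -
  have "(\<integral>\<^sup>+\<omega>. ennreal (mix t \<omega>) \<partial>M) = (\<integral>\<^sup>+\<omega>\<in>space M. ennreal (mix t \<omega>) \<partial>M)"
    by (intro nn_integral_cong) simp
  also have "\<dots> = (\<Sum>k\<in>UNIV. \<integral>\<^sup>+\<omega>\<in>space M. ennreal (summand k t \<omega>) \<partial>M)"
    using assms by (rule mix_integral_sum) simp
  also have "\<dots> = (\<Sum>k\<in>UNIV. (\<integral>\<^sup>+\<omega>\<in>space M. ennreal (summand k 0 \<omega>) \<partial>M) * ennreal (exp ((\<alpha> k + (\<Sum>j\<in>UNIV. (\<beta> k j)\<^sup>2) / 2) * (t - 0))))"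
    using assms sets.top[of "joint_past 0"] by (intro sum.cong refl summand_integral) auto
  also have "\<dots> = (\<Sum>k\<in>UNIV. ennreal (c k * exp ((\<alpha> k + (\<Sum>j\<in>UNIV. (\<beta> k j)\<^sup>2) / 2) * t)))"
  proof (intro sum.cong refl)
    fix k
    have "(\<integral>\<^sup>+\<omega>\<in>space M. ennreal (summand k 0 \<omega>) \<partial>M) = (\<integral>\<^sup>+\<omega>. ennreal (c k) \<partial>M)"
      by (intro nn_integral_cong) (simp add: summand_def)
    then show "(\<integral>\<^sup>+\<omega>\<in>space M. ennreal (summand k 0 \<omega>) \<partial>M) * ennreal (exp ((\<alpha> k + (\<Sum>j\<in>UNIV. (\<beta> k j)\<^sup>2) / 2) * (t - 0))) =
      ennreal (c k * exp ((\<alpha> k + (\<Sum>j\<in>UNIV. (\<beta> k j)\<^sup>2) / 2) * t))"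
      using c[of k] by (simp add: emeasure_space_1 ennreal_mult)
  qed
  finally show ?thesis using c by simp
qed

text \<open>On one level the maximal inequality gives a bound that does not depend on the level. The
  grids are nested, point \<open>i\<close> of level \<open>n\<close> being point
  \<open>2 * i\<close> of the next, so the events increase and the bound passes to their
  union.\<close>

theorem mix_dyadic_maximal_inequality:
  assumes s: "0 \<le> s" "0 \<le> d" and K: "0 < K"
  shows "measure M (\<Union>n. {\<omega> \<in> space M. \<exists>i\<le>2^n. K < mix (s + dyadic d n i) \<omega>})
    \<le> (\<Sum>k\<in>UNIV. c k * exp ((\<alpha> k + (\<Sum>j\<in>UNIV. (\<beta> k j)\<^sup>2) / 2) * s)) / K"
proof -
  let ?S = "\<Sum>k\<in>UNIV. c k * exp ((\<alpha> k + (\<Sum>j\<in>UNIV. (\<beta> k j)\<^sup>2) / 2) * s)"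
  define E where "E n = {\<omega> \<in> space M. \<exists>i\<le>2^n. K < mix (s + dyadic d n i) \<omega>}" for n
  have dy: "0 \<le> s + dyadic d n i" for n i using s by (simp add: dyadic_def)
  have [measurable]: "mix (s + dyadic d n i) \<in> borel_measurable M" for n i using dy by (rule mix_measurable_M)
  have EM [measurable]: "E n \<in> sets M" for n unfolding E_def by measurable
  have bound: "measure M (E n) \<le> ?S / K" for n
  proof -
    have "ennreal K * emeasure M {\<omega> \<in> space M. \<exists>i\<le>2^n. ennreal K < ennreal (mix (s + dyadic d n i) \<omega>)} \<le>
       (\<integral>\<^sup>+\<omega>. ennreal (mix (s + dyadic d n 0) \<omega>) \<partial>M)"
    proof (rule supermartingale_maximal_inequality[where G = "\<lambda>i. joint_past (s + dyadic d n i)"])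
      fix i :: nat
      show "subalgebra M (joint_past (s + dyadic d n i))" by (rule subalgebra_joint_past)
      show "(\<lambda>\<omega>. ennreal (mix (s + dyadic d n i) \<omega>)) \<in> borel_measurable (joint_past (s + dyadic d n i))"
        using mix_measurable[OF dy] by measurable
      show "(\<integral>\<^sup>+\<omega>\<in>A. ennreal (mix (s + dyadic d n (Suc i)) \<omega>) \<partial>M) \<le> (\<integral>\<^sup>+\<omega>\<in>A. ennreal (mix (s + dyadic d n i) \<omega>) \<partial>M)"
        if "A \<in> sets (joint_past (s + dyadic d n i))" for A
        using that monoD[OF dyadic_mono[OF s(2)], of i "Suc i" n] by (intro mix_supermartingale dy) auto
      show "sets (joint_past (s + dyadic d n i)) \<subseteq> sets (joint_past (s + dyadic d n j))" if "i \<le> j" for j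
        using monoD[OF dyadic_mono[OF s(2)] that, of n] by (intro joint_past_mono) auto
    qed
    also have "\<dots> = ennreal ?S" using mix_expectation[OF s(1)] by simp
    also have "{\<omega> \<in> space M. \<exists>i\<le>2^n. ennreal K < ennreal (mix (s + dyadic d n i) \<omega>)} = E n"
      using K by (auto simp: E_def ennreal_less_iff)
    finally have "ennreal (K * measure M (E n)) \<le> ennreal ?S"
      using K by (simp add: emeasure_eq_measure ennreal_mult)
    moreover have "0 \<le> ?S" using c by (intro sum_nonneg) auto
    ultimately have "K * measure M (E n) \<le> ?S" by (simp add: ennreal_le_iff)
    then show ?thesis using K by (simp add: field_simps)
  qed
  have "incseq E"
  proof (rule incseq_SucI, rule subsetI)
    fix n \<omega> assume "\<omega> \<in> E n"
    then obtain i where "i \<le> 2^n" "K < mix (s + dyadic d n i) \<omega>" "\<omega> \<in> space M" by (auto simp: E_def)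
    moreover have "dyadic d n i = dyadic d (Suc n) (2 * i)" by (simp add: dyadic_def)
    ultimately show "\<omega> \<in> E (Suc n)" by (auto simp: E_def intro!: exI[of _ "2 * i"])
  qed
  then have "(\<lambda>n. measure M (E n)) \<longlonglongrightarrow> measure M (\<Union>n. E n)"
    by (intro finite_Lim_measure_incseq) auto
  then have "measure M (\<Union>n. E n) \<le> ?S / K" by (rule LIMSEQ_le_const2) (auto intro: bound)
  then show ?thesis unfolding E_def .
qed

end

section \<open>Coordinates of the solution\<close>

lemma cinner_cvec: "cinner (cvec y) u = (\<Sum>i\<in>UNIV. complex_of_real (y $ i) * cnj (u $ i))"
  by (simp add: cinner_def cvec_def)

text \<open>The matrix moves to the second argument as its adjoint, and the eigenvalue leaves that
  conjugate-linear slot conjugated. The conjugation does no harm: only real parts of exponents enter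
  the norm later.\<close>

lemma cinner_eigenvector:
  fixes B :: "real ^ 'd ^ 'd"
  assumes "conj_transpose (cmat B) *v u = \<mu> *s u"
  shows "cinner (cvec (B *v y)) u = cnj \<mu> * cinner (cvec y) u"
proof -
  have u: "(\<Sum>i\<in>UNIV. complex_of_real (B $ i $ l) * u $ i) = \<mu> * u $ l" for l
    using arg_cong[OF assms, of "\<lambda>v. v $ l"]
    by (simp add: conj_transpose_def cmat_def matrix_vector_mult_def map_matrix_def transpose_def)
  have u': "(\<Sum>i\<in>UNIV. complex_of_real (B $ i $ l) * cnj (u $ i)) = cnj \<mu> * cnj (u $ l)" for l
    using arg_cong[OF u[of l], of cnj] by simp
  have "cinner (cvec (B *v y)) u = (\<Sum>i\<in>UNIV. \<Sum>l\<in>UNIV. complex_of_real (y $ l) * (complex_of_real (B $ i $ l) * cnj (u $ i)))"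
    unfolding cinner_cvec by (simp add: matrix_vector_mult_def sum_distrib_right) (simp only: mult_ac)
  also have "\<dots> = (\<Sum>l\<in>UNIV. complex_of_real (y $ l) * (\<Sum>i\<in>UNIV. complex_of_real (B $ i $ l) * cnj (u $ i)))"
    by (subst sum.swap) (simp add: sum_distrib_left)
  also have "\<dots> = cnj \<mu> * cinner (cvec y) u"
    unfolding u' cinner_cvec by (simp add: sum_distrib_left mult_ac)
  finally show ?thesis .
qed

lemma bounded_linear_cinner: "bounded_linear (\<lambda>y :: real ^ 'd. cinner (cvec y) u)"
  unfolding linear_conv_bounded_linear[symmetric]
proof (rule linearI)
  show "cinner (cvec (x + y)) u = cinner (cvec x) u + cinner (cvec y) u" for x y
    by (simp add: cinner_cvec sum.distrib distrib_right)
  show "cinner (cvec (r *\<^sub>R x)) u = r *\<^sub>R cinner (cvec x) u" for r x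
    by (simp add: cinner_cvec scaleR_sum_right) (simp add: scaleR_conv_of_real mult.assoc)
qed

lemma frequently_subsequence:
  assumes "\<exists>\<^sub>F n in sequentially. P n"
  obtains r :: "nat \<Rightarrow> nat" where "strict_mono r" "\<And>n. P (r n)"
proof
  have inf: "infinite {n. P n}"
    using assms unfolding frequently_sequentially infinite_nat_iff_unbounded_le by simp
  show "strict_mono (enumerate {n. P n})" using inf by (rule strict_mono_enumerate)
  show "P (enumerate {n. P n} n)" for n using enumerate_in_set[OF inf, of n] by simp
qed

text \<open>The inner product with a common eigenvector turns the vector equation into a scalar one,
  in which the componentwise integrals and covariations are combined with the coefficients
  \<open>cnj (u $ i)\<close>. Ito errors are real, so the limits with the complex weight
  \<open>Z\<close> are assumed for \<open>Re\<close> and \<open>Im\<close> separately.\<close>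

lemma stratonovich_system_pathwise:
  fixes X :: "real \<Rightarrow> real ^ 'd" and w :: "'l::finite \<Rightarrow> real \<Rightarrow> real" and I C :: "'l \<Rightarrow> 'd \<Rightarrow> real \<Rightarrow> real"
    and A :: "real ^ 'd ^ 'd" and B :: "'l \<Rightarrow> real ^ 'd ^ 'd" and u :: "complex ^ 'd" and \<mu> :: "'l \<Rightarrow> complex"
    and \<kappa> :: complex and T :: real and h :: "nat \<Rightarrow> nat"
  defines "g \<equiv> \<lambda>n. dyadic T (h n)"
    and "Z \<equiv> \<lambda>t. exp (- (cnj \<kappa> * of_real t + (\<Sum>j\<in>UNIV. cnj (\<mu> j) * of_real (w j t - w j 0))))"
    and "e \<equiv> \<lambda>j i n l. I j i (dyadic T (h n) (Suc l)) - I j i (dyadic T (h n) l)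
      - (B j *v X (dyadic T (h n) l)) $ i * (w j (dyadic T (h n) (Suc l)) - w j (dyadic T (h n) l))"
  assumes T: "0 < T" and h: "strict_mono h"
    and u: "conj_transpose (cmat A) *v u = \<kappa> *s u" "\<And>j. conj_transpose (cmat (B j)) *v u = \<mu> j *s u"
    and contX: "continuous_on {0..T} X" and contw: "\<And>j. continuous_on {0..T} (w j)"
    and contC: "\<And>j i. continuous_on {0..T} (C j i)" and varC: "\<And>j i. finite_variation (C j i)"
    and eq: "\<And>t. t \<in> {0..T} \<Longrightarrow> X t = x + integral {0..t} (\<lambda>s. A *v X s) + (\<Sum>j\<in>UNIV. \<chi> i. I j i t + C j i t / 2)"
    and re: "\<And>j i. (\<lambda>n. \<Sum>l<2 ^ h n. Re (Z (g n l)) * e j i n l) \<longlonglongrightarrow> 0"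
    and im: "\<And>j i. (\<lambda>n. \<Sum>l<2 ^ h n. Im (Z (g n l)) * e j i n l) \<longlonglongrightarrow> 0"
    and sq: "\<And>j i. (\<lambda>n. \<Sum>l<2 ^ h n. (e j i n l)\<^sup>2) \<longlonglongrightarrow> 0"
    and cov: "\<And>j i q r. r \<le> 2 ^ q \<Longrightarrow> (\<lambda>n. \<Sum>l<r * 2 ^ (h n - q).
        ((B j *v X (g n (Suc l))) $ i - (B j *v X (g n l)) $ i) * (w j (g n (Suc l)) - w j (g n l))) \<longlonglongrightarrow> C j i (T * real r / 2 ^ q)"
    and quad: "\<exists>K. \<exists>\<^sub>F n in sequentially. (\<Sum>j\<in>UNIV. \<Sum>l<2 ^ h n. (w j (g n (Suc l)) - w j (g n l))\<^sup>2) \<le> K"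
  shows "Z T * cinner (cvec (X T)) u = cinner (cvec (X 0)) u"
proof -
  obtain K where K: "\<exists>\<^sub>F n in sequentially. (\<Sum>j\<in>UNIV. \<Sum>l<2 ^ h n. (w j (g n (Suc l)) - w j (g n l))\<^sup>2) \<le> K"
    using quad by auto
  \<comment> \<open>The bound holds at infinitely many levels only, and which ones depends on the
    path. All the assumed limits are inherited by this subsequence.\<close>
  obtain r :: "nat \<Rightarrow> nat" where r: "strict_mono r" "\<And>n. (\<Sum>j\<in>UNIV. \<Sum>l<2 ^ h (r n). (w j (g (r n) (Suc l)) - w j (g (r n) l))\<^sup>2) \<le> K"
    by (rule frequently_subsequence[OF K]) blast
  note subseq = LIMSEQ_subseq_LIMSEQ[OF _ r(1), unfolded comp_def]
  let ?L = "\<lambda>y :: real ^ 'd. cinner (cvec y) u"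
  interpret L: bounded_linear ?L by (rule bounded_linear_cinner)
  define Y where "Y t = ?L (X t)" for t
  define J where "J j t = (\<Sum>i\<in>UNIV. complex_of_real (I j i t) * cnj (u $ i))" for j t
  define D where "D j t = (\<Sum>i\<in>UNIV. complex_of_real (C j i t) * cnj (u $ i))" for j t
  let ?X = "\<lambda>j i n l. (B j *v X (g n (Suc l))) $ i - (B j *v X (g n l)) $ i"
  let ?w = "\<lambda>j n l. w j (g n (Suc l)) - w j (g n l)"
  let ?e = "\<lambda>j n l. \<Sum>i\<in>UNIV. of_real (e j i n l) * cnj (u $ i)"
  let ?Im = "\<lambda>j i n. \<Sum>l<2 ^ h n. Im (Z (g n l)) * e j i n l"
  let ?Re = "\<lambda>j i n. \<Sum>l<2 ^ h n. Re (Z (g n l)) * e j i n l"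
  have LB: "?L (B j *v y) = cnj (\<mu> j) * ?L y" for j y by (rule cinner_eigenvector[OF u(2)])
  have LA: "?L (A *v y) = cnj \<kappa> * ?L y" for y by (rule cinner_eigenvector[OF u(1)])
  have contY: "continuous_on {0..T} Y" unfolding Y_def using L.continuous_on[OF contX] .
  have err: "J j (g n (Suc l)) - J j (g n l) - cnj (\<mu> j) * Y (g n l) * of_real (?w j n l) =
     (?e j n l)" for j n l
  proof -
    have b: "cnj (\<mu> j) * Y (g n l) = (\<Sum>i\<in>UNIV. of_real ((B j *v X (g n l)) $ i) * cnj (u $ i))"
      unfolding Y_def using LB[of j "X (g n l)"] cinner_cvec[of "B j *v X (g n l)" u] by simp
    show ?thesis
      unfolding b unfolding J_def e_def g_def sum_distrib_right sum_subtractf[symmetric]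
      by (intro sum.cong refl) (simp add: algebra_simps)
  qed
  have incr: "cnj (\<mu> j) * (Y (g n (Suc l)) - Y (g n l)) * of_real (?w j n l) =
     (\<Sum>i\<in>UNIV. of_real ((?X j i n l) * (?w j n l)) * cnj (u $ i))" for j n l
  proof -
    have "cnj (\<mu> j) * (Y (g n (Suc l)) - Y (g n l)) = ?L (B j *v X (g n (Suc l))) - ?L (B j *v X (g n l))"
      by (simp add: LB Y_def right_diff_distrib)
    also have "\<dots> = (\<Sum>i\<in>UNIV. of_real (?X j i n l) * cnj (u $ i))"
      unfolding cinner_cvec by (simp add: sum_subtractf left_diff_distrib)
    finally have E: "cnj (\<mu> j) * (Y (g n (Suc l)) - Y (g n l)) =
      (\<Sum>i\<in>UNIV. of_real (?X j i n l) * cnj (u $ i))" .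
    show ?thesis unfolding E sum_distrib_right of_real_mult by (intro sum.cong refl) (simp only: mult_ac)
  qed
  have "\<exists>V. \<forall>n. (\<Sum>l<2 ^ h n. \<bar>C j i (g n (Suc l)) - C j i (g n l)\<bar>) \<le> V" for j i
  proof -
    have T0: "0 \<le> T" using T by simp
    obtain V where V: "\<forall>n \<tau>. \<tau> 0 = 0 \<and> \<tau> n = T \<and> (\<forall>i<n. \<tau> i \<le> \<tau> (Suc i)) \<longrightarrow>
        (\<Sum>l<n. \<bar>C j i (\<tau> (Suc l)) - C j i (\<tau> l)\<bar>) \<le> V"
      using varC[of j i, unfolded finite_variation_def, THEN spec[of _ T], THEN mp, OF T0] by (elim exE)
    show ?thesis unfolding g_def
    proof (intro exI[of _ V] allI)
      fix n
      show "(\<Sum>l<2 ^ h n. \<bar>C j i (dyadic T (h n) (Suc l)) - C j i (dyadic T (h n) l)\<bar>) \<le> V"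
        by (rule V[THEN spec[of _ "2 ^ h n"], THEN spec[of _ "dyadic T (h n)"], THEN mp])
          (simp add: monoD[OF dyadic_mono[OF T0]])
    qed
  qed
  then obtain V where V: "\<And>j i n. (\<Sum>l<2 ^ h n. \<bar>C j i (g n (Suc l)) - C j i (g n l)\<bar>) \<le> V j i"
    by (metis (no_types))
  have V0: "0 \<le> V j i" for j i using order_trans[OF _ V[where n = 0 and j = j and i = i]] by (simp add: sum_nonneg)
  define V' where "V' = (\<Sum>j\<in>UNIV. \<Sum>i\<in>UNIV. cmod (u $ i) * V j i)"
  have "stratonovich_path T Y J D w (cnj \<kappa>) (?L x) (\<lambda>j. cnj (\<mu> j)) (\<lambda>n. h (r n)) V' K"
  proof (rule stratonovich_path.intro)
    show "continuous_on {0..T} (D j)" for j unfolding D_def using contC by (intro continuous_intros)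
    show "strict_mono (\<lambda>n. h (r n))" using strict_mono_o[OF h r(1)] by (simp add: comp_def)
  next
    fix t assume t: "t \<in> {0..T}"
    have "continuous_on {0..t} (\<lambda>s. A *v X s)"
      using t contX by (intro continuous_on_subset[OF matrix_vector_mult_linear_continuous_on[THEN continuous_on_compose2[OF _ contX]]]) auto
    then have "?L (integral {0..t} (\<lambda>s. A *v X s)) = integral {0..t} (\<lambda>s. ?L (A *v X s))"
      by (intro integral_linear[OF integrable_continuous_interval bounded_linear_cinner, symmetric, unfolded comp_def])
    also have "\<dots> = cnj \<kappa> * integral {0..t} Y" unfolding LA by (simp add: Y_def[abs_def])
    finally have 1: "?L (integral {0..t} (\<lambda>s. A *v X s)) = cnj \<kappa> * integral {0..t} Y" .
    have 2: "?L (\<chi> i. I j i t + C j i t / 2) = J j t + D j t / 2" for j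
      unfolding cinner_cvec J_def D_def by (simp add: sum.distrib sum_divide_distrib distrib_right)
    have "Y t = ?L (x + integral {0..t} (\<lambda>s. A *v X s) + (\<Sum>j\<in>UNIV. \<chi> i. I j i t + C j i t / 2))"
      unfolding Y_def using eq[OF t] by simp
    also have "\<dots> = ?L x + cnj \<kappa> * integral {0..t} Y + (\<Sum>j\<in>UNIV. J j t + D j t / 2)"
      by (simp only: L.add L.sum 1 2)
    finally show "Y t = ?L x + cnj \<kappa> * integral {0..t} Y + (\<Sum>j\<in>UNIV. J j t + D j t / 2)" .
  next
    fix j n
    have "cmod (D j (g (r n) (Suc l)) - D j (g (r n) l)) \<le> (\<Sum>i\<in>UNIV. cmod (u $ i) * \<bar>C j i (g (r n) (Suc l)) - C j i (g (r n) l)\<bar>)" for l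
    proof -
      have "D j (g (r n) (Suc l)) - D j (g (r n) l) = (\<Sum>i\<in>UNIV. of_real (C j i (g (r n) (Suc l)) - C j i (g (r n) l)) * cnj (u $ i))"
        unfolding D_def by (simp add: sum_subtractf left_diff_distrib)
      then show ?thesis by (simp only:) (rule sum_norm_le, simp add: norm_mult mult.commute del: of_real_diff)
    qed
    then have "(\<Sum>l<2 ^ h (r n). cmod (D j (g (r n) (Suc l)) - D j (g (r n) l))) \<le>
      (\<Sum>l<2 ^ h (r n). \<Sum>i\<in>UNIV. cmod (u $ i) * \<bar>C j i (g (r n) (Suc l)) - C j i (g (r n) l)\<bar>)"
      by (intro sum_mono)
    also have "\<dots> = (\<Sum>i\<in>UNIV. cmod (u $ i) * (\<Sum>l<2 ^ h (r n). \<bar>C j i (g (r n) (Suc l)) - C j i (g (r n) l)\<bar>))"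
      by (subst sum.swap) (simp add: sum_distrib_left)
    also have "\<dots> \<le> (\<Sum>i\<in>UNIV. cmod (u $ i) * V j i)" using V by (intro sum_mono mult_left_mono) auto
    also have "\<dots> \<le> V'" unfolding V'_def using V0
      by (intro member_le_sum[where f = "\<lambda>j. \<Sum>i\<in>UNIV. cmod (u $ i) * V j i"]) (auto intro!: sum_nonneg)
    finally show "(\<Sum>l<2 ^ h (r n). cmod (D j (dyadic T (h (r n)) (Suc l)) - D j (dyadic T (h (r n)) l))) \<le> V'"
      unfolding g_def .
    have "(\<Sum>l<2 ^ h (r n). (?w j (r n) l)\<^sup>2) \<le> (\<Sum>j\<in>UNIV. \<Sum>l<2 ^ h (r n). (?w j (r n) l)\<^sup>2)"
      by (intro member_le_sum[where f = "\<lambda>j. \<Sum>l<2 ^ h (r n). (?w j (r n) l)\<^sup>2"]) (auto intro!: sum_nonneg)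
    then show "(\<Sum>l<2 ^ h (r n). (w j (dyadic T (h (r n)) (Suc l)) - w j (dyadic T (h (r n)) l))\<^sup>2) \<le> K"
      using r(2)[of n] unfolding g_def by linarith
  next
    fix j
    have "(\<lambda>n. \<Sum>i\<in>UNIV. (of_real (?Re j i n) + \<i> * of_real (?Im j i n)) * cnj (u $ i))
        \<longlonglongrightarrow> (\<Sum>i\<in>UNIV. (of_real 0 + \<i> * of_real 0) * cnj (u $ i))"
      by (intro tendsto_sum tendsto_mult tendsto_add tendsto_of_real tendsto_const re im)
    then have "(\<lambda>n. \<Sum>i\<in>UNIV. (of_real (?Re j i n) + \<i> * of_real (?Im j i n)) * cnj (u $ i))
        \<longlonglongrightarrow> 0" by simp
    also have "(\<lambda>n. \<Sum>i\<in>UNIV. (of_real (?Re j i n) + \<i> * of_real (?Im j i n)) * cnj (u $ i))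
      = (\<lambda>n. \<Sum>l<2 ^ h n. Z (g n l) * (?e j n l))"
    proof
      fix n
      have "(of_real (?Re j i n) + \<i> * of_real (?Im j i n)) * cnj (u $ i)
        = (\<Sum>l<2 ^ h n. Z (g n l) * (of_real (e j i n l) * cnj (u $ i)))" for i
      proof -
        have "of_real (?Re j i n) + \<i> * of_real (?Im j i n)
          = (\<Sum>l<2 ^ h n. (of_real (Re (Z (g n l))) + \<i> * of_real (Im (Z (g n l)))) * of_real (e j i n l))"
          by (simp only: of_real_sum of_real_mult sum_distrib_left distrib_right sum.distrib mult.assoc)
        then show ?thesis by (simp only: complex_eq[symmetric] sum_distrib_right mult.assoc)
      qed
      then show "(\<Sum>i\<in>UNIV. (of_real (?Re j i n) + \<i> * of_real (?Im j i n)) * cnj (u $ i))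
        = (\<Sum>l<2 ^ h n. Z (g n l) * (?e j n l))"
        by (simp only:) (subst sum.swap, simp only: sum_distrib_left)
    qed
    finally show "(\<lambda>n. \<Sum>l<2 ^ h (r n). exp (- (cnj \<kappa> * complex_of_real (dyadic T (h (r n)) l) +
             (\<Sum>j\<in>UNIV. cnj (\<mu> j) * complex_of_real (w j (dyadic T (h (r n)) l) - w j 0)))) *
         (J j (dyadic T (h (r n)) (Suc l)) - J j (dyadic T (h (r n)) l) -
          cnj (\<mu> j) * Y (dyadic T (h (r n)) l) * complex_of_real (w j (dyadic T (h (r n)) (Suc l)) - w j (dyadic T (h (r n)) l)))) \<longlonglongrightarrow> 0"
      unfolding err[symmetric] Z_def g_def by (rule subseq)
    have "(\<lambda>n. \<Sum>l<2 ^ h n. (cmod (?e j n l))\<^sup>2) \<longlonglongrightarrow> 0"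
    proof (rule tendsto_sandwich[OF _ _ tendsto_const])
      \<comment> \<open>The factor \<open>CARD('d)\<close> comes from Cauchy-Schwarz over the
        components.\<close>
      have "(\<lambda>n. CARD('d) * (\<Sum>i\<in>UNIV. (cmod (u $ i))\<^sup>2 * (\<Sum>l<2 ^ h n. (e j i n l)\<^sup>2))) \<longlonglongrightarrow> CARD('d) * (\<Sum>i\<in>UNIV. (cmod (u $ i))\<^sup>2 * 0)"
        by (intro tendsto_intros sq)
      then show "(\<lambda>n. CARD('d) * (\<Sum>i\<in>UNIV. (cmod (u $ i))\<^sup>2 * (\<Sum>l<2 ^ h n. (e j i n l)\<^sup>2))) \<longlonglongrightarrow> 0" by simp
      show "\<forall>\<^sub>F n in sequentially. (\<Sum>l<2 ^ h n. (cmod (?e j n l))\<^sup>2) \<le>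
        CARD('d) * (\<Sum>i\<in>UNIV. (cmod (u $ i))\<^sup>2 * (\<Sum>l<2 ^ h n. (e j i n l)\<^sup>2))"
      proof (intro always_eventually allI)
        fix n
        have "(cmod (?e j n l))\<^sup>2 \<le> (\<Sum>i\<in>UNIV. CARD('d) * ((cmod (u $ i))\<^sup>2 * (e j i n l)\<^sup>2))" for l
        proof -
          have "cmod (?e j n l) \<le> (\<Sum>i\<in>UNIV. \<bar>e j i n l\<bar> * cmod (u $ i))"
            by (rule sum_norm_le) (simp add: norm_mult)
          then have "(cmod (?e j n l))\<^sup>2 \<le> (\<Sum>i\<in>UNIV. \<bar>e j i n l\<bar> * cmod (u $ i))\<^sup>2"
            by (intro power_mono) auto
          also have "\<dots> \<le> (\<Sum>i\<in>UNIV. (\<bar>e j i n l\<bar> * cmod (u $ i))\<^sup>2) * CARD('d)"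
            by (rule sum_squared_le_sum_of_squares)
          finally show ?thesis by (simp add: sum_distrib_left sum_distrib_right power_mult_distrib mult_ac)
        qed
        then have "(\<Sum>l<2 ^ h n. (cmod (?e j n l))\<^sup>2) \<le>
          (\<Sum>l<2 ^ h n. \<Sum>i\<in>UNIV. CARD('d) * ((cmod (u $ i))\<^sup>2 * (e j i n l)\<^sup>2))" by (intro sum_mono)
        also have "\<dots> = CARD('d) * (\<Sum>i\<in>UNIV. (cmod (u $ i))\<^sup>2 * (\<Sum>l<2 ^ h n. (e j i n l)\<^sup>2))"
          by (subst sum.swap) (simp only: sum_distrib_left)
        finally show "(\<Sum>l<2 ^ h n. (cmod (?e j n l))\<^sup>2) \<le>
           CARD('d) * (\<Sum>i\<in>UNIV. (cmod (u $ i))\<^sup>2 * (\<Sum>l<2 ^ h n. (e j i n l)\<^sup>2))" .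
      qed
    qed (auto intro!: always_eventually sum_nonneg)
    then show "(\<lambda>n. \<Sum>l<2 ^ h (r n). (cmod (J j (dyadic T (h (r n)) (Suc l)) - J j (dyadic T (h (r n)) l) -
          cnj (\<mu> j) * Y (dyadic T (h (r n)) l) * complex_of_real (w j (dyadic T (h (r n)) (Suc l)) - w j (dyadic T (h (r n)) l))))\<^sup>2) \<longlonglongrightarrow> 0"
      unfolding err[symmetric] g_def by (rule subseq)
  next
    fix j q and k :: nat assume k: "k \<le> 2 ^ q"
    have "(\<lambda>n. \<Sum>i\<in>UNIV. of_real (\<Sum>l<k * 2 ^ (h n - q). (?X j i n l) * (?w j n l)) * cnj (u $ i))
       \<longlonglongrightarrow> D j (T * real k / 2 ^ q)"
      unfolding D_def by (intro tendsto_sum tendsto_mult tendsto_of_real tendsto_const cov[OF k])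
    also have "(\<lambda>n. \<Sum>i\<in>UNIV. of_real (\<Sum>l<k * 2 ^ (h n - q). (?X j i n l) * (?w j n l)) * cnj (u $ i))
      = (\<lambda>n. \<Sum>l<k * 2 ^ (h n - q). cnj (\<mu> j) * (Y (g n (Suc l)) - Y (g n l)) * of_real (?w j n l))"
      unfolding incr by (subst sum.swap) (simp only: of_real_sum sum_distrib_right)
    finally show "(\<lambda>n. \<Sum>l<k * 2 ^ (h (r n) - q). cnj (\<mu> j) * (Y (dyadic T (h (r n)) (Suc l)) - Y (dyadic T (h (r n)) l)) *
         complex_of_real (w j (dyadic T (h (r n)) (Suc l)) - w j (dyadic T (h (r n)) l))) \<longlonglongrightarrow> D j (T * real k / 2 ^ q)"
      unfolding g_def by (rule subseq)
  qed (use T contY contw in auto)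
  from stratonovich_path.solution_formula[OF this] show ?thesis by (simp add: Z_def Y_def)
qed

section \<open>Limits in probability and expectations along dyadic grids\<close>

context filtered_brownian_motion begin

text \<open>All indices are put into group 0, and the remaining groups are empty.\<close>

lemma ito_riemann_sum:
  assumes I: "is_ito_integral M F W H I" and z: "continuous_adapted M F z" and T: "0 < T"
  shows "tends_to_zero_in_prob M (\<lambda>m \<omega>. ennreal ((\<Sum>l<2^m. z (dyadic T m l) \<omega> * (I (dyadic T m (Suc l)) \<omega> - I (dyadic T m l) \<omega>
     - H (dyadic T m l) \<omega> * (W (dyadic T m (Suc l)) \<omega> - W (dyadic T m l) \<omega>)))\<^sup>2))"
proof -
  have "(\<Sum>r<(2::nat)^m. (\<Sum>l | l < 2^m \<and> 0 = r. f l)\<^sup>2) = (\<Sum>l<2^m. f l)\<^sup>2" for m :: nat and f :: "nat \<Rightarrow> real"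
  proof -
    have "(\<Sum>r<(2::nat)^m. (\<Sum>l | l < 2^m \<and> 0 = r. f l)\<^sup>2) = (\<Sum>r<(2::nat)^m. if r = 0 then (\<Sum>l<2^m. f l)\<^sup>2 else 0)"
      by (intro sum.cong refl) (auto simp: lessThan_def)
    then show ?thesis by simp
  qed
  then show ?thesis using ito_riemann_sums[OF I z T, where grp = "\<lambda>_ _. 0"] by simp
qed

text \<open>Every index is a group of its own, and the weight is constantly 1.\<close>

lemma ito_riemann_sum_squares:
  assumes I: "is_ito_integral M F W H I" and T: "0 < T"
  shows "tends_to_zero_in_prob M (\<lambda>m \<omega>. ennreal (\<Sum>l<2^m. (I (dyadic T m (Suc l)) \<omega> - I (dyadic T m l) \<omega>
     - H (dyadic T m l) \<omega> * (W (dyadic T m (Suc l)) \<omega> - W (dyadic T m l) \<omega>))\<^sup>2))"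
proof -
  have z: "continuous_adapted M F (\<lambda>_ _. 1 :: real)" by (simp add: continuous_adapted_def)
  have *: "{l. l < (2::nat)^m \<and> l = r} = {r}" if "r < 2 ^ m" for m r using that by auto
  have "(\<Sum>r<(2::nat)^m. (\<Sum>l | l < 2^m \<and> l = r. f l)\<^sup>2) = (\<Sum>l<2^m. (f l)\<^sup>2)" for m :: nat and f :: "nat \<Rightarrow> real"
    by (intro sum.cong refl) (simp add: *)
  then show ?thesis using ito_riemann_sums[OF I z T, where grp = "\<lambda>_ l. l"] by simp
qed

text \<open>Provides a bound uniform in the level \<open>m\<close>, to be used with Fatou's
  lemma.\<close>

lemma quadratic_variation_expectation:
  assumes "0 \<le> T"
  shows "(\<integral>\<^sup>+\<omega>. ennreal (\<Sum>l<2^m. (W (dyadic T m (Suc l)) \<omega> - W (dyadic T m l) \<omega>)\<^sup>2) \<partial>M) = ennreal T"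
proof -
  let ?S = "\<lambda>\<omega>. \<Sum>l<2^m. (W (dyadic T m (Suc l)) \<omega> - W (dyadic T m l) \<omega>)\<^sup>2"
  have d: "0 \<le> dyadic T m l" "dyadic T m l \<le> dyadic T m (Suc l)" for l
    using assms monoD[OF dyadic_mono[OF assms], of l "Suc l" m] by (auto simp: dyadic_def)
  note mom = increment_moments[OF d]
  have "(\<integral>\<^sup>+\<omega>. ennreal (?S \<omega>) \<partial>M) =
    ennreal (expectation (\<lambda>\<omega>. ?S \<omega>))"
    using mom by (intro nn_integral_eq_integral Bochner_Integration.integrable_sum always_eventually allI sum_nonneg) auto
  also have "expectation (\<lambda>\<omega>. ?S \<omega>) = (\<Sum>l<2^m. dyadic T m (Suc l) - dyadic T m l)"
    using mom by (subst Bochner_Integration.integral_sum) auto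
  also have "\<dots> = T" by (simp add: sum_lessThan_telescope)
  finally show ?thesis .
qed

text \<open>The grid points of level \<open>m\<close> partition the interval from 0 to
  \<open>T * r / 2 ^ q\<close>. For \<open>m < q\<close> that time need not be a grid point; the
  truncated difference in \<open>m - q + q\<close> then raises the level to \<open>q\<close>, so
  that a partition results for every \<open>m\<close>, and gives back \<open>m\<close> as soon as
  \<open>q \<le> m\<close>.\<close>

lemma covariation_dyadic:
  assumes C: "is_quadratic_covariation M F H W C" and T: "0 < T"
  shows "tends_to_zero_in_prob M (\<lambda>m \<omega>. ennreal \<bar>(\<Sum>l<r * 2 ^ (m - q).
     (H (dyadic T (m - q + q) (Suc l)) \<omega> - H (dyadic T (m - q + q) l) \<omega>) *
     (W (dyadic T (m - q + q) (Suc l)) \<omega> - W (dyadic T (m - q + q) l) \<omega>)) - C (T * real r / 2 ^ q) \<omega>\<bar>)"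
proof -
  define f where "f m \<omega> = ennreal \<bar>(\<Sum>l<r * 2 ^ m.
     (H (dyadic T (m + q) (Suc l)) \<omega> - H (dyadic T (m + q) l) \<omega>) *
     (W (dyadic T (m + q) (Suc l)) \<omega> - W (dyadic T (m + q) l) \<omega>)) - C (T * real r / 2 ^ q) \<omega>\<bar>" for m \<omega>
  have T0: "0 \<le> T" using T by simp
  have part: "partition_sequence (T * real r / 2 ^ q) (\<lambda>m. r * 2 ^ m) (\<lambda>m l. dyadic T (m + q) l)"
    unfolding partition_sequence_def
  proof (intro conjI allI impI)
    show "dyadic T (m + q) (r * 2 ^ m) = T * real r / 2 ^ q" for m by (simp add: dyadic_def power_add)
    show "dyadic T (m + q) l \<le> dyadic T (m + q) (Suc l)" for m l
      using monoD[OF dyadic_mono[OF T0], of l "Suc l"] by simp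
    fix \<delta> :: real assume \<delta>: "0 < \<delta>"
    have "(\<lambda>m. T / 2 ^ q * (1/2) ^ m) \<longlonglongrightarrow> T / 2 ^ q * 0"
      by (intro tendsto_intros LIMSEQ_power_zero) auto
    then have "\<forall>\<^sub>F m in sequentially. T / 2 ^ q * (1/2) ^ m < \<delta>" using \<delta> by (intro order_tendstoD(2)[of _ 0]) auto
    then show "\<forall>\<^sub>F m in sequentially. \<forall>i<r * 2 ^ m. dyadic T (m + q) (Suc i) - dyadic T (m + q) i < \<delta>"
      by eventually_elim (simp add: dyadic_step power_add power_divide mult.commute)
  qed simp
  have "\<forall>t\<ge>0. \<forall>n \<tau>. partition_sequence t n \<tau> \<longrightarrow>
        tends_to_zero_in_prob M
          (\<lambda>m \<omega>. ennreal \<bar>(\<Sum>i<n m. (H (\<tau> m (Suc i)) \<omega> - H (\<tau> m i) \<omega>) *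
                                      (W (\<tau> m (Suc i)) \<omega> - W (\<tau> m i) \<omega>)) - C t \<omega>\<bar>)"
    using C unfolding is_quadratic_covariation_def by blast
  from this[rule_format, OF _ part] have f: "tends_to_zero_in_prob M f"
    using T unfolding f_def[abs_def] by simp
  have "tends_to_zero_in_prob M (\<lambda>m. f (m - q))"
    unfolding tends_to_zero_in_prob_def
  proof (intro conjI allI impI)
    show "f (m - q) \<in> borel_measurable M" for m using f by (simp add: tends_to_zero_in_prob_def)
    fix e :: real assume "0 < e"
    then have "(\<lambda>m. measure M {\<omega> \<in> space M. ennreal e < f m \<omega>}) \<longlonglongrightarrow> 0"
      using f by (simp add: tends_to_zero_in_prob_def)
    then show "(\<lambda>m. measure M {\<omega> \<in> space M. ennreal e < f (m - q) \<omega>}) \<longlonglongrightarrow> 0"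
      by (intro LIMSEQ_offset[where k = q and f = "\<lambda>m. measure M {\<omega> \<in> space M. ennreal e < f (m - q) \<omega>}"]) simp
  qed
  then show ?thesis unfolding f_def .
qed

end

lemma tends_in_prob_constant:
  assumes "prob_space M" "tends_to_zero_in_prob M (\<lambda>_. f)"
  shows "AE \<omega> in M. f \<omega> = 0"
proof -
  obtain h where "AE \<omega> in M. \<forall>f'\<in>{\<lambda>_::nat. f}. (\<lambda>n. f' (h n :: nat) \<omega>) \<longlonglongrightarrow> 0"
    by (rule tends_in_prob_subseq[OF assms(1), of "{\<lambda>_. f}"]) (use assms(2) in auto)
  then show ?thesis by eventually_elim (simp add: LIMSEQ_const_iff)
qed

lemma ito_integral_at_0:
  assumes "prob_space M" "is_ito_integral M F W H I"
  shows "AE \<omega> in M. I 0 \<omega> = 0"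
proof -
  obtain n \<tau> \<xi> where si: "\<And>m. simple_integrand F (n m) (\<tau> m) (\<xi> m)"
    and conv: "tends_to_zero_in_prob M (\<lambda>m \<omega>. SUP s\<in>{0..0}. ennreal \<bar>simple_integral W (n m) (\<tau> m) (\<xi> m) s \<omega> - I s \<omega>\<bar>)"
    using assms(2) unfolding is_ito_integral_def by blast
  have "simple_integral W (n m) (\<tau> m) (\<xi> m) 0 \<omega> = 0" for m \<omega>
  proof -
    have "0 \<le> \<tau> m i" if "i \<le> n m" for i
      using si[of m] steps_mono[of "n m" "\<tau> m" 0 i] that by (simp add: simple_integrand_def)
    then show ?thesis by (auto simp: simple_integral_def min_absorb2 intro!: sum.neutral)
  qed
  then have "tends_to_zero_in_prob M (\<lambda>m \<omega>. ennreal \<bar>I 0 \<omega>\<bar>)" using conv by simp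
  from tends_in_prob_constant[OF assms(1) this] show ?thesis by eventually_elim simp
qed

lemma covariation_at_0:
  assumes "prob_space M" "is_quadratic_covariation M F Y Z C"
  shows "AE \<omega> in M. C 0 \<omega> = 0"
proof -
  have part: "partition_sequence 0 (\<lambda>_. 0) (\<lambda>_ _. 0)" by (simp add: partition_sequence_def)
  have "\<forall>t\<ge>0. \<forall>n \<tau>. partition_sequence t n \<tau> \<longrightarrow>
        tends_to_zero_in_prob M
          (\<lambda>m \<omega>. ennreal \<bar>(\<Sum>i<n m. (Y (\<tau> m (Suc i)) \<omega> - Y (\<tau> m i) \<omega>) *
                                      (Z (\<tau> m (Suc i)) \<omega> - Z (\<tau> m i) \<omega>)) - C t \<omega>\<bar>)"
    using assms(2) unfolding is_quadratic_covariation_def by blast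
  from this[rule_format, OF order_refl part]
  have "tends_to_zero_in_prob M (\<lambda>m \<omega>. ennreal \<bar>C 0 \<omega>\<bar>)" by simp
  from tends_in_prob_constant[OF assms(1) this] show ?thesis by eventually_elim simp
qed

lemma ennreal_square_tendsto_0:
  assumes "(\<lambda>n. ennreal ((f n :: real)\<^sup>2)) \<longlonglongrightarrow> 0"
  shows "f \<longlonglongrightarrow> 0"
proof -
  have "(\<lambda>n. (f n)\<^sup>2) \<longlonglongrightarrow> 0" using assms by (subst (asm) ennreal_tendsto_0_iff) auto
  from tendsto_real_sqrt[OF this] show ?thesis by (simp add: tendsto_rabs_zero_iff)
qed

lemma continuous_adapted_compose:
  fixes g :: "'b::topological_space \<Rightarrow> 'c::topological_space"
  assumes "continuous_adapted M F Z" "continuous_on UNIV g"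
  shows "continuous_adapted M F (\<lambda>t \<omega>. g (Z t \<omega>))"
  unfolding continuous_adapted_def
proof (intro conjI allI impI)
  fix t :: real assume "0 \<le> t"
  then have "Z t \<in> borel_measurable (F t)" using assms(1) unfolding continuous_adapted_def by blast
  then show "(\<lambda>\<omega>. g (Z t \<omega>)) \<in> borel_measurable (F t)"
    by (rule measurable_compose[OF _ borel_measurable_continuous_onI[OF assms(2)]])
next
  have "AE \<omega> in M. continuous_on {0..} (\<lambda>t. Z t \<omega>)" using assms(1) by (simp add: continuous_adapted_def)
  then show "AE \<omega> in M. continuous_on {0..} (\<lambda>t. g (Z t \<omega>))"
    by eventually_elim (rule continuous_on_compose2[OF assms(2)], auto)
qed

section \<open>From limits in probability to almost sure formulas for the solution\<close>

locale linear_stratonovich = independent_brownian_motions M F W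
  for M :: "'a measure" and F and W :: "'l::finite \<Rightarrow> real \<Rightarrow> 'a \<Rightarrow> real" +
  fixes A :: "real ^ 'd ^ 'd" and B :: "'l \<Rightarrow> real ^ 'd ^ 'd" and x :: "real ^ 'd"
    and X :: "real \<Rightarrow> 'a \<Rightarrow> real ^ 'd"
  assumes solution: "linear_stratonovich_solution M F W A B x X"
begin

lemma solution_continuous: "AE \<omega> in M. continuous_on {0..} (\<lambda>t. X t \<omega>)"
  using solution by (simp add: linear_stratonovich_solution_def continuous_adapted_def)

lemma W_continuous: "AE \<omega> in M. \<forall>j. continuous_on {0..} (\<lambda>t. W j t \<omega>)"
  using bm by (intro eventually_all_finite) (simp add: brownian_motion_def continuous_adapted_def)

lemma solution_integrals:
  obtains I C :: "'l \<Rightarrow> 'd \<Rightarrow> real \<Rightarrow> 'a \<Rightarrow> real"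
  where "\<And>j i. is_ito_integral M F (W j) (\<lambda>t \<omega>. (B j *v X t \<omega>) $ i) (I j i)"
    and "\<And>j i. is_quadratic_covariation M F (\<lambda>t \<omega>. (B j *v X t \<omega>) $ i) (W j) (C j i)"
    and "AE \<omega> in M. \<forall>t\<ge>0. X t \<omega> = x + integral {0..t} (\<lambda>s. A *v X s \<omega>) + (\<Sum>j\<in>UNIV. \<chi> i. I j i t \<omega> + C j i t \<omega> / 2)"
proof -
  obtain S :: "'l \<Rightarrow> real \<Rightarrow> 'a \<Rightarrow> real ^ 'd" where S: "\<And>j i. is_stratonovich_integral M F (W j)
                 (\<lambda>t \<omega>. (B j *v X t \<omega>) $ i) (\<lambda>t \<omega>. S j t \<omega> $ i)"
    and eq: "AE \<omega> in M. \<forall>t\<ge>0. X t \<omega> = x + integral {0..t} (\<lambda>s. A *v X s \<omega>) + (\<Sum>j\<in>UNIV. S j t \<omega>)"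
    using solution unfolding linear_stratonovich_solution_def by blast
  have "\<exists>IC. is_ito_integral M F (W j) (\<lambda>t \<omega>. (B j *v X t \<omega>) $ i) (fst IC) \<and>
      is_quadratic_covariation M F (\<lambda>t \<omega>. (B j *v X t \<omega>) $ i) (W j) (snd IC) \<and>
      (\<forall>t \<omega>. S j t \<omega> $ i = fst IC t \<omega> + 1/2 * snd IC t \<omega>)" for j i
    using S[of j i] unfolding is_stratonovich_integral_def by auto
  then obtain IC where IC: "\<And>j i. is_ito_integral M F (W j) (\<lambda>t \<omega>. (B j *v X t \<omega>) $ i) (fst (IC j i))"
      "\<And>j i. is_quadratic_covariation M F (\<lambda>t \<omega>. (B j *v X t \<omega>) $ i) (W j) (snd (IC j i))"
      "\<And>j i t \<omega>. S j t \<omega> $ i = fst (IC j i) t \<omega> + 1/2 * snd (IC j i) t \<omega>"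
    by metis
  have "S j t \<omega> = (\<chi> i. fst (IC j i) t \<omega> + snd (IC j i) t \<omega> / 2)" for j t \<omega>
    by (simp add: vec_eq_iff IC(3))
  then show ?thesis using that[of "\<lambda>j i. fst (IC j i)" "\<lambda>j i. snd (IC j i)"] IC eq by simp
qed

text \<open>At time 0 the equation leaves \<open>x\<close> plus the Ito integrals and covariations
  at 0. These are determined by limits in probability of sums that vanish there, so they are 0
  almost surely.\<close>

lemma initial_value: "AE \<omega> in M. X 0 \<omega> = x"
proof -
  obtain I C :: "'l \<Rightarrow> 'd \<Rightarrow> real \<Rightarrow> 'a \<Rightarrow> real" where I: "\<And>j i. is_ito_integral M F (W j) (\<lambda>t \<omega>. (B j *v X t \<omega>) $ i) (I j i)"
    and C: "\<And>j i. is_quadratic_covariation M F (\<lambda>t \<omega>. (B j *v X t \<omega>) $ i) (W j) (C j i)"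
    and eq: "AE \<omega> in M. \<forall>t\<ge>0. X t \<omega> = x + integral {0..t} (\<lambda>s. A *v X s \<omega>) + (\<Sum>j\<in>UNIV. \<chi> i. I j i t \<omega> + C j i t \<omega> / 2)"
    by (rule solution_integrals) (rule that)
  have "AE \<omega> in M. \<forall>j i. I j i 0 \<omega> = 0" "AE \<omega> in M. \<forall>j i. C j i 0 \<omega> = 0"
    by (intro eventually_all_finite ito_integral_at_0[OF prob_space_axioms I] covariation_at_0[OF prob_space_axioms C])+
  then show ?thesis using eq
  proof eventually_elim
    case (elim \<omega>)
    have "X 0 \<omega> = x + integral {0..0} (\<lambda>s. A *v X s \<omega>) + (\<Sum>j\<in>UNIV. \<chi> i. I j i 0 \<omega> + C j i 0 \<omega> / 2)"
      using elim(3) by blast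
    also have "\<dots> = x" using elim(1,2) by (simp add: vec_eq_iff)
    finally show ?case .
  qed
qed

text \<open>The hypotheses of the pathwise result are obtained almost surely along one common
  subsequence \<open>h\<close>, apart from the bound on the quadratic variation, which comes from
  Fatou's lemma. The exceptional null set may depend on the fixed time \<open>T\<close>.\<close>

theorem coordinate_formula:
  fixes u :: "complex ^ 'd" and \<kappa> :: complex and \<mu> :: "'l \<Rightarrow> complex"
  assumes u: "conj_transpose (cmat A) *v u = \<kappa> *s u" "\<And>j. conj_transpose (cmat (B j)) *v u = \<mu> j *s u"
    and T: "0 < T"
  shows "AE \<omega> in M. cinner (cvec (X T \<omega>)) u =
    cinner (cvec (X 0 \<omega>)) u * exp (cnj \<kappa> * of_real T + (\<Sum>j\<in>UNIV. cnj (\<mu> j) * of_real (W j T \<omega> - W j 0 \<omega>)))"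
proof -
  obtain I C :: "'l \<Rightarrow> 'd \<Rightarrow> real \<Rightarrow> 'a \<Rightarrow> real" where I: "\<And>j i. is_ito_integral M F (W j) (\<lambda>t \<omega>. (B j *v X t \<omega>) $ i) (I j i)"
    and C: "\<And>j i. is_quadratic_covariation M F (\<lambda>t \<omega>. (B j *v X t \<omega>) $ i) (W j) (C j i)"
    and eq: "AE \<omega> in M. \<forall>t\<ge>0. X t \<omega> = x + integral {0..t} (\<lambda>s. A *v X s \<omega>) + (\<Sum>j\<in>UNIV. \<chi> i. I j i t \<omega> + C j i t \<omega> / 2)"
    by (rule solution_integrals) (rule that)
  let ?dI = "\<lambda>j i n l \<omega>. I j i (dyadic T n (Suc l)) \<omega> - I j i (dyadic T n l) \<omega>"
  let ?dW = "\<lambda>j n l \<omega>. W j (dyadic T n (Suc l)) \<omega> - W j (dyadic T n l) \<omega>"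
  define Z where "Z t \<omega> = exp (- (cnj \<kappa> * of_real t + (\<Sum>j\<in>UNIV. cnj (\<mu> j) * of_real (W j t \<omega> - W j 0 \<omega>))))" for t \<omega>
  have Zad: "continuous_adapted M F Z"
    unfolding continuous_adapted_def
  proof (intro conjI allI impI)
    fix t :: real assume t: "0 \<le> t"
    have [measurable]: "W j t \<in> borel_measurable (F t)" "W j 0 \<in> borel_measurable (F t)" for j
    proof -
      interpret filtered_brownian_motion M F "W j" by (rule bm_locale)
      show "W j t \<in> borel_measurable (F t)" using t by (rule W_adapted)
      show "W j 0 \<in> borel_measurable (F t)" using t by (intro F_measurable_mono[OF W_adapted]) auto
    qed
    show "Z t \<in> borel_measurable (F t)" unfolding Z_def by measurable
  next
    show "AE \<omega> in M. continuous_on {0..} (\<lambda>t. Z t \<omega>)"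
      using W_continuous
    proof eventually_elim
      case (elim \<omega>)
      then show ?case unfolding Z_def by (intro continuous_intros) auto
    qed
  qed
  \<comment> \<open>Weights in the Riemann sums are real processes, so the complex \<open>Z\<close>
    is used through its two parts.\<close>
  have Re_ad: "continuous_adapted M F (\<lambda>t \<omega>. Re (Z t \<omega>))" and Im_ad: "continuous_adapted M F (\<lambda>t \<omega>. Im (Z t \<omega>))"
    by (intro continuous_adapted_compose[OF Zad] continuous_intros)+
  define H where "H j i t \<omega> = (B j *v X t \<omega>) $ i" for j i t \<omega>
  define e where "e j i m l \<omega> = ?dI j i m l \<omega>
    - H j i (dyadic T m l) \<omega> * (?dW j m l \<omega>)" for j i m l \<omega>
  define f1 where "f1 p = (\<lambda>m \<omega>. ennreal ((\<Sum>l<2^m. Re (Z (dyadic T m l) \<omega>) * e (fst p) (snd p) m l \<omega>)\<^sup>2))" for p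
  define f2 where "f2 p = (\<lambda>m \<omega>. ennreal ((\<Sum>l<2^m. Im (Z (dyadic T m l) \<omega>) * e (fst p) (snd p) m l \<omega>)\<^sup>2))" for p
  define f3 where "f3 p = (\<lambda>m \<omega>. ennreal (\<Sum>l<2^m. (e (fst p) (snd p) m l \<omega>)\<^sup>2))" for p
  define f4 where "f4 p qr = (\<lambda>m \<omega>. ennreal \<bar>(\<Sum>l<snd qr * 2 ^ (m - fst qr).
     (H (fst p) (snd p) (dyadic T (m - fst qr + fst qr) (Suc l)) \<omega> - H (fst p) (snd p) (dyadic T (m - fst qr + fst qr) l) \<omega>) *
     (?dW (fst p) (m - fst qr + fst qr) l \<omega>))
       - C (fst p) (snd p) (T * real (snd qr) / 2 ^ fst qr) \<omega>\<bar>)" for p and qr :: "nat \<times> nat"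
  \<comment> \<open>The covariations are included at all dyadic multiples of \<open>T\<close>; the
    family stays countable.\<close>
  define \<Z> where "\<Z> = range f1 \<union> range f2 \<union> range f3 \<union> (\<Union>p. range (f4 p))"
  have "countable \<Z>" unfolding \<Z>_def by (intro countable_Un countable_UN countable_image) auto
  moreover have "tends_to_zero_in_prob M f" if "f \<in> \<Z>" for f
    using that unfolding \<Z>_def
  proof (elim UnE UN_E rangeE)
    fix p assume f: "f = f1 p"
    show ?thesis unfolding f f1_def e_def H_def
      by (rule filtered_brownian_motion.ito_riemann_sum[OF bm_locale I Re_ad T])
  next
    fix p assume f: "f = f2 p"
    show ?thesis unfolding f f2_def e_def H_def
      by (rule filtered_brownian_motion.ito_riemann_sum[OF bm_locale I Im_ad T])
  next
    fix p assume f: "f = f3 p"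
    show ?thesis unfolding f f3_def e_def H_def
      by (rule filtered_brownian_motion.ito_riemann_sum_squares[OF bm_locale I T])
  next
    fix p qr assume f: "f = f4 p qr"
    show ?thesis unfolding f f4_def H_def
      by (rule filtered_brownian_motion.covariation_dyadic[OF bm_locale C T])
  qed
  ultimately obtain h where h: "strict_mono h" "AE \<omega> in M. \<forall>f\<in>\<Z>. (\<lambda>n. f (h n) \<omega>) \<longlonglongrightarrow> 0"
    by (rule tends_in_prob_subseq[OF prob_space_axioms]) blast
  \<comment> \<open>The expectation of these sums is the same on every level. Fatou's lemma makes
    their lower limit along \<open>h\<close> almost surely finite, that is, the sums are bounded at
    infinitely many of the levels.\<close>
  define Q where "Q m \<omega> = (\<Sum>j\<in>UNIV. \<Sum>l<2^m. (?dW j m l \<omega>)\<^sup>2)" for m \<omega>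
  have W [measurable]: "W j (dyadic T m l) \<in> borel_measurable M" for j m l
    using T by (intro filtered_brownian_motion.W_measurable[OF bm_locale]) (simp add: dyadic_def)
  have [measurable]: "Q m \<in> borel_measurable M" for m unfolding Q_def by measurable
  have EQ: "(\<integral>\<^sup>+\<omega>. ennreal (Q m \<omega>) \<partial>M) = ennreal (CARD('l) * T)" for m
  proof -
    have "(\<integral>\<^sup>+\<omega>. ennreal (Q m \<omega>) \<partial>M) =
      (\<integral>\<^sup>+\<omega>. (\<Sum>j\<in>UNIV. ennreal (\<Sum>l<2^m. (?dW j m l \<omega>)\<^sup>2)) \<partial>M)"
      unfolding Q_def by (intro nn_integral_cong sum_ennreal[symmetric]) (auto intro: sum_nonneg)
    also have "\<dots> = (\<Sum>j\<in>(UNIV::'l set). ennreal T)"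
    proof (subst nn_integral_sum)
      show "(\<Sum>j\<in>UNIV. \<integral>\<^sup>+\<omega>. ennreal (\<Sum>l<2^m. (?dW j m l \<omega>)\<^sup>2) \<partial>M) = (\<Sum>j\<in>(UNIV::'l set). ennreal T)"
        using T by (intro sum.cong refl filtered_brownian_motion.quadratic_variation_expectation[OF bm_locale]) simp
    qed measurable
    finally show ?thesis using T by (simp add: ennreal_of_nat_eq_real_of_nat ennreal_mult)
  qed
  have "(\<integral>\<^sup>+\<omega>. liminf (\<lambda>n. ennreal (Q (h n) \<omega>)) \<partial>M) \<le> liminf (\<lambda>n. \<integral>\<^sup>+\<omega>. ennreal (Q (h n) \<omega>) \<partial>M)"
    by (rule nn_integral_liminf) measurable
  also have "\<dots> = ennreal (CARD('l) * T)" unfolding EQ by (simp add: Liminf_const)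
  finally have "(\<integral>\<^sup>+\<omega>. liminf (\<lambda>n. ennreal (Q (h n) \<omega>)) \<partial>M) \<noteq> \<infinity>"
    by (metis ennreal_neq_top infinity_ennreal_def neq_top_trans)
  then have "AE \<omega> in M. liminf (\<lambda>n. ennreal (Q (h n) \<omega>)) \<noteq> \<infinity>"
    by (intro nn_integral_PInf_AE) measurable
  then have quad: "AE \<omega> in M. \<exists>K. \<exists>\<^sub>F n in sequentially. Q (h n) \<omega> \<le> K"
  proof eventually_elim
    case (elim \<omega>)
    show ?case
    proof (rule ccontr)
      assume "\<nexists>K. \<exists>\<^sub>F n in sequentially. Q (h n) \<omega> \<le> K"
      then have *: "\<forall>\<^sub>F n in sequentially. real k < Q (h n) \<omega>" for k :: nat
        by (auto simp: not_frequently not_le)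
      obtain k :: nat where k: "liminf (\<lambda>n. ennreal (Q (h n) \<omega>)) < of_nat k"
        using elim ennreal_Ex_less_of_nat[of "liminf (\<lambda>n. ennreal (Q (h n) \<omega>))"] by (auto simp: top.not_eq_extremum)
      have "\<forall>\<^sub>F n in sequentially. of_nat k \<le> ennreal (Q (h n) \<omega>)"
        using *[of k] by eventually_elim (simp add: ennreal_of_nat_eq_real_of_nat ennreal_leI)
      then have "of_nat k \<le> liminf (\<lambda>n. ennreal (Q (h n) \<omega>))" by (rule Liminf_bounded)
      with k show False by simp
    qed
  qed
  have contC: "AE \<omega> in M. \<forall>j i. continuous_on {0..} (\<lambda>t. C j i t \<omega>) \<and> finite_variation (\<lambda>t. C j i t \<omega>)"
    using C by (intro eventually_all_finite) (simp add: is_quadratic_covariation_def continuous_adapted_def)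
  show ?thesis
    using solution_continuous W_continuous eq h(2) quad contC
  proof eventually_elim
    case (elim \<omega>)
    have lims: "(\<lambda>n. f1 p (h n) \<omega>) \<longlonglongrightarrow> 0" "(\<lambda>n. f2 p (h n) \<omega>) \<longlonglongrightarrow> 0" "(\<lambda>n. f3 p (h n) \<omega>) \<longlonglongrightarrow> 0"
      "(\<lambda>n. f4 p qr (h n) \<omega>) \<longlonglongrightarrow> 0" for p qr
    proof -
      have "f1 p \<in> \<Z>" "f2 p \<in> \<Z>" "f3 p \<in> \<Z>" "f4 p qr \<in> \<Z>" unfolding \<Z>_def by blast+
      then show "(\<lambda>n. f1 p (h n) \<omega>) \<longlonglongrightarrow> 0" "(\<lambda>n. f2 p (h n) \<omega>) \<longlonglongrightarrow> 0" "(\<lambda>n. f3 p (h n) \<omega>) \<longlonglongrightarrow> 0"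
        "(\<lambda>n. f4 p qr (h n) \<omega>) \<longlonglongrightarrow> 0" using elim(4) by blast+
    qed
    have "exp (- (cnj \<kappa> * of_real T + (\<Sum>j\<in>UNIV. cnj (\<mu> j) * of_real (W j T \<omega> - W j 0 \<omega>)))) * cinner (cvec (X T \<omega>)) u = cinner (cvec (X 0 \<omega>)) u"
    proof (rule stratonovich_system_pathwise[where h = h and w = "\<lambda>j t. W j t \<omega>" and X = "\<lambda>t. X t \<omega>"
          and I = "\<lambda>j i t. I j i t \<omega>" and C = "\<lambda>j i t. C j i t \<omega>" and A = A and B = B and x = x, OF T h(1) u])
      have sub: "{0..T} \<subseteq> {0..}" by auto
      show "continuous_on {0..T} (\<lambda>t. X t \<omega>)" by (rule continuous_on_subset[OF elim(1) sub])
      show "continuous_on {0..T} (\<lambda>t. W j t \<omega>)" for j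
        by (rule continuous_on_subset[OF _ sub]) (use elim(2) in blast)
      show "continuous_on {0..T} (\<lambda>t. C j i t \<omega>)" for j i
        by (rule continuous_on_subset[OF _ sub]) (use elim(6) in blast)
      show "finite_variation (\<lambda>t. C j i t \<omega>)" for j i using elim(6) by blast
      show "X t \<omega> = x + integral {0..t} (\<lambda>s. A *v X s \<omega>) + (\<Sum>j\<in>UNIV. \<chi> i. I j i t \<omega> + C j i t \<omega> / 2)" if "t \<in> {0..T}" for t
        using elim(3) that by auto
      show "\<exists>K. \<exists>\<^sub>F n in sequentially. (\<Sum>j\<in>UNIV. \<Sum>l<2 ^ h n. (?dW j (h n) l \<omega>)\<^sup>2) \<le> K"
        using elim(5) unfolding Q_def .
      fix j i
      show "(\<lambda>n. \<Sum>l<2 ^ h n. Re (exp (- (cnj \<kappa> * of_real (dyadic T (h n) l) + (\<Sum>j\<in>UNIV. cnj (\<mu> j) * of_real (W j (dyadic T (h n) l) \<omega> - W j 0 \<omega>))))) *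
          (?dI j i (h n) l \<omega>
      - (B j *v X (dyadic T (h n) l) \<omega>) $ i * (?dW j (h n) l \<omega>))) \<longlonglongrightarrow> 0"
        using ennreal_square_tendsto_0[OF lims(1)[of "(j, i)", unfolded f1_def]] unfolding e_def H_def Z_def by simp
      show "(\<lambda>n. \<Sum>l<2 ^ h n. Im (exp (- (cnj \<kappa> * of_real (dyadic T (h n) l) + (\<Sum>j\<in>UNIV. cnj (\<mu> j) * of_real (W j (dyadic T (h n) l) \<omega> - W j 0 \<omega>))))) *
          (?dI j i (h n) l \<omega>
      - (B j *v X (dyadic T (h n) l) \<omega>) $ i * (?dW j (h n) l \<omega>))) \<longlonglongrightarrow> 0"
        using ennreal_square_tendsto_0[OF lims(2)[of "(j, i)", unfolded f2_def]] unfolding e_def H_def Z_def by simp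
      show "(\<lambda>n. \<Sum>l<2 ^ h n. (?dI j i (h n) l \<omega>
      - (B j *v X (dyadic T (h n) l) \<omega>) $ i * (?dW j (h n) l \<omega>))\<^sup>2) \<longlonglongrightarrow> 0"
        using lims(3)[of "(j, i)"] unfolding f3_def e_def H_def
        by (subst (asm) ennreal_tendsto_0_iff) (auto intro: sum_nonneg)
      fix q r :: nat assume "r \<le> 2 ^ q"
      have "(\<lambda>n. f4 (j, i) (q, r) (h n) \<omega>) \<longlonglongrightarrow> 0" by (rule lims(4))
      then have "(\<lambda>n. (\<Sum>l<r * 2 ^ (h n - q). (H j i (dyadic T (h n - q + q) (Suc l)) \<omega> - H j i (dyadic T (h n - q + q) l) \<omega>) *
         (?dW j (h n - q + q) l \<omega>)) - C j i (T * real r / 2 ^ q) \<omega>) \<longlonglongrightarrow> 0"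
        unfolding f4_def by (subst (asm) ennreal_tendsto_0_iff) (simp_all add: tendsto_rabs_zero_iff)
      then have "(\<lambda>n. \<Sum>l<r * 2 ^ (h n - q). (H j i (dyadic T (h n - q + q) (Suc l)) \<omega> - H j i (dyadic T (h n - q + q) l) \<omega>) *
         (?dW j (h n - q + q) l \<omega>)) \<longlonglongrightarrow> C j i (T * real r / 2 ^ q) \<omega>"
        by (rule LIM_zero_cancel)
      \<comment> \<open>From here on the truncated difference is exact, so
        \<open>h n - q + q\<close> is \<open>h n\<close>.\<close>
      moreover have "\<forall>\<^sub>F n in sequentially. q \<le> h n"
        using h(1) by (intro eventually_sequentiallyI[of q]) (meson order_trans strict_mono_imp_increasing)
      then have "\<forall>\<^sub>F n in sequentially. (\<Sum>l<r * 2 ^ (h n - q). (H j i (dyadic T (h n - q + q) (Suc l)) \<omega> - H j i (dyadic T (h n - q + q) l) \<omega>) *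
         (?dW j (h n - q + q) l \<omega>)) =
        (\<Sum>l<r * 2 ^ (h n - q). ((B j *v X (dyadic T (h n) (Suc l)) \<omega>) $ i - (B j *v X (dyadic T (h n) l) \<omega>) $ i) *
         (?dW j (h n) l \<omega>))"
        by eventually_elim (simp add: H_def)
      ultimately show "(\<lambda>n. \<Sum>l<r * 2 ^ (h n - q). ((B j *v X (dyadic T (h n) (Suc l)) \<omega>) $ i - (B j *v X (dyadic T (h n) l) \<omega>) $ i) *
         (?dW j (h n) l \<omega>)) \<longlonglongrightarrow> C j i (T * real r / 2 ^ q) \<omega>"
        by (rule Lim_transform_eventually)
    qed
    moreover have "y = z * exp a" if "exp (- a) * y = z" for y z a :: complex
      using that by (auto simp: exp_minus)
    ultimately show ?case by blast
  qed
qed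

end

section \<open>The probability bound\<close>

lemma cinner_sum_left: "cinner (\<Sum>k\<in>S. a k *s v k) w = (\<Sum>k\<in>S. a k * cinner (v k) w)"
proof -
  have "cinner (\<Sum>k\<in>S. a k *s v k) w = (\<Sum>i\<in>UNIV. \<Sum>k\<in>S. a k * (v k $ i * cnj (w $ i)))"
    by (simp add: cinner_def sum_distrib_right mult.assoc)
  also have "\<dots> = (\<Sum>k\<in>S. a k * cinner (v k) w)"
    by (subst sum.swap) (simp add: cinner_def sum_distrib_left)
  finally show ?thesis .
qed

lemma cinner_commute: "cinner z w = cnj (cinner w z)"
  by (simp add: cinner_def mult.commute)

text \<open>The coefficients of \<open>cvec y\<close> in the basis are its inner products with the
  basis vectors. Expanding only the first argument of its inner product with itself leaves each
  coefficient times its own conjugate.\<close>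

lemma parseval:
  assumes "orthonormal_basis v"
  shows "(\<Sum>k\<in>UNIV. (cmod (cinner (cvec y) (v k)))\<^sup>2) = (norm y)\<^sup>2"
proof -
  let ?z = "cvec y"
  have on: "cinner (v k) (v l) = (if k = l then 1 else 0)" for k l
    using assms by (simp add: orthonormal_basis_def)
  have inj: "inj v"
    using on by (metis injI zero_neq_one)
  have "?z \<in> vec.span (range v)" using assms by (simp add: orthonormal_basis_def)
  then obtain b where "?z = (\<Sum>w\<in>range v. b w *s w)" by (auto simp: vec.span_finite)
  then have z: "?z = (\<Sum>k\<in>UNIV. b (v k) *s v k)" using inj by (simp add: sum.reindex)
  have coeff: "cinner ?z (v k) = b (v k)" for k
    by (subst z) (simp add: cinner_sum_left on if_distrib cong: if_cong)
  have "cinner ?z ?z = (\<Sum>k\<in>UNIV. b (v k) * cinner (v k) ?z)"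
    by (subst z) (rule cinner_sum_left)
  also have "\<dots> = (\<Sum>k\<in>UNIV. of_real ((cmod (cinner ?z (v k)))\<^sup>2))"
    by (intro sum.cong refl) (simp add: cinner_commute[of _ ?z] coeff complex_norm_square[symmetric] del: of_real_power)
  finally have "cinner ?z ?z = of_real (\<Sum>k\<in>UNIV. (cmod (cinner ?z (v k)))\<^sup>2)" by (simp del: of_real_power)
  moreover have "cinner ?z ?z = of_real ((norm y)\<^sup>2)"
    unfolding power2_norm_eq_inner by (simp add: cinner_def cvec_def inner_vec_def)
  ultimately show ?thesis using of_real_eq_iff by metis
qed

section \<open>The norm of the solution as an exponential mixture\<close>

context linear_stratonovich begin

text \<open>Parseval's identity at time \<open>t\<close>: imaginary parts of the exponents only
  rotate the coordinates, so the squared moduli retain twice the real parts.\<close>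

lemma norm_solution:
  assumes v: "orthonormal_basis v"
    and eig: "\<And>k. conj_transpose (cmat A) *v v k = \<kappa> k *s v k" "\<And>k j. conj_transpose (cmat (B j)) *v v k = \<mu> k j *s v k"
    and t: "0 \<le> t"
  shows "AE \<omega> in M. (norm (X t \<omega>))\<^sup>2 = (\<Sum>k\<in>UNIV. (cmod (cinner (cvec x) (v k)))\<^sup>2 *
    exp (2 * Re (\<kappa> k) * t + (\<Sum>j\<in>UNIV. 2 * Re (\<mu> k j) * (W j t \<omega> - W j 0 \<omega>))))"
proof -
  have "AE \<omega> in M. \<forall>k. cinner (cvec (X t \<omega>)) (v k) =
    cinner (cvec (X 0 \<omega>)) (v k) * exp (cnj (\<kappa> k) * of_real t + (\<Sum>j\<in>UNIV. cnj (\<mu> k j) * of_real (W j t \<omega> - W j 0 \<omega>)))"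
  proof (cases "t = 0")
    case False
    then show ?thesis using t by (intro eventually_all_finite coordinate_formula eig) simp
  qed simp
  then show ?thesis using initial_value
  proof eventually_elim
    case (elim \<omega>)
    have "(cmod (cinner (cvec (X t \<omega>)) (v k)))\<^sup>2 = (cmod (cinner (cvec x) (v k)))\<^sup>2 *
      exp (2 * Re (\<kappa> k) * t + (\<Sum>j\<in>UNIV. 2 * Re (\<mu> k j) * (W j t \<omega> - W j 0 \<omega>)))" for k
    proof -
      let ?r = "Re (\<kappa> k) * t + (\<Sum>j\<in>UNIV. Re (\<mu> k j) * (W j t \<omega> - W j 0 \<omega>))"
      have "cmod (cinner (cvec (X t \<omega>)) (v k)) = cmod (cinner (cvec x) (v k)) * exp ?r"
        using elim by (simp add: norm_mult norm_exp_eq_Re)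
      moreover have "(exp ?r)\<^sup>2 = exp (2 * Re (\<kappa> k) * t + (\<Sum>j\<in>UNIV. 2 * Re (\<mu> k j) * (W j t \<omega> - W j 0 \<omega>)))"
        by (simp add: exp_double[symmetric] distrib_left sum_distrib_left mult.assoc)
      ultimately show ?thesis by (simp add: power_mult_distrib)
    qed
    then show ?case unfolding parseval[OF v, symmetric] by simp
  qed
qed

text \<open>The formula for the norm holds almost surely at each fixed time, hence at the countably
  many dyadic points of the interval simultaneously. By continuity of the path, a norm strictly
  above \<open>c\<close> somewhere forces one strictly above \<open>c\<close> at such a point, so
  the supremum is covered by the dyadic maximal inequality.\<close>

theorem sup_norm_bound:
  assumes v: "orthonormal_basis v"
    and eig: "\<And>k. conj_transpose (cmat A) *v v k = \<kappa> k *s v k" "\<And>k j. conj_transpose (cmat (B j)) *v v k = \<mu> k j *s v k"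
    and decay: "\<And>k. Re (\<kappa> k) + (\<Sum>j\<in>UNIV. (Re (\<mu> k j))\<^sup>2) \<le> 0"
    and s: "0 \<le> s" "s < s'" and c: "0 < c"
  shows "measure M {\<omega> \<in> space M. c < (SUP t\<in>{s..s'}. norm (X t \<omega>))} \<le>
    (\<Sum>k\<in>UNIV. (cmod (cinner (cvec x) (v k)))\<^sup>2 * exp (2 * (Re (\<kappa> k) + (\<Sum>j\<in>UNIV. (Re (\<mu> k j))\<^sup>2)) * s)) / c\<^sup>2"
proof -
  define d where "d = s' - s"
  have d: "0 < d" using s by (simp add: d_def)
  \<comment> \<open>All coefficients are doubled because the norm is squared. As (2 b)^2 / 2 = 2
    b^2, the condition on the mixture is twice the assumption \<open>decay\<close>.\<close>
  interpret mix: exponential_mixture M F W "\<lambda>k. (cmod (cinner (cvec x) (v k)))\<^sup>2" "\<lambda>k. 2 * Re (\<kappa> k)" "\<lambda>k j. 2 * Re (\<mu> k j)"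
  proof
    show "2 * Re (\<kappa> k) + (\<Sum>j\<in>UNIV. (2 * Re (\<mu> k j))\<^sup>2) / 2 \<le> 0" for k
      using decay[of k] by (simp add: power_mult_distrib sum_distrib_left[symmetric])
  qed simp
  have dy: "0 \<le> s + dyadic d n i" for n i using s d by (simp add: dyadic_def)
  define E where "E = (\<Union>n. {\<omega> \<in> space M. \<exists>i\<le>2^n. c\<^sup>2 < mix.mix (s + dyadic d n i) \<omega>})"
  have [measurable]: "mix.mix (s + dyadic d n i) \<in> borel_measurable M" for n i using dy by (rule mix.mix_measurable_M)
  have EM: "E \<in> sets M" unfolding E_def by measurable
  have mixeq: "AE \<omega> in M. \<forall>n i. (norm (X (s + dyadic d n i) \<omega>))\<^sup>2 = mix.mix (s + dyadic d n i) \<omega>"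
    unfolding AE_all_countable mix.mix_def mix.summand_def
    using norm_solution[OF v eig dy] by blast
  have "measure M {\<omega> \<in> space M. c < (SUP t\<in>{s..s'}. norm (X t \<omega>))} \<le> measure M E"
  proof (rule finite_measure_mono_AE[OF _ EM])
    show "AE \<omega> in M. \<omega> \<in> {\<omega> \<in> space M. c < (SUP t\<in>{s..s'}. norm (X t \<omega>))} \<longrightarrow> \<omega> \<in> E"
      using mixeq solution_continuous
    proof eventually_elim
      case (elim \<omega>)
      show ?case
      proof
        assume \<omega>: "\<omega> \<in> {\<omega> \<in> space M. c < (SUP t\<in>{s..s'}. norm (X t \<omega>))}"
        \<comment> \<open>Otherwise \<open>c\<close> would be an upper bound of the norms and hence
          of their supremum.\<close>
        then obtain t where t: "t \<in> {s..s'}" "c < norm (X t \<omega>)"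
          using cSUP_least[of "{s..s'}" "\<lambda>t. norm (X t \<omega>)" c] s by (force simp: not_less[symmetric])
        have "continuous_on {s..s'} (\<lambda>t. norm (X t \<omega>))"
          using elim(2) s by (intro continuous_on_norm) (auto intro: continuous_on_subset)
        then obtain \<delta> where \<delta>: "0 < \<delta>" "\<And>u. u \<in> {s..s'} \<Longrightarrow> dist u t < \<delta> \<Longrightarrow> dist (norm (X u \<omega>)) (norm (X t \<omega>)) < norm (X t \<omega>) - c"
          using t unfolding continuous_on_iff by (metis diff_gt_0_iff_gt)
        obtain n where n: "d / 2 ^ n < \<delta>"
        proof -
          obtain n where "(1/2) ^ n < \<delta> / d" using \<delta> d real_arch_pow_inv[of "\<delta> / d" "1/2"] by auto
          then have "d / 2 ^ n < \<delta>" using d by (simp add: field_simps power_divide)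
          then show ?thesis using that by blast
        qed
        \<comment> \<open>The index of the last grid point not after \<open>t\<close>; its distance
          to \<open>t\<close> is less than \<open>d / 2 ^ n\<close>.\<close>
        define i where "i = nat \<lfloor>(t - s) * 2 ^ n / d\<rfloor>"
        have nn: "0 \<le> (t - s) * 2 ^ n / d" using t d by simp
        then have i: "real i \<le> (t - s) * 2 ^ n / d" "(t - s) * 2 ^ n / d < real i + 1"
          unfolding i_def by (simp_all add: of_nat_nat)
        have lo: "dyadic d n i \<le> t - s" using i(1) d by (simp add: dyadic_def field_simps)
        have hi: "t - s < dyadic d n i + d / 2 ^ n" using i(2) d by (simp add: dyadic_def field_simps)
        have "(t - s) * 2 ^ n / d \<le> 2 ^ n" using t d by (simp add: d_def field_simps)
        then have "real i \<le> 2 ^ n" using i(1) by linarith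
        then have i2: "i \<le> 2 ^ n" by (metis of_nat_le_iff of_nat_numeral of_nat_power)
        have "0 \<le> dyadic d n i" using d by (simp add: dyadic_def)
        then have "s + dyadic d n i \<in> {s..s'}" "dist (s + dyadic d n i) t < \<delta>"
          using lo hi n t by (auto simp: dist_real_def)
        from \<delta>(2)[OF this] have "c < norm (X (s + dyadic d n i) \<omega>)" by (auto simp: dist_real_def abs_if split: if_splits)
        then have "c\<^sup>2 < mix.mix (s + dyadic d n i) \<omega>"
          using c elim(1) power_strict_mono[of c "norm (X (s + dyadic d n i) \<omega>)" 2] by simp
        then show "\<omega> \<in> E" using \<omega> i2 by (auto simp: E_def)
      qed
    qed
  qed
  also have "\<dots> \<le> (\<Sum>k\<in>UNIV. (cmod (cinner (cvec x) (v k)))\<^sup>2 * exp ((2 * Re (\<kappa> k) + (\<Sum>j\<in>UNIV. (2 * Re (\<mu> k j))\<^sup>2) / 2) * s)) / c\<^sup>2"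
    unfolding E_def using s d c by (intro mix.mix_dyadic_maximal_inequality) auto
  also have "(\<lambda>k. 2 * Re (\<kappa> k) + (\<Sum>j\<in>UNIV. (2 * Re (\<mu> k j))\<^sup>2) / 2) = (\<lambda>k. 2 * (Re (\<kappa> k) + (\<Sum>j\<in>UNIV. (Re (\<mu> k j))\<^sup>2)))"
    by (simp add: power_mult_distrib sum_distrib_left[symmetric] distrib_left)
  finally show ?thesis .
qed

end

theorem proposition2p22:
  fixes M :: "'a measure"
    and F :: "real \<Rightarrow> 'a measure"
    and W :: "'l::finite \<Rightarrow> real \<Rightarrow> 'a \<Rightarrow> real"
    and A :: "real ^ 'd ^ 'd"
    and B :: "'l \<Rightarrow> real ^ 'd ^ 'd"
    and X :: "real ^ 'd \<Rightarrow> real \<Rightarrow> 'a \<Rightarrow> real ^ 'd"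
    and v :: "'d \<Rightarrow> complex ^ 'd"
    and lam lamt :: "'d \<Rightarrow> complex"
    and mu :: "'d \<Rightarrow> 'l \<Rightarrow> complex"
    and s eps :: "nat \<Rightarrow> real"
    and x :: "real ^ 'd"
    and p :: real
  assumes "usual_conditions M F"
    and "\<And>j. brownian_motion M F (W j)"
    and "independent_processes M W"
    and "\<And>y. linear_stratonovich_solution M F W A B y (X y)"
    and "simultaneously_unitarily_diagonalizable (insert (cmat A) (range (\<lambda>j. cmat (B j))))"
    and "orthonormal_basis v"
    and "\<And>k. conj_transpose (cmat A) *v v k = lam k *s v k"
    and "\<And>k j. conj_transpose (cmat (B j)) *v v k = mu k j *s v k"
    and "\<And>k. lamt k = lam k + 1/2 * (\<Sum>j\<in>UNIV. (mu k j)\<^sup>2)"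
    and "(MAX k. Re (lam k) + (\<Sum>j\<in>UNIV. (Re (mu k j))\<^sup>2)) < 0"
    and "\<And>n. 0 < s n" and "strict_mono s" and "filterlim s at_top sequentially"
    and "\<And>n. 0 < eps n" and "decseq eps"
    and "x \<noteq> 0" and "1 < p"
  shows
    "(\<forall>n. measure M {\<omega> \<in> space M. (SUP t\<in>{s n..s (Suc n)}. norm (X x t \<omega>)) > eps n * norm x}
        \<le> 1 / ((eps n)\<^sup>2 * (norm x)\<^sup>2) * (p / (p - 1)) powr p
          * exp (2 * (p\<^sup>2 - p) * (s (Suc n) - s n) * (MAX k. \<Sum>j\<in>UNIV. (Re (mu k j))\<^sup>2))
          * (\<Sum>k\<in>UNIV. (cmod (cinner (cvec x) (v k)))\<^sup>2
               * exp ((2 * Re (lamt k) + (\<Sum>j\<in>UNIV. (cmod (mu k j))\<^sup>2)) * s n))) \<and>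
     (let Lx = (MAX k\<in>{k. cinner (cvec x) (v k) \<noteq> 0}. Re (lam k) + (\<Sum>j\<in>UNIV. (Re (mu k j))\<^sup>2))
      in Lx < 0 \<and>
         (\<forall>n. measure M {\<omega> \<in> space M. (SUP t\<in>{s n..s (Suc n)}. norm (X x t \<omega>)) > eps n * norm x}
            \<le> exp (2 * Lx * s n) / (eps n)\<^sup>2 * (p / (p - 1)) powr p
              * exp (2 * (p\<^sup>2 - p) * (s (Suc n) - s n) * (MAX k. \<Sum>j\<in>UNIV. (Re (mu k j))\<^sup>2))))"
proof -
  have "prob_space M" using assms(1) by (simp add: usual_conditions_def)
  interpret linear_stratonovich M F W A B x "X x"
    using \<open>prob_space M\<close> assms(1-4)
    by (simp add: linear_stratonovich_def independent_brownian_motions_def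
        independent_brownian_motions_axioms_def linear_stratonovich_axioms_def)
  define c where "c k = (cmod (cinner (cvec x) (v k)))\<^sup>2" for k
  define \<theta> where "\<theta> k = Re (lam k) + (\<Sum>j\<in>UNIV. (Re (mu k j))\<^sup>2)" for k
  define D where "D n = (p / (p - 1)) powr p * exp (2 * (p\<^sup>2 - p) * (s (Suc n) - s n) * (MAX k. \<Sum>j\<in>UNIV. (Re (mu k j))\<^sup>2))" for n
  have \<theta>_neg: "\<theta> k < 0" for k
    using assms(10) by (auto simp: \<theta>_def Max_less_iff)
  \<comment> \<open>The real part of a square is (Re)^2 - (Im)^2 and the squared modulus is (Re)^2 +
    (Im)^2, so the imaginary parts of \<open>mu k j\<close> cancel and the exponent of the claim is
    the growth rate of the mixture.\<close>
  have exponent: "2 * Re (lamt k) + (\<Sum>j\<in>UNIV. (cmod (mu k j))\<^sup>2) = 2 * \<theta> k" for k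
  proof -
    have "2 * Re (lamt k) = 2 * Re (lam k) + (\<Sum>j\<in>UNIV. (Re (mu k j))\<^sup>2 - (Im (mu k j))\<^sup>2)"
      unfolding assms(9) by (simp add: Re_power2)
    then show ?thesis
      by (simp add: \<theta>_def cmod_power2 sum.distrib sum_subtractf)
  qed
  have D: "1 \<le> D n" for n
  proof -
    have "1 \<le> (p / (p - 1)) powr p" using assms(17) by (intro ge_one_powr_ge_zero) auto
    moreover have "1 \<le> exp (2 * (p\<^sup>2 - p) * (s (Suc n) - s n) * (MAX k. \<Sum>j\<in>UNIV. (Re (mu k j))\<^sup>2))"
    proof -
      have "0 \<le> (MAX k. \<Sum>j\<in>UNIV. (Re (mu k j))\<^sup>2)"
        by (rule order_trans[OF _ Max_ge[OF _ rangeI[of _ undefined]]]) (auto intro: sum_nonneg)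
      moreover have "0 \<le> p\<^sup>2 - p" using assms(17) by (simp add: power2_eq_square)
      moreover have "0 \<le> s (Suc n) - s n" using assms(12) by (simp add: strict_mono_less_eq)
      ultimately show ?thesis by simp
    qed
    ultimately show ?thesis unfolding D_def using mult_mono[of 1 "(p / (p - 1)) powr p" 1] by simp
  qed
  have prob: "measure M {\<omega> \<in> space M. (SUP t\<in>{s n..s (Suc n)}. norm (X x t \<omega>)) > eps n * norm x}
      \<le> 1 / ((eps n)\<^sup>2 * (norm x)\<^sup>2) * D n * (\<Sum>k\<in>UNIV. c k * exp (2 * \<theta> k * s n))" for n
  proof -
    let ?S = "\<Sum>k\<in>UNIV. c k * exp (2 * \<theta> k * s n)"
    have "measure M {\<omega> \<in> space M. eps n * norm x < (SUP t\<in>{s n..s (Suc n)}. norm (X x t \<omega>))} \<le> ?S / (eps n * norm x)\<^sup>2"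
      unfolding c_def \<theta>_def
      using assms(11)[of n] assms(12,14,16) \<theta>_neg unfolding \<theta>_def
      by (intro sup_norm_bound assms(6,7,8)) (auto simp: strict_mono_less less_imp_le)
    also have "\<dots> \<le> D n * (?S / (eps n * norm x)\<^sup>2)"
      using mult_right_mono[OF D[of n], of "?S / (eps n * norm x)\<^sup>2"] by (simp add: c_def sum_nonneg)
    finally show ?thesis by (simp add: power_mult_distrib mult_ac)
  qed
  define N where "N = {k. cinner (cvec x) (v k) \<noteq> 0}"
  define Lx where "Lx = (MAX k\<in>N. \<theta> k)"
  have parseval_x: "(\<Sum>k\<in>UNIV. c k) = (norm x)\<^sup>2" unfolding c_def by (rule parseval[OF assms(6)])
  \<comment> \<open>By Parseval some coordinate of the nonzero vector \<open>x\<close> is nonzero;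
    the maximum defining \<open>Lx\<close> therefore runs over a nonempty set.\<close>
  have N: "N \<noteq> {}"
  proof
    assume "N = {}"
    then have "(\<Sum>k\<in>UNIV. c k) = 0" by (auto simp: N_def c_def)
    with parseval_x assms(16) show False by simp
  qed
  have Lx: "Lx < 0" using N \<theta>_neg by (simp add: Lx_def)
  have second: "measure M {\<omega> \<in> space M. (SUP t\<in>{s n..s (Suc n)}. norm (X x t \<omega>)) > eps n * norm x}
      \<le> exp (2 * Lx * s n) / (eps n)\<^sup>2 * D n" for n
  proof -
    have "(\<Sum>k\<in>UNIV. c k * exp (2 * \<theta> k * s n)) \<le> (\<Sum>k\<in>UNIV. c k * exp (2 * Lx * s n))"
    proof (intro sum_mono)
      fix k
      show "c k * exp (2 * \<theta> k * s n) \<le> c k * exp (2 * Lx * s n)"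
      \<comment> \<open>Outside \<open>N\<close> the weight \<open>c k\<close> is 0, so
        \<open>Lx\<close> has to dominate \<open>\<theta> k\<close> only on
        \<open>N\<close>.\<close>
      proof (cases "k \<in> N")
        case True
        then have "\<theta> k \<le> Lx" by (simp add: Lx_def)
        then show ?thesis using assms(11)[of n] by (intro mult_left_mono) (auto simp: c_def)
      qed (simp add: N_def c_def)
    qed
    also have "\<dots> = (norm x)\<^sup>2 * exp (2 * Lx * s n)" by (simp add: sum_distrib_right[symmetric] parseval_x)
    finally have "1 / ((eps n)\<^sup>2 * (norm x)\<^sup>2) * D n * (\<Sum>k\<in>UNIV. c k * exp (2 * \<theta> k * s n)) \<le>
      1 / ((eps n)\<^sup>2 * (norm x)\<^sup>2) * D n * ((norm x)\<^sup>2 * exp (2 * Lx * s n))"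
      using D[of n] by (intro mult_left_mono) auto
    also have "\<dots> = exp (2 * Lx * s n) / (eps n)\<^sup>2 * D n" using assms(16) by simp
    finally show ?thesis using prob[of n] by linarith
  qed
  show ?thesis
    using prob second Lx
    unfolding exponent Let_def c_def D_def Lx_def N_def \<theta>_def by (simp add: mult.assoc)
qed

end
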